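(* For every integer $\lambda\ge 1$, there exists a finite collection of facet-defining graphs such that every facet-defining graph $(G,a)$ with subdefect $\lambda$ is (up to isomorphism of weighted graphs) a unit odd subdivision of a graph in the collection.
   Context: All graphs are finite, simple and undirected. A weighted graph is a pair $(G,a)$ where $G$ is a graph with at least three vertices and $a : V(G)\to \mathbb{Z}$ satisfies $a(v)>0$ for every vertex $v$. For $S\subseteq V(G)$ put $a(S)=\sum_{v\in S}a(v)$ and let $||S||=|E(G[S])|$ be the number of edges of $G$ with both ends in $S$. Let $\beta(G,a)=\max_{S\subseteq V(G)}\{a(S)-||S||\}$. The subdefect of $(G,a)$ is $a(V(G))-2\beta(G,a)$. For a finite set $N$, let $A=\{ij : i,j\in N, i\ne j\}$ be the set of ordered pairs of distinct elements. The linear ordering polytope $P_{\mathrm{LO}}^N\subseteq\mathbb{R}^A$ is the convex hull of the $0/1$ incidence vectors of all strict linear orderings of $N$ (viewed as subsets of $A$). Let $(G,a)$ be a weighted graph with $V=V(G)$, $E=E(G)$, and let $N$ be a finite set containing $V$ and a set $V'$ disjoint from $V$ with a bijection $V\to V'$, $v\mapsto v'$. The graphical inequality of $(G,a)$ is $$\sum_{v\in V}a(v)x_{vv'}-\sum_{vw\in E}(x_{vw'}+x_{wv'})\le\beta(G,a).$$ The weighted graph $(G,a)$ is a facet-defining graph if its graphical inequality defines a facet of $P_{\mathrm{LO}}^N$ (this property does not depend on the choice of $N$). A unit odd subdivision of $(G,a)$ is any weighted graph obtained from $(G,a)$ by replacing edges with odd-length paths (length $1$, i.e. leaving the edge unchanged,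 is allowed; the internal vertices of the paths are new and distinct), where all new vertices have weight $1$ and the original vertices keep their weights. *)

theory Defs
  imports "HOL-Analysis.Analysis" "HOL-Analysis.Finite_Function_Topology"
begin

record 'v wgraph =
  verts :: "'v set"
  edges :: "'v set set"
  weight :: "'v \<Rightarrow> int"

definition weighted_graph :: "'v wgraph \<Rightarrow> bool" where
  "weighted_graph G \<longleftrightarrow>
     finite (verts G) \<and>
     (\<forall>e\<in>edges G. e \<subseteq> verts G \<and> card e = 2) \<and>
     3 \<le> card (verts G) \<and>
     (\<forall>v\<in>verts G. 0 < weight G v)"

definition num_induced_edges :: "'v wgraph \<Rightarrow> 'v set \<Rightarrow> nat" where
  "num_induced_edges G S = card {e \<in> edges G. e \<subseteq> S}"

definition beta :: "'v wgraph \<Rightarrow> int" where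
  "beta G = Max ((\<lambda>S. sum (weight G) S - int (num_induced_edges G S)) ` Pow (verts G))"

definition subdefect :: "'v wgraph \<Rightarrow> int" where
  "subdefect G = sum (weight G) (verts G) - 2 * beta G"

definition wgraph_iso :: "'v wgraph \<Rightarrow> 'w wgraph \<Rightarrow> bool" where
  "wgraph_iso G H \<longleftrightarrow>
     (\<exists>f. bij_betw f (verts G) (verts H) \<and>
          edges H = (\<lambda>e. f ` e) ` edges G \<and>
          (\<forall>v\<in>verts G. weight H (f v) = weight G v))"

text \<open>A path is the list of its vertices, so a path of odd length is a list with an even
  number of entries.\<close>

definition path_edges :: "'v list \<Rightarrow> 'v set set" where
  "path_edges p = {{p ! k, p ! Suc k} | k. Suc k < length p}"

definition internal_verts :: "'v list \<Rightarrow> 'v set" where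
  "internal_verts p = set p - {hd p, last p}"

definition unit_odd_subdivision :: "'v wgraph \<Rightarrow> 'v wgraph \<Rightarrow> bool" where
  "unit_odd_subdivision G H \<longleftrightarrow>
     (\<exists>P :: 'v set \<Rightarrow> 'v list.
        (\<forall>e\<in>edges H. P e \<noteq> [] \<and> distinct (P e) \<and> even (length (P e)) \<and>
                     {hd (P e), last (P e)} = e \<and>
                     internal_verts (P e) \<inter> verts H = {}) \<and>
        (\<forall>e\<in>edges H. \<forall>e'\<in>edges H. e \<noteq> e' \<longrightarrow>
                     internal_verts (P e) \<inter> internal_verts (P e') = {}) \<and>
        verts G = verts H \<union> (\<Union>e\<in>edges H. internal_verts (P e)) \<and>
        edges G = (\<Union>e\<in>edges H. path_edges (P e)) \<and>
        (\<forall>v\<in>verts H. weight G v = weight H v) \<and>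
        (\<forall>v\<in>verts G - verts H. weight G v = 1))"

text \<open>The dimension of the ground space \<open>\<real>\<^sup>A\<close> varies with the graph, so \<open>\<real>\<^sup>A\<close> is rendered as the
  space of finitely supported functions with support in \<open>A\<close>. This space is not of class
  \<open>euclidean_space\<close>, to which the library restricts \<^const>\<open>aff_dim\<close> and \<open>facet_of\<close>; both are
  stated here for arbitrary real vector spaces.\<close>

definition affine_dimension :: "'a::real_vector set \<Rightarrow> int" where
  "affine_dimension S = (if S = {} then - 1 else int (dim {x - y | x y. x \<in> S \<and> y \<in> S}))"

lemma affine_dimension_eq_aff_dim:
  fixes S :: "'a::euclidean_space set"
  shows "affine_dimension S = aff_dim S"
proof (cases "S = {}")
  case True
  then show ?thesis
    by (simp add: affine_dimension_def)
next
  case False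
  then obtain a where a: "a \<in> S"
    by blast
  let ?D = "{x - y | x y. x \<in> S \<and> y \<in> S}"
  let ?T = "(\<lambda>x. x - a) ` S"
  have "x - y \<in> span ?T" if "x \<in> S" "y \<in> S" for x y
  proof -
    have "(x - a) - (y - a) \<in> span ?T"
      using that by (intro span_diff span_base) auto
    then show ?thesis
      by simp
  qed
  then have "?D \<subseteq> span ?T"
    by blast
  moreover have "?T \<subseteq> ?D"
    using a by blast
  ultimately have "span ?D = span ?T"
    by (meson span_mono span_minimal subspace_span subset_antisym)
  then have "dim ?D = dim ?T"
    by (rule span_eq_dim)
  moreover have "aff_dim S = int (dim ?T)"
    by (rule aff_dim_eq_dim_subtract) (simp add: a hull_inc)
  ultimately show ?thesis
    using False by (simp add: affine_dimension_def)
qed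

definition is_facet_of :: "'a::real_vector set \<Rightarrow> 'a set \<Rightarrow> bool" where
  "is_facet_of F P \<longleftrightarrow> F face_of P \<and> F \<noteq> {} \<and> affine_dimension F = affine_dimension P - 1"

lemma is_facet_of_iff_facet_of:
  fixes F P :: "'a::euclidean_space set"
  shows "is_facet_of F P \<longleftrightarrow> F facet_of P"
  by (simp add: is_facet_of_def facet_of_def affine_dimension_eq_aff_dim)

definition defines_facet :: "('a::real_vector \<Rightarrow> real) \<Rightarrow> real \<Rightarrow> 'a set \<Rightarrow> bool" where
  "defines_facet l b P \<longleftrightarrow> (\<forall>x\<in>P. l x \<le> b) \<and> is_facet_of {x \<in> P. l x = b} P"

definition arcs :: "'n set \<Rightarrow> ('n \<times> 'n) set" where
  "arcs N = {(i, j). i \<in> N \<and> j \<in> N \<and> i \<noteq> j}"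

definition incidence_vector :: "'i set \<Rightarrow> 'i \<Rightarrow>\<^sub>0 real" where
  "incidence_vector L = (\<Sum>p\<in>L. Poly_Mapping.single p 1)"

lemma lookup_incidence_vector:
  assumes "finite L"
  shows "Poly_Mapping.lookup (incidence_vector L) p = (if p \<in> L then 1 else 0)"
  using assms by (simp add: incidence_vector_def lookup_sum lookup_single when_def)

definition linear_ordering_polytope :: "'n set \<Rightarrow> ('n \<times> 'n \<Rightarrow>\<^sub>0 real) set" where
  "linear_ordering_polytope N =
     convex hull (incidence_vector ` {L. L \<subseteq> arcs N \<and> strict_linear_order_on N L})"

text \<open>The ground set \<open>N\<close> contains the vertices through \<open>i\<close> and their primed copies through \<open>i'\<close>.\<close>

definition ground_set_for :: "'n set \<Rightarrow> ('v \<Rightarrow> 'n) \<Rightarrow> ('v \<Rightarrow> 'n) \<Rightarrow> 'v set \<Rightarrow> bool" where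
  "ground_set_for N i i' V \<longleftrightarrow>
     finite N \<and> inj_on i V \<and> inj_on i' V \<and> i ` V \<inter> i' ` V = {} \<and> i ` V \<union> i' ` V \<subseteq> N"

text \<open>Each edge occurs as two ordered pairs in the second sum, which yields both of its terms.\<close>

definition graphical_lhs ::
    "('v \<Rightarrow> 'n) \<Rightarrow> ('v \<Rightarrow> 'n) \<Rightarrow> 'v wgraph \<Rightarrow> ('n \<times> 'n \<Rightarrow>\<^sub>0 real) \<Rightarrow> real" where
  "graphical_lhs i i' G x =
     (\<Sum>v\<in>verts G. of_int (weight G v) * Poly_Mapping.lookup x (i v, i' v))
     - (\<Sum>(v, w)\<in>{(v, w). v \<in> verts G \<and> w \<in> verts G \<and> {v, w} \<in> edges G}.
          Poly_Mapping.lookup x (i v, i' w))"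

text \<open>Whether the graphical inequality defines a facet does not depend on the ground set. Every
  finite ground set can be renamed into the natural numbers, so the quantifier covers all of them.\<close>

definition facet_defining_graph :: "'v wgraph \<Rightarrow> bool" where
  "facet_defining_graph G \<longleftrightarrow>
     weighted_graph G \<and>
     (\<exists>(N :: nat set) i i'. ground_set_for N i i' (verts G) \<and>
        defines_facet (graphical_lhs i i' G) (of_int (beta G)) (linear_ordering_polytope N))"

end

theory Submission
  imports Defs "HOL-Library.Ramsey"
begin

text \<open>If the graphical inequality of \<open>(G, a)\<close> defines a facet, then \<open>(a, 1)\<close> is, up to scaling, the
  only functional that is constant on the tight sets. Taking \<open>a v\<close> copies of every vertex \<open>v\<close>,
  subdividing every edge into three and deleting edges as long as the stability number stays the
  same turns \<open>G\<close> into an alpha-critical graph \<open>H\<close> whose defect is the subdefect \<open>lam\<close>.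

  In \<open>H\<close> a maximum stable set misses boundedly many edges, by Ramsey's theorem and
  supermodularity of \<open>A \<mapsto> |A| - |N A|\<close>. Hence the maximum stable sets fall into boundedly many
  classes, each a distributive lattice with a perfect matching on its moving vertices. Two of these
  matchings alternate along boundedly many paths, and along such a path the orders of the two
  lattices are opposite. Three orders cannot be pairwise opposite, so few vertices of \<open>H\<close> have
  degree at least 3.

  Lanes of vertices of degree 2 through several copies of one vertex of \<open>G\<close> violate the uniqueness of
  the functional if there are too many of them, so all but boundedly many vertices of \<open>G\<close> have weight 1
  and degree 2. The remaining freedom is a vector of path lengths, and Dickson's lemma applies.\<close>

section \<open>Missed edges of critical graphs\<close>

text \<open>The two halves of the argument speak about different graphs. Criticality, and with it
  every Ramsey and lattice bound, lives in the auxiliary graph \<open>H\<close>; the facet condition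
  lives in \<open>G\<close> and controls the copies of a vertex only through their sum. So few
  vertices of degree at least 3 in \<open>H\<close> say nothing yet about \<open>G\<close>: a vertex
  of huge weight or degree could be spread over many copies of degree 2. The lanes close this gap.
  On a path of vertices of degree 2 a maximum stable set alternates, up to at most one missed edge,
  so the number of vertices that it selects there depends only on the ends. If the ends are copies
  of the same vertices, this yields functionals that are constant on the tight sets without being
  multiples of \<open>(a, 1)\<close>.

  Subdividing trades the penalty for an edge inside \<open>S\<close> for a lost vertex, which turns
  \<open>a(S) - ||S||\<close> into the size of a stable set.

  It is not shown that contracting long paths keeps a graph facet-defining. Hence the collection
  does not consist of contracted graphs but of members of the class whose path lengths are
  minimal.\<close>

definition stable_in :: "'x set \<Rightarrow> ('x \<Rightarrow> 'x \<Rightarrow> bool) \<Rightarrow> 'x set \<Rightarrow> bool" where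
  "stable_in X adj S \<longleftrightarrow> S \<subseteq> X \<and> (\<forall>x\<in>S. \<forall>y\<in>S. \<not> adj x y)"

text \<open>\<open>critical\<close> is the form in which criticality gets used: once the edge x y is
  deleted, some larger stable set contains both ends, and dropping either end leaves two maximum
  stable sets that differ by one swap. \<open>lam\<close> is the defect.\<close>

locale alpha_critical =
  fixes X :: "'x set" and adj :: "'x \<Rightarrow> 'x \<Rightarrow> bool" and \<alpha> lam :: nat
  assumes finite_X: "finite X"
    and adj_sym: "adj x y \<Longrightarrow> adj y x"
    and adj_irrefl: "\<not> adj x x"
    and adj_in: "adj x y \<Longrightarrow> x \<in> X"
    and no_isolated: "x \<in> X \<Longrightarrow> \<exists>y. adj x y"
    and stable_bound: "stable_in X adj S \<Longrightarrow> card S \<le> \<alpha>"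
    and critical: "adj x y \<Longrightarrow> \<exists>R. x \<notin> R \<and> y \<notin> R \<and>
        stable_in X adj (insert x R) \<and> card (insert x R) = \<alpha> \<and>
        stable_in X adj (insert y R) \<and> card (insert y R) = \<alpha>"
    and card_X: "card X = 2 * \<alpha> + lam"
begin

abbreviation "indset \<equiv> stable_in X adj"

definition "tight T \<longleftrightarrow> indset T \<and> card T = \<alpha>"
definition "nbrs S = {y. \<exists>x\<in>S. adj x y}"
definition "missed T = {{x, y} |x y. adj x y \<and> x \<notin> T \<and> y \<notin> T}"

lemma adj_in2: "adj x y \<Longrightarrow> y \<in> X"
  using adj_in adj_sym by blast

lemma stable_sub: "indset S \<Longrightarrow> S \<subseteq> X"
  by (simp add: stable_in_def)

lemma stableD: "indset S \<Longrightarrow> x \<in> S \<Longrightarrow> y \<in> S \<Longrightarrow> \<not> adj x y"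
  by (simp add: stable_in_def)

lemma stable_finite: "indset S \<Longrightarrow> finite S"
  using finite_X finite_subset stable_sub by blast

lemma stable_mono: "indset S \<Longrightarrow> S' \<subseteq> S \<Longrightarrow> indset S'"
  unfolding stable_in_def by blast

lemma tight_stable: "tight T \<Longrightarrow> indset T" by (simp add: tight_def)
lemma tight_card: "tight T \<Longrightarrow> card T = \<alpha>" by (simp add: tight_def)
lemma tight_finite: "tight T \<Longrightarrow> finite T" using tight_stable stable_finite by blast
lemma tight_sub: "tight T \<Longrightarrow> T \<subseteq> X" using tight_stable stable_sub by blast

lemma nbrs_sub: "nbrs S \<subseteq> X"
  unfolding nbrs_def using adj_in2 by blast

lemma finite_nbrs: "finite (nbrs S)"
  using nbrs_sub finite_X finite_subset by blast

lemma critical_swap: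
  assumes "adj x y"
  obtains R where "x \<notin> R" "y \<notin> R" "tight (insert x R)" "tight (insert y R)"
  using critical[OF assms] unfolding tight_def by blast

lemma stable_exchange:
  assumes T: "indset T" and S: "indset S"
  shows "indset ((T - nbrs S) \<union> S)"
  using assms unfolding stable_in_def nbrs_def using adj_sym by blast

text \<open>Take x in S, a neighbour y and the swap R of the edge x y. The part of S outside
  \<open>insert x R\<close> is paid for by an exchange, the part inside R by induction, and x by y,
  which is no neighbour of \<open>S \<inter> R\<close> because \<open>insert y R\<close> is
  stable.\<close>

lemma stable_card_le_nbrs: "indset S \<Longrightarrow> card S \<le> card (nbrs S)"
proof (induction "card S" arbitrary: S rule: less_induct)
  case less
  show ?case
  proof (cases "S = {}")
    case False
    then obtain x where x: "x \<in> S" by blast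
    then have "x \<in> X" using less.prems stable_sub by blast
    then obtain y where xy: "adj x y" using no_isolated by blast
    obtain R where R: "x \<notin> R" "y \<notin> R" "tight (insert x R)" "tight (insert y R)"
      using critical_swap[OF xy] .
    have fin: "finite S" "finite R"
      using less.prems stable_finite tight_finite[OF R(3)] by auto
    let ?Q = "insert x R"
    have "S \<inter> nbrs S = {}"
      using less.prems unfolding nbrs_def stable_in_def by blast
    then have *: "?Q - nbrs S \<union> S = (?Q \<union> S) - (nbrs S \<inter> ?Q)"
      by blast
    have "card (?Q - nbrs S \<union> S) \<le> \<alpha>"
      using stable_bound stable_exchange[OF tight_stable[OF R(3)] less.prems] by blast
    moreover have "card (?Q - nbrs S \<union> S) = card (?Q \<union> S) - card (nbrs S \<inter> ?Q)"
      unfolding * by (rule card_Diff_subset) (use fin in auto)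
    moreover have "card (?Q \<union> S) = card ?Q + card (S - ?Q)"
      using card_Un_disjoint[of ?Q "S - ?Q"] fin by (simp add: Un_Diff_cancel)
    ultimately have 1: "card (S - ?Q) \<le> card (nbrs S \<inter> ?Q)"
      using tight_card[OF R(3)] by linarith
    have "S \<inter> R \<subset> S" using x R(1) by blast
    then have "card (S \<inter> R) < card S" using fin psubset_card_mono by blast
    then have 2: "card (S \<inter> R) \<le> card (nbrs (S \<inter> R))"
      using less.hyps less.prems stable_mono by blast
    have y_notin: "y \<notin> nbrs (S \<inter> R)"
      using stableD[OF tight_stable[OF R(4)]] unfolding nbrs_def by blast
    have disj: "?Q \<inter> nbrs (S \<inter> R) = {}"
      using stableD[OF tight_stable[OF R(3)]] unfolding nbrs_def by blast
    have "y \<notin> ?Q" using xy R adj_irrefl by auto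
    have "(nbrs S \<inter> ?Q) \<union> insert y (nbrs (S \<inter> R)) \<subseteq> nbrs S"
      using x xy unfolding nbrs_def by blast
    then have "card ((nbrs S \<inter> ?Q) \<union> insert y (nbrs (S \<inter> R))) \<le> card (nbrs S)"
      using finite_nbrs card_mono by blast
    moreover have "card ((nbrs S \<inter> ?Q) \<union> insert y (nbrs (S \<inter> R)))
        = card (nbrs S \<inter> ?Q) + (1 + card (nbrs (S \<inter> R)))"
      using y_notin disj \<open>y \<notin> ?Q\<close> finite_nbrs fin
      by (subst card_Un_disjoint) auto
    moreover have "card S = card (S - ?Q) + (1 + card (S \<inter> R))"
    proof -
      have "S = (S - ?Q) \<union> insert x (S \<inter> R)" using x by blast
      then have "card S = card ((S - ?Q) \<union> insert x (S \<inter> R))" by simp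
      also have "\<dots> = card (S - ?Q) + card (insert x (S \<inter> R))"
        by (rule card_Un_disjoint) (use fin in auto)
      finally show ?thesis using R(1) fin by simp
    qed
    ultimately show ?thesis using 1 2 by linarith
  qed simp
qed

text \<open>The stable set \<open>T - nbrs A\<close> has no neighbour in T or in A, so its
  neighbours are among the remaining \<open>\<alpha> + lam - card A\<close> vertices, and there are
  at least as many of them as members.\<close>

lemma card_nbrs_excess:
  assumes T: "tight T" and A: "A \<subseteq> X - T"
  shows "card A \<le> card (nbrs A \<inter> T) + lam"
proof -
  let ?S = "T - nbrs A"
  have fT: "finite T" using T tight_finite by blast
  have "nbrs ?S \<subseteq> X - T - A"
  proof
    fix y assume y: "y \<in> nbrs ?S"
    then obtain x where x: "x \<in> T" "x \<notin> nbrs A" "adj x y" unfolding nbrs_def by blast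
    have "y \<notin> T" using stableD[OF tight_stable[OF T] x(1)] x(3) by blast
    moreover have "y \<notin> A" using x(2,3) adj_sym unfolding nbrs_def by blast
    ultimately show "y \<in> X - T - A" using y nbrs_sub by blast
  qed
  then have "card (nbrs ?S) \<le> card (X - T - A)"
    using finite_X by (intro card_mono) auto
  also have "\<dots> = card X - card T - card A"
    using A finite_X fT tight_sub[OF T] by (simp add: card_Diff_subset finite_subset)
  finally have "card (nbrs ?S) \<le> card X - card T - card A" .
  moreover have "card ?S \<le> card (nbrs ?S)"
    using stable_card_le_nbrs stable_mono[OF tight_stable[OF T]] by blast
  moreover have "card ?S = card T - card (nbrs A \<inter> T)"
    by (metis Diff_Int2 Int_absorb Int_commute card_Diff_subset_Int fT finite_Int)
  moreover have "card A \<le> card (X - T)"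
    using A finite_X by (simp add: card_mono)
  then have "card A \<le> card X - card T"
    using fT tight_sub[OF T] by (simp add: card_Diff_subset)
  moreover have "card (nbrs A \<inter> T) \<le> card T" using fT by (simp add: card_mono)
  ultimately show ?thesis using card_X tight_card[OF T] by linarith
qed

lemma stable_card_le_nbrs_tight:
  assumes T: "tight T" and A: "indset A" "A \<inter> T = {}"
  shows "card A \<le> card (nbrs A \<inter> T)"
proof -
  have fin: "finite T" "finite A" using T tight_finite A stable_finite by auto
  have "card (T - nbrs A \<union> A) \<le> \<alpha>"
    using stable_bound stable_exchange[OF tight_stable[OF T] A(1)] by blast
  moreover have "card (T - nbrs A \<union> A) = card (T - nbrs A) + card A"
    by (rule card_Un_disjoint) (use A fin in auto)
  moreover have "card (T - nbrs A) = card T - card (nbrs A \<inter> T)"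
    by (metis Diff_Int2 Int_absorb Int_commute card_Diff_subset_Int fin(1) finite_Int)
  moreover have "card (nbrs A \<inter> T) \<le> card T" using fin by (simp add: card_mono)
  ultimately show ?thesis using tight_card[OF T] by linarith
qed

lemma nbrs_Un: "nbrs (A \<union> B) = nbrs A \<union> nbrs B"
  unfolding nbrs_def by blast

text \<open>The excess \<open>card A - card (nbrs A \<inter> T)\<close> is supermodular, at most
  \<open>lam\<close> outside T, and at most 0 on stable sets disjoint from T. Each new
  \<open>A b\<close> raises the excess of the union by at least 1, since its intersection with the
  earlier union avoids \<open>z b\<close> and is therefore stable.\<close>

lemma chain_bound:
  fixes A :: "nat \<Rightarrow> 'x set" and K :: "nat set"
  assumes T: "tight T" and K: "finite K"
    and sub: "\<And>i. i \<in> K \<Longrightarrow> A i \<subseteq> X - T"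
    and one: "\<And>i. i \<in> K \<Longrightarrow> card (nbrs (A i) \<inter> T) + 1 \<le> card (A i)"
    and stab: "\<And>i x. i \<in> K \<Longrightarrow> z i \<notin> x \<Longrightarrow> x \<subseteq> A i \<Longrightarrow> indset x"
    and sep: "\<And>i j. i \<in> K \<Longrightarrow> j \<in> K \<Longrightarrow> i < j \<Longrightarrow> z j \<notin> A i"
  shows "card K \<le> lam"
proof -
  have "card (nbrs (\<Union>(A ` K)) \<inter> T) + card K \<le> card (\<Union>(A ` K))"
    using K sub one stab sep
  proof (induction K rule: finite_linorder_max_induct)
    case (insert b K)
    let ?U = "\<Union>(A ` K)"
    have IH: "card (nbrs ?U \<inter> T) + card K \<le> card ?U"
    proof (rule insert.IH)
      show "indset x" if "i \<in> K" "z i \<notin> x" "x \<subseteq> A i" for i x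
        using insert.prems(3)[OF _ that(2,3)] that(1) by blast
      show "A i \<subseteq> X - T" if "i \<in> K" for i
        using insert.prems(1)[of i] that by simp
      show "card (nbrs (A i) \<inter> T) + 1 \<le> card (A i)" if "i \<in> K" for i
        using insert.prems(2)[of i] that by simp
      show "z j \<notin> A i" if "i \<in> K" "j \<in> K" "i < j" for i j
        using insert.prems(4)[of i j] that by simp
    qed
    have Ub: "?U \<subseteq> X - T" "A b \<subseteq> X - T" using insert.prems(1) by auto
    have fin: "finite ?U" "finite (A b)" using Ub finite_X finite_subset by blast+
    have "z b \<notin> ?U" using insert by auto
    then have "indset (?U \<inter> A b)" using insert.prems(3)[of b "?U \<inter> A b"] by auto
    then have 1: "card (?U \<inter> A b) \<le> card (nbrs (?U \<inter> A b) \<inter> T)"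
      using stable_card_le_nbrs_tight[OF T] Ub by blast
    have "nbrs (?U \<inter> A b) \<inter> T \<subseteq> (nbrs ?U \<inter> T) \<inter> (nbrs (A b) \<inter> T)"
      unfolding nbrs_def by blast
    then have 2: "card (nbrs (?U \<inter> A b) \<inter> T) \<le> card ((nbrs ?U \<inter> T) \<inter> (nbrs (A b) \<inter> T))"
      using finite_nbrs by (intro card_mono) auto
    have 3: "card (?U \<union> A b) + card (?U \<inter> A b) = card ?U + card (A b)"
      using card_Un_Int[OF fin] by simp
    have 4: "card ((nbrs ?U \<inter> T) \<union> (nbrs (A b) \<inter> T)) + card ((nbrs ?U \<inter> T) \<inter> (nbrs (A b) \<inter> T))
       = card (nbrs ?U \<inter> T) + card (nbrs (A b) \<inter> T)"
      using card_Un_Int[of "nbrs ?U \<inter> T" "nbrs (A b) \<inter> T"] finite_nbrs by simp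
    have 5: "card (nbrs (A b) \<inter> T) + 1 \<le> card (A b)" using insert.prems by auto
    have 6: "nbrs (\<Union>(A ` insert b K)) \<inter> T = (nbrs ?U \<inter> T) \<union> (nbrs (A b) \<inter> T)"
      by (simp add: nbrs_Un) blast
    have 7: "\<Union>(A ` insert b K) = ?U \<union> A b" by auto
    have "b \<notin> K" using insert.hyps by auto
    then have 8: "card (insert b K) = card K + 1" using insert.hyps by simp
    show ?case unfolding 6 unfolding 7 8 using IH 1 2 3 4 5 by linarith
  qed (simp add: nbrs_def)
  moreover have "card (\<Union>(A ` K)) \<le> card (nbrs (\<Union>(A ` K)) \<inter> T) + lam"
    by (rule card_nbrs_excess[OF T]) (use sub in blast)
  ultimately show ?thesis by linarith
qed

end

text \<open>A Ramsey number for homogeneous sets of \<open>lam + 1\<close> elements, one more than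
  \<open>chain_bound\<close> permits.\<close>

definition missed_limit :: "nat \<Rightarrow> nat" where
  "missed_limit lam = (SOME r. \<forall>(V::nat set) (E::nat set set). finite V \<and> card V \<ge> r \<longrightarrow>
     (\<exists>R \<subseteq> V. card R = Suc lam \<and> clique R E \<or> card R = Suc lam \<and> indep R E))"

lemma missed_limit:
  fixes V :: "nat set"
  assumes "finite V" "card V \<ge> missed_limit lam"
  shows "\<exists>R \<subseteq> V. card R = Suc lam \<and> (clique R E \<or> indep R E)"
proof -
  have "\<exists>r. \<forall>(V::nat set) (E::nat set set). finite V \<and> card V \<ge> r \<longrightarrow>
     (\<exists>R \<subseteq> V. card R = Suc lam \<and> clique R E \<or> card R = Suc lam \<and> indep R E)"
    using ramsey2[of "Suc lam" "Suc lam", where 'a = nat] by blast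
  from someI_ex[OF this] show ?thesis
    using assms unfolding missed_limit_def by blast
qed

context alpha_critical
begin

lemma finite_missed: "finite (missed T)"
proof -
  have "missed T \<subseteq> Pow X"
    unfolding missed_def using adj_in adj_in2 by auto
  then show ?thesis using finite_X finite_subset by blast
qed

text \<open>A missed edge x y with its swap R gives a set of \<open>\<alpha> + 1\<close> vertices
  that spans no other edge, and its part outside T has positive excess. For two such edges at least
  one end of the later one avoids the part of the earlier one; Ramsey's theorem makes the choice of
  this end uniform on \<open>lam + 1\<close> edges, against \<open>chain_bound\<close>.\<close>

lemma card_missed_less:
  assumes T: "tight T"
  shows "card (missed T) < missed_limit lam"
proof (rule ccontr)
  assume contr: "\<not> ?thesis"
  define m where "m = card (missed T)"
  obtain h where h: "bij_betw h {0..<m} (missed T)"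
    using ex_bij_betw_nat_finite[OF finite_missed[of T]] unfolding m_def by blast
  have "\<forall>i\<in>{0..<m}. \<exists>x y R. h i = {x, y} \<and> adj x y \<and> x \<notin> T \<and> y \<notin> T \<and> x \<notin> R \<and> y \<notin> R
      \<and> tight (insert x R) \<and> tight (insert y R)"
  proof
    fix i assume "i \<in> {0..<m}"
    then have "h i \<in> missed T" using h bij_betwE by blast
    then obtain x y where xy: "h i = {x, y}" "adj x y" "x \<notin> T" "y \<notin> T"
      unfolding missed_def by blast
    then show "\<exists>x y R. h i = {x, y} \<and> adj x y \<and> x \<notin> T \<and> y \<notin> T \<and> x \<notin> R \<and> y \<notin> R
      \<and> tight (insert x R) \<and> tight (insert y R)"
      using critical_swap[OF xy(2)] by metis
  qed
  then obtain x y R where xyR: "\<And>i. i \<in> {0..<m} \<Longrightarrow> h i = {x i, y i} \<and> adj (x i) (y i) \<and> x i \<notin> T \<and> y i \<notin> T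
      \<and> x i \<notin> R i \<and> y i \<notin> R i \<and> tight (insert (x i) (R i)) \<and> tight (insert (y i) (R i))"
    unfolding bchoice_iff by metis
  define Q where "Q i = insert (x i) (insert (y i) (R i))" for i
  define A where "A i = Q i - T" for i
  have Qadj: "{v, w} = {x i, y i}" if i: "i \<in> {0..<m}" and vw: "v \<in> Q i" "w \<in> Q i" "adj v w" for i v w
  proof -
    have "\<not> (v \<in> insert (x i) (R i) \<and> w \<in> insert (x i) (R i))"
      "\<not> (v \<in> insert (y i) (R i) \<and> w \<in> insert (y i) (R i))"
      using xyR[OF i] vw(3) stableD[OF tight_stable] by blast+
    then have "v = x i \<and> w = y i \<or> v = y i \<and> w = x i"
      using vw unfolding Q_def by (elim insertE) simp_all
    then show ?thesis by auto
  qed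
  have QX: "Q i \<subseteq> X" if "i \<in> {0..<m}" for i
    using xyR[OF that] tight_sub unfolding Q_def by blast
  have cardQ: "card (Q i) = \<alpha> + 1" if "i \<in> {0..<m}" for i
  proof -
    have "x i \<noteq> y i" using xyR[OF that] adj_irrefl by metis
    then show ?thesis
      using xyR[OF that] tight_card tight_finite unfolding Q_def
      by (metis One_nat_def add.commute card_insert_disjoint insert_iff plus_1_eq_Suc)
  qed
  \<comment> \<open>The only edge inside \<open>Q i\<close> has no end in T, so
    \<open>nbrs (A i)\<close> meets T outside \<open>Q i\<close>. The two parts of T together have
    at most \<alpha> elements, whereas \<open>Q i\<close> has one more.\<close>
  have one: "card (nbrs (A i) \<inter> T) + 1 \<le> card (A i)" if i: "i \<in> {0..<m}" for i
  proof -
    have fQ: "finite (Q i)" using QX[OF i] finite_X finite_subset by blast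
    have "(Q i \<inter> T) \<inter> (nbrs (A i) \<inter> T) = {}"
    proof (rule ccontr)
      assume "\<not> ?thesis"
      then obtain t a where t: "t \<in> Q i" "t \<in> T" "a \<in> A i" "adj a t"
        unfolding nbrs_def by blast
      then have "{a, t} = {x i, y i}" using Qadj[OF i] unfolding A_def by blast
      then have "t \<in> {x i, y i}" by blast
      then show False using t(2) xyR[OF i] by blast
    qed
    then have "card (Q i \<inter> T) + card (nbrs (A i) \<inter> T) = card ((Q i \<inter> T) \<union> (nbrs (A i) \<inter> T))"
      using fQ finite_nbrs by (simp add: card_Un_disjoint)
    also have "\<dots> \<le> card T" using tight_finite[OF T] by (intro card_mono) auto
    finally have "card (Q i \<inter> T) + card (nbrs (A i) \<inter> T) \<le> \<alpha>" using tight_card[OF T] by simp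
    moreover have "card (Q i) = card (Q i \<inter> T) + card (A i)"
      unfolding A_def using card_Int_Diff[OF fQ] by blast
    ultimately show ?thesis using cardQ[OF i] by linarith
  qed
  \<comment> \<open>A pair in E can use the end \<open>x j\<close>. For any other pair
    \<open>x j\<close> lies in \<open>A i\<close>, and then \<open>y j\<close> does not, because
    \<open>A i\<close> spans no edge but its own.\<close>
  define E where "E = {{i, j} |i j. i < j \<and> x j \<notin> A i}"
  obtain K where K: "K \<subseteq> {0..<m}" "card K = Suc lam" "clique K E \<or> indep K E"
    using missed_limit[of "{0..<m}" lam E] contr unfolding m_def by auto
  have not_both: "\<not> (x j \<in> A i \<and> y j \<in> A i)" if "i \<in> {0..<m}" "j \<in> {0..<m}" "i \<noteq> j" for i j
  proof
    assume "x j \<in> A i \<and> y j \<in> A i"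
    then have "{x j, y j} = {x i, y i}" using Qadj[OF that(1)] xyR[OF that(2)] unfolding A_def by blast
    then have "h i = h j" using xyR that by simp
    then show False using h that unfolding bij_betw_def inj_on_def by blast
  qed
  have "\<exists>z. (\<forall>i\<in>K. z i \<in> {x i, y i}) \<and> (\<forall>i\<in>K. \<forall>j\<in>K. i < j \<longrightarrow> z j \<notin> A i)"
    using K(3)
  proof
    assume c: "clique K E"
    have "x j \<notin> A i" if "i \<in> K" "j \<in> K" "i < j" for i j
    proof -
      have "{i, j} \<in> E" using c that unfolding clique_def by auto
      then show ?thesis unfolding E_def using that(3) by (auto simp: doubleton_eq_iff)
    qed
    then show ?thesis by (intro exI[of _ x]) auto
  next
    assume c: "indep K E"
    have "y j \<notin> A i" if "i \<in> K" "j \<in> K" "i < j" for i j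
    proof -
      have "{i, j} \<notin> E" using c that unfolding indep_def by auto
      then have "x j \<in> A i" unfolding E_def using that(3) by auto
      then show ?thesis using not_both[of i j] that K(1) by auto
    qed
    then show ?thesis by (intro exI[of _ y]) auto
  qed
  then obtain z where z: "\<And>i. i \<in> K \<Longrightarrow> z i \<in> {x i, y i}"
    and zA: "\<And>i j. i \<in> K \<Longrightarrow> j \<in> K \<Longrightarrow> i < j \<Longrightarrow> z j \<notin> A i" by blast
  have "card K \<le> lam"
  proof (rule chain_bound[OF T _ _ _ _ zA])
    show "finite K" using K(1) finite_subset by blast
    show "A i \<subseteq> X - T" if "i \<in> K" for i using that QX K(1) unfolding A_def by blast
    show "card (nbrs (A i) \<inter> T) + 1 \<le> card (A i)" if "i \<in> K" for i using that one K(1) by blast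
    show "indset B" if "i \<in> K" "z i \<notin> B" "B \<subseteq> A i" for i B
      unfolding stable_in_def
    proof (intro conjI ballI notI)
      show "B \<subseteq> X" using that QX K(1) unfolding A_def by blast
      fix v w assume vw: "v \<in> B" "w \<in> B" "adj v w"
      then have "{v, w} = {x i, y i}" using that Qadj[of i v w] K(1) unfolding A_def by blast
      then have "z i \<in> {v, w}" using z[OF that(1)] by simp
      then show False using vw that(2) by blast
    qed
  qed
  then show False using K(2) by simp
qed

text \<open>For the swap R of an edge x y, the set \<open>insert y R\<close> misses every other edge
  at x: R contains no neighbour of x, as \<open>insert x R\<close> is stable.\<close>

lemma degree_bound: "card {y. adj x y} \<le> missed_limit lam"
proof (cases "\<exists>y. adj x y")
  case True
  then obtain y where xy: "adj x y" by blast
  obtain R where R: "x \<notin> R" "y \<notin> R" "tight (insert x R)" "tight (insert y R)"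
    using critical_swap[OF xy] .
  have "(\<lambda>z. {x, z}) ` ({z. adj x z} - {y}) \<subseteq> missed (insert y R)"
  proof
    fix e assume "e \<in> (\<lambda>z. {x, z}) ` ({z. adj x z} - {y})"
    then obtain z where z: "e = {x, z}" "adj x z" "z \<noteq> y" by blast
    have "x \<noteq> y" using xy adj_irrefl by metis
    moreover have "z \<notin> R" using stableD[OF tight_stable[OF R(3)], of x z] z by blast
    ultimately show "e \<in> missed (insert y R)" using z R unfolding missed_def by blast
  qed
  then have "card ((\<lambda>z. {x, z}) ` ({z. adj x z} - {y})) \<le> card (missed (insert y R))"
    using finite_missed card_mono by blast
  moreover have "card ((\<lambda>z. {x, z}) ` ({z. adj x z} - {y})) = card ({z. adj x z} - {y})"
    by (rule card_image) (auto simp: inj_on_def doubleton_eq_iff)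
  moreover have "finite {z. adj x z}"
    using finite_X adj_in2 by (metis finite_subset mem_Collect_eq subsetI)
  ultimately show ?thesis using card_missed_less[OF R(4)] xy by (simp add: card_Diff_singleton)
qed simp

end

section \<open>Vertices of degree at least three\<close>

lemma hall_marriage:
  assumes "finite A" "\<And>a. a \<in> A \<Longrightarrow> finite (N a)"
    and "\<And>S. S \<subseteq> A \<Longrightarrow> card S \<le> card (\<Union>(N ` S))"
  shows "\<exists>f. inj_on f A \<and> (\<forall>a\<in>A. f a \<in> N a)"
  using assms
proof (induction "card A" arbitrary: A N rule: less_induct)
  case less
  note finA = less.prems(1) and finN = less.prems(2) and hall = less.prems(3)
  have finU: "finite (\<Union>(N ` S))" if "S \<subseteq> A" for S
  proof (rule finite_UN_I)
    show "finite S" using that finA finite_subset by blast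
  qed (use that finN in auto)
  show ?case
  proof (cases "A = {}")
    case False
    show ?thesis
    \<comment> \<open>A proper subfamily with no spare neighbour is matched by itself, and its
      neighbours are removed; Hall's condition for a union with it gives the condition for the rest.
      If there is no such subfamily, every proper subfamily can afford to lose one neighbour, so any
      single pair may be matched first.\<close>
    proof (cases "\<exists>S. S \<subset> A \<and> S \<noteq> {} \<and> card (\<Union>(N ` S)) \<le> card S")
      case True
      then obtain S where S: "S \<subset> A" "S \<noteq> {}" "card (\<Union>(N ` S)) \<le> card S" by blast
      let ?U = "\<Union>(N ` S)"
      have finS: "finite S" using S(1) finA finite_subset by blast
      obtain f where f: "inj_on f S" "\<forall>a\<in>S. f a \<in> N a"
      proof -
        have "\<exists>f. inj_on f S \<and> (\<forall>a\<in>S. f a \<in> N a)"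
        proof (rule less.hyps)
          show "card S < card A" using S(1) finA psubset_card_mono by blast
          show "finite (N a)" if "a \<in> S" for a using that S(1) finN by blast
          show "card B \<le> card (\<Union>(N ` B))" if "B \<subseteq> S" for B using that S(1) hall[of B] by blast
        qed (fact finS)
        then show ?thesis using that by blast
      qed
      have "\<exists>g. inj_on g (A - S) \<and> (\<forall>a\<in>A - S. g a \<in> N a - ?U)"
      proof (rule less.hyps)
        show "card (A - S) < card A"
          using S(1,2) finA by (intro psubset_card_mono) auto
        show "finite (A - S)" using finA by simp
        show "finite (N a - ?U)" if "a \<in> A - S" for a using that finN by blast
        show "card B \<le> card (\<Union>a\<in>B. N a - ?U)" if B: "B \<subseteq> A - S" for B
        proof -
          have finB: "finite B" using B finA finite_subset by blast
          have "card S + card B = card (S \<union> B)"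
            by (rule card_Un_disjoint[symmetric]) (use finS finB B in auto)
          also have "\<dots> \<le> card (\<Union>(N ` (S \<union> B)))" using hall[of "S \<union> B"] B S(1) by blast
          also have "\<Union>(N ` (S \<union> B)) = ?U \<union> (\<Union>a\<in>B. N a - ?U)" by blast
          also have "card \<dots> \<le> card ?U + card (\<Union>a\<in>B. N a - ?U)" by (rule card_Un_le)
          finally show ?thesis using S(3) by linarith
        qed
      qed
      then obtain g where g: "inj_on g (A - S)" "\<forall>a\<in>A - S. g a \<in> N a - ?U" by blast
      define h where "h a = (if a \<in> S then f a else g a)" for a
      have "inj_on h A"
      proof (rule inj_onI)
        fix a b assume ab: "a \<in> A" "b \<in> A" "h a = h b"
        have *: "f a' \<in> ?U" if "a' \<in> S" for a' using f(2) that by blast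
        have **: "g a' \<notin> ?U" if "a' \<in> A - S" for a' using g(2) that by blast
        show "a = b"
        proof (cases "a \<in> S"; cases "b \<in> S")
          assume "a \<in> S" "b \<in> S"
          then show ?thesis using ab(3) f(1) unfolding h_def inj_on_def by simp
        next
          assume "a \<in> S" "b \<notin> S"
          then show ?thesis using ab *[of a] **[of b] unfolding h_def by simp
        next
          assume "a \<notin> S" "b \<in> S"
          then show ?thesis using ab *[of b] **[of a] unfolding h_def by simp
        next
          assume "a \<notin> S" "b \<notin> S"
          then show ?thesis using ab g(1) unfolding h_def inj_on_def by simp
        qed
      qed
      moreover have "\<forall>a\<in>A. h a \<in> N a" using f(2) g(2) unfolding h_def by auto
      ultimately show ?thesis by blast
    next
      case no: False
      obtain a where a: "a \<in> A" using False by blast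
      have "card {a} \<le> card (N a)" using hall[of "{a}"] a by simp
      then have "N a \<noteq> {}" by auto
      then obtain b where b: "b \<in> N a" by blast
      have "\<exists>g. inj_on g (A - {a}) \<and> (\<forall>x\<in>A - {a}. g x \<in> N x - {b})"
      proof (rule less.hyps)
        show "card (A - {a}) < card A" by (rule card_Diff1_less[OF finA a])
        show "finite (A - {a})" using finA by simp
        show "finite (N x - {b})" if "x \<in> A - {a}" for x using that finN by blast
        show "card B \<le> card (\<Union>x\<in>B. N x - {b})" if B: "B \<subseteq> A - {a}" for B
        proof (cases "B = {}")
          case False
          have "B \<subset> A" using B a by blast
          then have "card B < card (\<Union>(N ` B))" using no False by (meson not_less)
          moreover have "(\<Union>x\<in>B. N x - {b}) = \<Union>(N ` B) - {b}" by blast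
          moreover have "card (\<Union>(N ` B)) - 1 \<le> card (\<Union>(N ` B) - {b})"
            using card_Diff1_le diff_card_le_card_Diff[of "{b}" "\<Union>(N ` B)"] by simp
          ultimately show ?thesis by simp
        qed simp
      qed
      then obtain g where g: "inj_on g (A - {a})" "\<forall>x\<in>A - {a}. g x \<in> N x - {b}" by blast
      have "inj_on (g(a := b)) A"
        using g unfolding inj_on_def by auto
      moreover have "\<forall>x\<in>A. (g(a := b)) x \<in> N x" using g(2) b by auto
      ultimately show ?thesis by blast
    qed
  qed simp
qed

text \<open>If the orbit stayed in Dom, the injection f would permute this finite set, so x would
  have a predecessor in its own orbit and lie on a cycle.\<close>

lemma orbit_terminal:
  assumes fin: "finite I" and dom: "Dom \<subseteq> I" and inj: "inj_on f Dom" and into: "f ` Dom \<subseteq> I"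
    and x: "x \<in> I" and acyc: "(x, x) \<notin> {(y, f y) |y. y \<in> Dom}\<^sup>+"
  shows "\<exists>z \<in> I - Dom. (x, z) \<in> {(y, f y) |y. y \<in> Dom}\<^sup>*"
proof (rule ccontr)
  let ?R = "{(y, f y) |y. y \<in> Dom}"
  define Y where "Y = ?R\<^sup>* `` {x}"
  assume contr: "\<not> ?thesis"
  have "y \<in> I" if "(x, y) \<in> ?R\<^sup>*" for y
    using that by (induction rule: rtrancl_induct) (use x into in auto)
  then have YD: "Y \<subseteq> Dom" and finY: "finite Y"
    using contr fin finite_subset[of Y I] unfolding Y_def by blast+
  have "f ` Y \<subseteq> Y"
  proof
    fix z assume "z \<in> f ` Y"
    then obtain y where y: "y \<in> Y" "z = f y" by blast
    then have "(x, y) \<in> ?R\<^sup>*" "(y, z) \<in> ?R" using YD unfolding Y_def by auto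
    then show "z \<in> Y" unfolding Y_def by (auto intro: rtrancl_into_rtrancl)
  qed
  moreover have "inj_on f Y" using inj YD inj_on_subset by blast
  ultimately have "f ` Y = Y" using finY endo_inj_surj by blast
  moreover have "x \<in> Y" unfolding Y_def by blast
  ultimately obtain y where y: "y \<in> Y" "x = f y" by blast
  then have "(x, y) \<in> ?R\<^sup>*" "(y, x) \<in> ?R" using YD unfolding Y_def by auto
  from rtrancl_into_trancl1[OF this] show False using acyc by contradiction
qed

section \<open>Classes of maximum stable sets as distributive lattices\<close>

context alpha_critical
begin

text \<open>Subsets of \<open>A - B\<close> are stable and disjoint from B, so the exchange bound is
  Hall's condition; their neighbours in B lie outside the stable set A. Equal sizes make the
  matching perfect.\<close>

lemma matching_between_tight:
  assumes A: "tight A" and B: "tight B"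
  shows "\<exists>f. bij_betw f (A - B) (B - A) \<and> (\<forall>x\<in>A - B. adj x (f x))"
proof -
  have fin: "finite A" "finite B" using A B tight_finite by auto
  have "\<exists>f. inj_on f (A - B) \<and> (\<forall>x\<in>A - B. f x \<in> {y. adj x y} \<inter> (B - A))"
  proof (rule hall_marriage)
    show "finite (A - B)" "finite ({y. adj x y} \<inter> (B - A))" for x using fin by auto
    fix S assume S: "S \<subseteq> A - B"
    have stS: "indset S" using S stable_mono[OF tight_stable[OF A]] by blast
    have "card S \<le> card (nbrs S \<inter> B)"
      using stable_card_le_nbrs_tight[OF B stS] S by blast
    also have "nbrs S \<inter> B \<subseteq> (\<Union>x\<in>S. {y. adj x y} \<inter> (B - A))"
    proof
      fix y assume "y \<in> nbrs S \<inter> B"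
      then obtain x where x: "x \<in> S" "adj x y" "y \<in> B" unfolding nbrs_def by blast
      then have "y \<notin> A" using stableD[OF tight_stable[OF A], of x y] S by blast
      then show "y \<in> (\<Union>x\<in>S. {y. adj x y} \<inter> (B - A))" using x by blast
    qed
    then have "card (nbrs S \<inter> B) \<le> card (\<Union>x\<in>S. {y. adj x y} \<inter> (B - A))"
      by (rule card_mono[rotated]) (rule finite_subset[of _ B], use fin in auto)
    finally show "card S \<le> card (\<Union>x\<in>S. {y. adj x y} \<inter> (B - A))" .
  qed
  then obtain f where f: "inj_on f (A - B)" "\<forall>x\<in>A - B. f x \<in> {y. adj x y} \<inter> (B - A)" by blast
  have "card (A - B) = card (B - A)"
    using tight_card[OF A] tight_card[OF B] card_Int_Diff[OF fin(1), of B] card_Int_Diff[OF fin(2), of A]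
    by (simp add: Int_commute)
  moreover have "f ` (A - B) \<subseteq> B - A" using f(2) by blast
  ultimately have "f ` (A - B) = B - A"
    using card_image[OF f(1)] fin by (metis card_subset_eq finite_Diff)
  then show ?thesis using f unfolding bij_betw_def by blast
qed

text \<open>Away from the ends of the edges missed by \<open>T0\<close>, every edge has exactly one
  end in \<open>T0\<close>, as in a bipartite graph. Fixing the trace on these ends is what makes
  lattice operations possible.\<close>

definition "lab T0 p = {T. tight T \<and> T \<inter> \<Union>(missed T0) = p}"
definition "moving L = {x. (\<exists>T\<in>L. x \<in> T) \<and> (\<exists>T\<in>L. x \<notin> T)}"

text \<open>Join on \<open>T0\<close> and meet outside it, and conversely. Only an edge between two
  vertices outside \<open>T0\<close> is critical for stability; it is missed by \<open>T0\<close>,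
  so the common trace puts both ends into T, which is stable. The two sizes add up to twice
  \<alpha>, so neither falls short.\<close>

lemma lab_lattice:
  assumes T0: "tight T0" and T: "T \<in> lab T0 p" and U: "U \<in> lab T0 p"
  shows "((T \<union> U) \<inter> T0) \<union> (T \<inter> U - T0) \<in> lab T0 p" (is "?J \<in> _")
    and "((T \<union> U) - T0) \<union> (T \<inter> U \<inter> T0) \<in> lab T0 p" (is "?M \<in> _")
proof -
  have tT: "tight T" "tight U" using T U unfolding lab_def by auto
  have sub: "T \<subseteq> X" "U \<subseteq> X" using tT tight_sub by auto
  have W0: "T0 \<inter> \<Union>(missed T0) = {}" unfolding missed_def by auto
  have lab: "T \<inter> \<Union>(missed T0) = p" "U \<inter> \<Union>(missed T0) = p" using T U unfolding lab_def by auto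
  have st: "\<not> adj x y" if "x \<in> T" "y \<in> T" for x y using that stableD tight_stable tT by blast
  have su: "\<not> adj x y" if "x \<in> U" "y \<in> U" for x y using that stableD tight_stable tT by blast
  have s0: "\<not> adj x y" if "x \<in> T0" "y \<in> T0" for x y using that stableD tight_stable T0 by blast
  have out: "\<not> adj x y" if xy: "x \<in> T \<union> U - T0" "y \<in> T \<union> U - T0" for x y
  proof
    assume a: "adj x y"
    then have "{x, y} \<in> missed T0" using xy unfolding missed_def by blast
    then have "x \<in> T \<and> y \<in> T" using xy lab by blast
    then show False using st a by blast
  qed
  have "\<not> adj x y" if "x \<in> ?J" "y \<in> ?J" for x y
    using that st[of x y] su[of x y] s0[of x y] by blast
  then have J: "indset ?J" using sub unfolding stable_in_def by auto
  have "\<not> adj x y" if "x \<in> ?M" "y \<in> ?M" for x y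
    using that st[of x y] su[of x y] s0[of x y] out[of x y] by blast
  then have M: "indset ?M" using sub unfolding stable_in_def by auto
  have fin: "finite T" "finite U" using tT tight_finite by auto
  have c1: "card ((T \<union> U) \<inter> T0) + card ((T \<inter> U) \<inter> T0) = card (T \<inter> T0) + card (U \<inter> T0)"
  proof -
    have "(T \<union> U) \<inter> T0 = (T \<inter> T0) \<union> (U \<inter> T0)" "(T \<inter> U) \<inter> T0 = (T \<inter> T0) \<inter> (U \<inter> T0)" by blast+
    then show ?thesis using card_Un_Int[of "T \<inter> T0" "U \<inter> T0"] fin by simp
  qed
  have c2: "card ((T \<union> U) - T0) + card ((T \<inter> U) - T0) = card (T - T0) + card (U - T0)"
  proof -
    have "(T \<union> U) - T0 = (T - T0) \<union> (U - T0)" "(T \<inter> U) - T0 = (T - T0) \<inter> (U - T0)" by blast+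
    then show ?thesis using card_Un_Int[of "T - T0" "U - T0"] fin by simp
  qed
  have c3: "card T = card (T \<inter> T0) + card (T - T0)" "card U = card (U \<inter> T0) + card (U - T0)"
    using fin card_Int_Diff by auto
  have cJ: "card ?J = card ((T \<union> U) \<inter> T0) + card ((T \<inter> U) - T0)"
    by (rule card_Un_disjoint) (use fin in auto)
  have cM: "card ?M = card ((T \<union> U) - T0) + card ((T \<inter> U) \<inter> T0)"
    by (rule card_Un_disjoint) (use fin in auto)
  have "card ?J + card ?M = \<alpha> + \<alpha>"
    using c1 c2 c3 cJ cM tight_card[OF tT(1)] tight_card[OF tT(2)] by linarith
  moreover have "card ?J \<le> \<alpha>" "card ?M \<le> \<alpha>" using stable_bound J M by auto
  ultimately have "tight ?J" "tight ?M" using J M unfolding tight_def by auto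
  moreover have "?J \<inter> \<Union>(missed T0) = p" "?M \<inter> \<Union>(missed T0) = p" using lab W0 by blast+
  ultimately show "?J \<in> lab T0 p" "?M \<in> lab T0 p" unfolding lab_def by auto
qed

text \<open>A has the largest part inside \<open>T0\<close> and B the largest part outside. A
  lattice operation with any T cannot enlarge these parts, so A and B are the two extreme
  elements.\<close>

lemma lab_extremes:
  assumes T0: "tight T0" and ne: "lab T0 p \<noteq> {}"
  obtains A B where "A \<in> lab T0 p" "B \<in> lab T0 p"
    "\<And>T. T \<in> lab T0 p \<Longrightarrow> T \<inter> T0 \<subseteq> A \<and> A - T0 \<subseteq> T \<and> B \<inter> T0 \<subseteq> T \<and> T - T0 \<subseteq> B"
proof -
  let ?L = "lab T0 p"
  have tl: "tight T" if "T \<in> ?L" for T using that unfolding lab_def by blast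
  have finL: "finite ?L"
    using tl tight_sub finite_X finite_subset[of ?L "Pow X"] by auto
  have fin: "finite T" if "T \<in> ?L" for T using that tl tight_finite by blast
  have split: "card (T \<inter> T0) + card (T - T0) = \<alpha>" if "T \<in> ?L" for T
    using card_Int_Diff[OF fin[OF that]] tight_card[OF tl[OF that]] by metis
  have argmax: "\<exists>A\<in>?L. \<forall>T\<in>?L. g T \<le> g A" for g :: "'x set \<Rightarrow> nat"
  proof -
    have "Max (g ` ?L) \<in> g ` ?L" using finL ne by (intro Max_in) auto
    then obtain A where "A \<in> ?L" "g A = Max (g ` ?L)" by auto
    then show ?thesis using finL by (intro bexI[of _ A]) auto
  qed
  obtain A where A: "A \<in> ?L" "\<And>T. T \<in> ?L \<Longrightarrow> card (T \<inter> T0) \<le> card (A \<inter> T0)"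
    using argmax[of "\<lambda>T. card (T \<inter> T0)"] by blast
  obtain B where B: "B \<in> ?L" "\<And>T. T \<in> ?L \<Longrightarrow> card (T - T0) \<le> card (B - T0)"
    using argmax[of "\<lambda>T. card (T - T0)"] by blast
  have "T \<inter> T0 \<subseteq> A \<and> A - T0 \<subseteq> T" if T: "T \<in> ?L" for T
  proof -
    let ?J = "((T \<union> A) \<inter> T0) \<union> (T \<inter> A - T0)"
    have J: "?J \<in> ?L" using lab_lattice(1)[OF T0 T A(1)] .
    have j: "?J \<inter> T0 = (T \<union> A) \<inter> T0" "?J - T0 = T \<inter> A - T0" by auto
    have "A \<inter> T0 = (T \<union> A) \<inter> T0"
      using A(2)[OF J] fin[OF A(1)] fin[OF T] unfolding j
      by (intro card_seteq) auto
    moreover have "T \<inter> A - T0 = A - T0"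
    proof (rule card_seteq)
      have "card (A \<inter> T0) = card (?J \<inter> T0)" using calculation j by simp
      then show "card (A - T0) \<le> card (T \<inter> A - T0)"
        using split[OF A(1)] split[OF J] unfolding j by linarith
    qed (use fin[OF A(1)] in auto)
    ultimately show ?thesis by blast
  qed
  moreover have "B \<inter> T0 \<subseteq> T \<and> T - T0 \<subseteq> B" if T: "T \<in> ?L" for T
  proof -
    let ?M = "((T \<union> B) - T0) \<union> (T \<inter> B \<inter> T0)"
    have M: "?M \<in> ?L" using lab_lattice(2)[OF T0 T B(1)] .
    have m: "?M \<inter> T0 = T \<inter> B \<inter> T0" "?M - T0 = (T \<union> B) - T0" by auto
    have "B - T0 = (T \<union> B) - T0"
      using B(2)[OF M] fin[OF B(1)] fin[OF T] unfolding m
      by (intro card_seteq) auto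
    moreover have "T \<inter> B \<inter> T0 = B \<inter> T0"
    proof (rule card_seteq)
      have "card (B - T0) = card (?M - T0)" using calculation m by simp
      then show "card (B \<inter> T0) \<le> card (T \<inter> B \<inter> T0)"
        using split[OF B(1)] split[OF M] unfolding m by linarith
    qed (use fin[OF B(1)] in auto)
    ultimately show ?thesis by blast
  qed
  ultimately show ?thesis using that[OF A(1) B(1)] by blast
qed

lemma card_Union_missed:
  assumes "tight T"
  shows "card (\<Union>(missed T)) \<le> 2 * missed_limit lam"
proof -
  have "card e \<le> 2" if "e \<in> missed T" for e
    using that unfolding missed_def by (auto simp: card_insert_if)
  then have "(\<Sum>e\<in>missed T. card e) \<le> (\<Sum>e\<in>missed T. 2)" by (intro sum_mono) auto
  also have "\<dots> = 2 * card (missed T)" by simp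
  finally show ?thesis
    using card_Union_le_sum_card[of "missed T"] card_missed_less[OF assms] by linarith
qed

definition "partner L m \<longleftrightarrow> (\<forall>x\<in>moving L. m x \<in> moving L \<and> adj x (m x) \<and> m (m x) = x \<and>
  (\<forall>T\<in>L. x \<in> T \<longleftrightarrow> m x \<notin> T))"

text \<open>Z catches the edges through which an alternating path can leave the moving
  vertices.\<close>

definition "margin L Z \<longleftrightarrow> (\<forall>x\<in>moving L. \<forall>y. adj x y \<and> y \<notin> moving L \<longrightarrow> x \<in> Z \<and> y \<in> Z)"

text \<open>The moving vertices form the symmetric difference of the extremes A and B, and a perfect
  matching between its two halves provides the partners. An edge from a moving vertex to any other
  vertex is missed by the extreme that does not contain the moving end, so the ends of the edges
  missed by A or B serve as Z.\<close>

lemma lab_structure: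
  assumes T0: "tight T0"
  shows "\<exists>m Z. partner (lab T0 p) m \<and> margin (lab T0 p) Z \<and> finite Z \<and> card Z \<le> 4 * missed_limit lam"
proof (cases "lab T0 p = {}")
  case True
  then have "moving (lab T0 p) = {}" unfolding moving_def by blast
  then show ?thesis
    unfolding partner_def margin_def by (intro exI[of _ id] exI[of _ "{}"]) simp
next
  case False
  let ?L = "lab T0 p"
  obtain A B where A: "A \<in> ?L" and B: "B \<in> ?L"
    and AB: "\<And>T. T \<in> ?L \<Longrightarrow> T \<inter> T0 \<subseteq> A \<and> A - T0 \<subseteq> T \<and> B \<inter> T0 \<subseteq> T \<and> T - T0 \<subseteq> B"
    using lab_extremes[OF T0 False] by blast
  have tA: "tight A" and tB: "tight B" using A B unfolding lab_def by auto
  have inner: "A \<inter> B \<subseteq> T" and outer: "T \<subseteq> A \<union> B" if "T \<in> ?L" for T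
    using AB[OF that] by blast+
  have mov: "moving ?L = (A - B) \<union> (B - A)"
    using A B inner outer unfolding moving_def by blast
  obtain f where f: "bij_betw f (A - B) (B - A)" "\<And>x. x \<in> A - B \<Longrightarrow> adj x (f x)"
    using matching_between_tight[OF tA tB] by blast
  define g where "g = inv_into (A - B) f"
  have g: "\<And>y. y \<in> B - A \<Longrightarrow> g y \<in> A - B \<and> f (g y) = y" "\<And>x. x \<in> A - B \<Longrightarrow> g (f x) = x"
  proof -
    show "g y \<in> A - B \<and> f (g y) = y" if "y \<in> B - A" for y
    proof -
      have "y \<in> f ` (A - B)" using f(1) that unfolding bij_betw_def by simp
      then show ?thesis unfolding g_def using inv_into_into f_inv_into_f by metis
    qed
    show "g (f x) = x" if "x \<in> A - B" for x
      using f(1) that unfolding g_def bij_betw_def by (simp add: inv_into_f_f)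
  qed
  have fB: "f x \<in> B - A" if "x \<in> A - B" for x using that f(1) bij_betwE by blast
  define m where "m x = (if x \<in> A then f x else g x)" for x
  \<comment> \<open>T lies between \<open>A \<inter> B\<close> and \<open>A \<union> B\<close> and
    contains at most one end of each matching edge. As it is as large as A, it contains exactly
    one.\<close>
  have one: "x \<in> T \<longleftrightarrow> f x \<notin> T" if T: "T \<in> ?L" and x: "x \<in> A - B" for T x
  proof -
    have tT: "tight T" using T unfolding lab_def by auto
    have finT: "finite T" using tT tight_finite by blast
    have ex: "\<not> (x \<in> T \<and> f x \<in> T)" if "x \<in> A - B" for x
      using f(2)[OF that] stableD[OF tight_stable[OF tT]] by blast
    let ?P = "{x \<in> A - B. x \<in> T}" and ?Q = "{x \<in> A - B. f x \<in> T}"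
    have finA: "finite A" using tA tight_finite by blast
    have "f ` ?Q = T \<inter> (B - A)"
    proof -
      have "f ` ?Q = T \<inter> f ` (A - B)" by blast
      then show ?thesis using f(1) unfolding bij_betw_def by simp
    qed
    moreover have "inj_on f ?Q" using f(1) unfolding bij_betw_def inj_on_def by auto
    ultimately have cQ: "card (T \<inter> (B - A)) = card ?Q" using card_image by metis
    have T_eq: "T = (A \<inter> B) \<union> ?P \<union> (T \<inter> (B - A))"
      using inner[OF T] outer[OF T] by blast
    have "card T = card ((A \<inter> B) \<union> ?P \<union> (T \<inter> (B - A)))" using T_eq by simp
    also have "\<dots> = card ((A \<inter> B) \<union> ?P) + card (T \<inter> (B - A))"
      by (rule card_Un_disjoint) (use finA finT in auto)
    also have "card ((A \<inter> B) \<union> ?P) = card (A \<inter> B) + card ?P"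
      by (rule card_Un_disjoint) (use finA in auto)
    finally have "card T = card (A \<inter> B) + card ?P + card ?Q" using cQ by simp
    moreover have "card ?P + card ?Q = card (?P \<union> ?Q)"
      by (rule card_Un_disjoint[symmetric]) (use ex finA in auto)
    moreover have "card A = card (A \<inter> B) + card (A - B)" using card_Int_Diff[OF finA] .
    ultimately have "card (A - B) \<le> card (?P \<union> ?Q)"
      using tight_card[OF tA] tight_card[OF tT] by linarith
    then have "?P \<union> ?Q = A - B" using finA by (intro card_seteq) auto
    then show ?thesis using x ex[OF x] by blast
  qed
  have part: "partner ?L m"
    unfolding partner_def
  proof
    fix x assume "x \<in> moving ?L"
    then consider "x \<in> A - B" | "x \<in> B - A" using mov by blast
    then show "m x \<in> moving ?L \<and> adj x (m x) \<and> m (m x) = x \<and> (\<forall>T\<in>?L. (x \<in> T) = (m x \<notin> T))"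
    proof cases
      case 1
      then have "m x = f x" "m (f x) = x" using g fB[OF 1] unfolding m_def by auto
      then show ?thesis using 1 mov fB[OF 1] f(2)[OF 1] one[OF _ 1] by auto
    next
      case 2
      then have *: "m x = g x" "m (g x) = x" using g unfolding m_def by auto
      moreover have "g x \<in> A - B" "f (g x) = x" using g 2 by auto
      moreover have "adj x (g x)" using f(2)[of "g x"] calculation adj_sym by metis
      ultimately show ?thesis using mov one[of _ "g x"] by auto
    qed
  qed
  define Z where "Z = \<Union>(missed A) \<union> \<Union>(missed B)"
  have front: "margin ?L Z"
    unfolding margin_def
  proof (intro ballI allI impI)
    fix x y assume x: "x \<in> moving ?L" and y: "adj x y \<and> y \<notin> moving ?L"
    obtain C D where CD: "(C = A \<and> D = B) \<or> (C = B \<and> D = A)" "x \<in> C - D" using x mov by blast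
    have "y \<notin> C" using stableD[OF tight_stable, of C x y] CD tA tB y by blast
    then have "y \<notin> D" using y CD mov by blast
    then have "{x, y} \<in> missed D" using y CD unfolding missed_def by blast
    then show "x \<in> Z \<and> y \<in> Z" using CD unfolding Z_def by auto
  qed
  have finM: "finite (\<Union>(missed C))" for C
    by (rule finite_subset[OF _ finite_X]) (use adj_in adj_in2 in \<open>auto simp: missed_def\<close>)
  have "card Z \<le> 4 * missed_limit lam"
    using card_Union_missed[OF tA] card_Union_missed[OF tB] card_Un_le[of "\<Union>(missed A)" "\<Union>(missed B)"]
    unfolding Z_def by linarith
  moreover have "finite Z" unfolding Z_def using finM by simp
  ultimately show ?thesis using part front by blast
qed

end

text \<open>The summands count the ends of the edges missed by one fixed maximum stable set, the
  neighbours of these ends, and the codes of all other branch vertices: three classes out of at most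
  \<open>2 ^ w\<close> and three terminal vertices out of at most z.\<close>

definition branch_limit :: "nat \<Rightarrow> nat" where
  "branch_limit lam = (let r = missed_limit lam; w = 2 * r; z = 2 ^ w * (8 * r)
     in w + w * r + (2 ^ w) ^ 3 * z ^ 3)"

section \<open>Alternating paths between two classes\<close>

context alpha_critical
begin

definition "below L x y \<longleftrightarrow> (\<forall>T\<in>L. x \<in> T \<longrightarrow> y \<in> T)"

lemma below_trans: "below L x y \<Longrightarrow> below L y z \<Longrightarrow> below L x z"
  unfolding below_def by blast

definition "step_dom L m K n = {x \<in> moving L \<inter> moving K. m x \<in> moving K \<and> n (m x) \<in> moving L}"

text \<open>Each step runs along one matching edge of either class. In L, \<open>n (m x)\<close>
  excludes its neighbour \<open>m x\<close> and thereby forces x; in K, x excludes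
  \<open>m x\<close> and thereby forces \<open>n (m x)\<close>. This is where the directions become
  opposite.\<close>

lemma step_below:
  assumes m: "partner L m" and n: "partner K n" and LT: "\<And>T. T \<in> L \<union> K \<Longrightarrow> tight T"
    and x: "x \<in> step_dom L m K n"
  shows "below L (n (m x)) x" "below K x (n (m x))"
proof -
  have x': "x \<in> moving L" "m x \<in> moving K" using x unfolding step_dom_def by auto
  have a: "adj (m x) (n (m x))" "adj x (m x)" using m n x' unfolding partner_def by blast+
  show "below L (n (m x)) x"
    unfolding below_def
  proof (intro ballI impI)
    fix T assume T: "T \<in> L" "n (m x) \<in> T"
    then have "m x \<notin> T" using stableD[OF tight_stable[OF LT[of T]]] a(1) by blast
    then show "x \<in> T" using m x'(1) T(1) unfolding partner_def by blast
  qed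
  show "below K x (n (m x))"
    unfolding below_def
  proof (intro ballI impI)
    fix T assume T: "T \<in> K" "x \<in> T"
    then have "m x \<notin> T" using stableD[OF tight_stable[OF LT[of T]]] a(2) by blast
    then show "n (m x) \<in> T" using n x'(2) T(1) unfolding partner_def by blast
  qed
qed

lemma steps_below:
  assumes m: "partner L m" and n: "partner K n" and LT: "\<And>T. T \<in> L \<union> K \<Longrightarrow> tight T"
    and xy: "(x, y) \<in> {(y, n (m y)) |y. y \<in> step_dom L m K n}\<^sup>*"
  shows "below L y x \<and> below K x y"
  using xy
proof (induction rule: rtrancl_induct)
  case base
  then show ?case unfolding below_def by blast
next
  case (step y z)
  from step.hyps(2) have y: "y \<in> step_dom L m K n" and z: "z = n (m y)" by auto
  have "below L z y" "below K y z" using step_below[OF m n LT y] z by auto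
  with step.IH show ?case using below_trans by meson
qed

lemma step_inj:
  assumes m: "partner L m" and n: "partner K n"
  shows "inj_on (\<lambda>x. n (m x)) (step_dom L m K n)"
proof (rule inj_onI)
  fix x y assume x: "x \<in> step_dom L m K n" and y: "y \<in> step_dom L m K n" and e: "n (m x) = n (m y)"
  have "n (n (m x)) = m x" "n (n (m y)) = m y" "m (m x) = x" "m (m y) = y"
    using m n x y unfolding partner_def step_dom_def by blast+
  then show "x = y" using e by metis
qed

text \<open>Two partner maps alternate along paths that run in opposite directions of the two
  orders, so such a path is determined by the vertex where it leaves the moving part.\<close>

lemma steps_terminal:
  assumes m: "partner L m" and n: "partner K n" and LT: "\<And>T. T \<in> L \<union> K \<Longrightarrow> tight T"
    and ZL: "margin L Z" and ZK: "margin K Z'"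
    and x: "x \<in> moving L \<inter> moving K" "m x \<noteq> n x"
    and anti: "\<And>w. w \<noteq> x \<Longrightarrow> below L x w \<Longrightarrow> below L w x \<Longrightarrow> False"
  shows "\<exists>z \<in> m ` Z \<union> Z'. (x, z) \<in> {(y, n (m y)) |y. y \<in> step_dom L m K n}\<^sup>*"
proof -
  let ?D = "step_dom L m K n" and ?I = "moving L \<inter> moving K"
  let ?R = "{(y, n (m y)) |y. y \<in> ?D}"
  have mX: "moving L \<subseteq> X"
    using LT tight_sub unfolding moving_def by blast
  have "\<exists>z\<in>?I - ?D. (x, z) \<in> ?R\<^sup>*"
  proof (rule orbit_terminal)
    show "finite ?I" using mX finite_X finite_subset by blast
    show "inj_on (\<lambda>y. n (m y)) ?D" using step_inj[OF m n] .
    show "(\<lambda>y. n (m y)) ` ?D \<subseteq> ?I"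
    proof
      fix w assume "w \<in> (\<lambda>y. n (m y)) ` ?D"
      then obtain y where y: "y \<in> ?D" "w = n (m y)" by blast
      then have "n (m y) \<in> moving L" "n (m y) \<in> moving K"
        using n unfolding step_dom_def partner_def by blast+
      then show "w \<in> ?I" using y(2) by blast
    qed
    \<comment> \<open>On a cycle the first vertex after x differs from x since
      \<open>m x \<noteq> n x\<close>, yet each of the two would be below the other in L.\<close>
    show "(x, x) \<notin> ?R\<^sup>+"
    proof
      assume "(x, x) \<in> ?R\<^sup>+"
      from tranclD[OF this] obtain y where y: "(x, y) \<in> ?R" "(y, x) \<in> ?R\<^sup>*" by (elim exE conjE)
      then have yx: "y = n (m x)" "x \<in> ?D" by auto
      have "y \<noteq> x"
      proof
        assume "y = x"
        then have "n (n (m x)) = n x" using yx by simp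
        moreover have "n (n (m x)) = m x" using yx(2) n unfolding step_dom_def partner_def by blast
        ultimately show False using x(2) by simp
      qed
      then show False
        using anti[of y] steps_below[OF m n LT y(2)] step_below[OF m n LT yx(2)] yx(1) by blast
    qed
  qed (use x in \<open>auto simp: step_dom_def\<close>)
  then obtain z where z: "z \<in> ?I - ?D" "(x, z) \<in> ?R\<^sup>*" by blast
  have mz: "m z \<in> moving L" "adj z (m z)" "m (m z) = z" using m z unfolding partner_def by blast+
  \<comment> \<open>The path stops at z for one of two reasons: the edge from z to
    \<open>m z\<close> leaves the moving part of K, so z is in Z'; or the edge from
    \<open>m z\<close> to its partner in K leaves the moving part of L, so \<open>m z\<close> is in
    Z.\<close>
  have "z \<in> m ` Z \<union> Z'"
  proof (cases "m z \<in> moving K")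
    case False
    then show ?thesis using ZK z(1) mz unfolding margin_def by blast
  next
    case True
    then have "n (m z) \<notin> moving L" "adj (m z) (n (m z))"
      using z(1) n unfolding step_dom_def partner_def by auto
    then have "m z \<in> Z" using ZL mz(1) unfolding margin_def by blast
    then show ?thesis using mz(3) by (metis UnI1 image_eqI)
  qed
  then show ?thesis using z(2) by blast
qed

text \<open>Steps are injective, so two vertices with a common terminal vertex lie on one path, and
  one of them is reached from the other.\<close>

lemma steps_comparable:
  assumes m: "partner L m" and n: "partner K n" and LT: "\<And>T. T \<in> L \<union> K \<Longrightarrow> tight T"
    and xz: "(x, z) \<in> {(y, n (m y)) |y. y \<in> step_dom L m K n}\<^sup>*"
    and yz: "(y, z) \<in> {(y, n (m y)) |y. y \<in> step_dom L m K n}\<^sup>*"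
  shows "below L y x \<and> below K x y \<or> below L x y \<and> below K y x"
proof -
  define R where "R = {(y, n (m y)) |y. y \<in> step_dom L m K n}"
  have "single_valued (R\<inverse>)"
    using step_inj[OF m n] unfolding R_def single_valued_def inj_on_def by auto
  moreover have "(z, x) \<in> (R\<inverse>)\<^sup>*" "(z, y) \<in> (R\<inverse>)\<^sup>*"
    using xz yz unfolding R_def[symmetric] by (auto intro: rtrancl_converseI)
  ultimately have "(x, y) \<in> (R\<inverse>)\<^sup>* \<or> (y, x) \<in> (R\<inverse>)\<^sup>*"
    using single_valued_confluent by metis
  then have "(y, x) \<in> R\<^sup>* \<or> (x, y) \<in> R\<^sup>*" by (auto dest: rtrancl_converseD)
  then show ?thesis using steps_below[OF m n LT] unfolding R_def by blast
qed

text \<open>Each of the two members contains exactly one of v and \<open>m v\<close>, and they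
  differ only in v and u. A vertex w occurring in the same members as v would lie in R, hence in
  both of them, although v lies in only one.\<close>

lemma swap_partner:
  assumes T0: "tight T0" and m: "partner (lab T0 p) m"
    and R: "v \<notin> R" "u \<notin> R" "v \<noteq> u" "insert v R \<in> lab T0 p" "insert u R \<in> lab T0 p"
  shows "v \<in> moving (lab T0 p)" "m v = u"
    and "\<And>w. w \<noteq> v \<Longrightarrow> below (lab T0 p) v w \<Longrightarrow> below (lab T0 p) w v \<Longrightarrow> False"
proof -
  show v: "v \<in> moving (lab T0 p)" unfolding moving_def using R by blast
  have mv: "\<And>T. T \<in> lab T0 p \<Longrightarrow> v \<in> T \<longleftrightarrow> m v \<notin> T" using m v unfolding partner_def by blast
  have "m v \<in> insert u R" using mv[OF R(5)] R by blast
  moreover have "m v \<notin> insert v R" using mv[OF R(4)] R by blast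
  ultimately show "m v = u" by blast
  fix w assume w: "w \<noteq> v" "below (lab T0 p) v w" "below (lab T0 p) w v"
  then have "w \<in> R" using R(4) unfolding below_def by blast
  then have "v \<in> insert u R" using w(3) R(5) unfolding below_def by blast
  then show False using R by blast
qed

text \<open>Swapping v with three of its neighbours gives three classes in which v has three
  different partners. Every two of these classes have an alternating path that starts in v. The
  classes and the terminal vertices of the paths form a code that determines v.\<close>

theorem card_branch_vertices: "card {v \<in> X. 3 \<le> card {y. adj v y}} \<le> branch_limit lam"
proof (cases "X = {}")
  case False
  then obtain x y where "adj x y" using no_isolated by blast
  then obtain T0 where T0: "tight T0" using critical_swap by metis
  define r where "r = missed_limit lam"
  define W where "W = \<Union>(missed T0)"
  define L where "L = lab T0"
  have W_X: "W \<subseteq> X" unfolding W_def missed_def using adj_in adj_in2 by auto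
  have finW: "finite W" using W_X finite_X finite_subset by blast
  have cW: "card W \<le> 2 * r" unfolding W_def r_def using card_Union_missed[OF T0] .
  obtain m Z where mZ: "\<And>p. partner (L p) (m p) \<and> margin (L p) (Z p) \<and> finite (Z p) \<and> card (Z p) \<le> 4 * r"
    using lab_structure[OF T0] unfolding L_def r_def by metis
  have LT: "tight T" if "T \<in> L p" for T p using that unfolding L_def lab_def by blast
  have LT2: "tight T" if "T \<in> L p \<union> L q" for T p q using that LT by blast
  \<comment> \<open>Contains the terminal vertices for all pairs of classes; every subset p of W
    contributes at most twice \<open>4 * r\<close> vertices.\<close>
  define ZZ where "ZZ = (\<Union>p\<in>Pow W. m p ` Z p \<union> Z p)"
  have finZZ: "finite ZZ" unfolding ZZ_def using mZ finW by auto
  have "card ZZ \<le> (\<Sum>p\<in>Pow W. card (m p ` Z p \<union> Z p))"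
    unfolding ZZ_def using finW by (intro card_UN_le) simp
  also have "\<dots> \<le> (\<Sum>p\<in>Pow W. 8 * r)"
  proof (rule sum_mono)
    fix p
    have "card (m p ` Z p) \<le> card (Z p)" using mZ card_image_le by blast
    then show "card (m p ` Z p \<union> Z p) \<le> 8 * r"
      using card_Un_le[of "m p ` Z p" "Z p"] mZ[of p] by linarith
  qed
  also have "\<dots> = 2 ^ card W * (8 * r)" using finW by (simp add: card_Pow)
  also have "\<dots> \<le> 2 ^ (2 * r) * (8 * r)" using cW by (simp add: power_increasing)
  finally have cZZ: "card ZZ \<le> 2 ^ (2 * r) * (8 * r)" .
  define R where "R p q = {(y, m q (m p y)) |y. y \<in> step_dom (L p) (m p) (L q) (m q)}" for p q
  \<comment> \<open>If neither v nor its neighbour u is in W, swapping them does not change the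
    trace on W, so both maximum stable sets belong to the same class.\<close>
  define G where "G = {v \<in> X. 3 \<le> card {y. adj v y}} - (W \<union> (\<Union>w\<in>W. {y. adj w y}))"
  define anti where "anti p v \<longleftrightarrow> (\<forall>w. w \<noteq> v \<longrightarrow> below (L p) v w \<longrightarrow> \<not> below (L p) w v)" for p v
  have swap: "\<exists>p\<in>Pow W. v \<in> moving (L p) \<and> m p v = u \<and> anti p v"
    if v: "v \<in> G" and vu: "adj v u" for v u
  proof -
    obtain S where S: "v \<notin> S" "u \<notin> S" "tight (insert v S)" "tight (insert u S)"
      using critical_swap[OF vu] .
    have "v \<notin> W" using v unfolding G_def by blast
    moreover have "u \<notin> W" using v vu adj_sym unfolding G_def by blast
    ultimately have "insert v S \<in> lab T0 (S \<inter> W)" "insert u S \<in> lab T0 (S \<inter> W)"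
      using S unfolding lab_def W_def by auto
    moreover have "v \<noteq> u" using vu adj_irrefl by metis
    ultimately have "v \<in> moving (L (S \<inter> W)) \<and> m (S \<inter> W) v = u \<and> anti (S \<inter> W) v"
      using swap_partner[OF T0 _ S(1,2), of "S \<inter> W" "m (S \<inter> W)"] mZ unfolding L_def anti_def by blast
    then show ?thesis by blast
  qed
  have data: "\<exists>p1\<in>Pow W. \<exists>p2\<in>Pow W. \<exists>p3\<in>Pow W. \<exists>z12\<in>ZZ. \<exists>z13\<in>ZZ. \<exists>z23\<in>ZZ.
      anti p1 v \<and> anti p2 v \<and> anti p3 v \<and>
      (v, z12) \<in> (R p1 p2)\<^sup>* \<and> (v, z13) \<in> (R p1 p3)\<^sup>* \<and> (v, z23) \<in> (R p2 p3)\<^sup>*"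
    if v: "v \<in> G" for v
  proof -
    have "3 \<le> card {y. adj v y}" using v unfolding G_def by blast
    then obtain U where U: "U \<subseteq> {y. adj v y}" "card U = 3"
      using obtain_subset_with_card_n by metis
    then obtain u1 u2 u3 where u: "u1 \<noteq> u2" "u1 \<noteq> u3" "u2 \<noteq> u3" "U = {u1, u2, u3}"
      by (auto simp: card_3_iff)
    obtain p1 where p1: "p1 \<in> Pow W" "v \<in> moving (L p1)" "m p1 v = u1" "anti p1 v"
      using swap[OF v, of u1] u(4) U(1) by blast
    obtain p2 where p2: "p2 \<in> Pow W" "v \<in> moving (L p2)" "m p2 v = u2" "anti p2 v"
      using swap[OF v, of u2] u(4) U(1) by blast
    obtain p3 where p3: "p3 \<in> Pow W" "v \<in> moving (L p3)" "m p3 v = u3" "anti p3 v"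
      using swap[OF v, of u3] u(4) U(1) by blast
    have leave: "\<exists>z\<in>ZZ. (v, z) \<in> (R p q)\<^sup>*"
      if pq: "p \<in> Pow W" "q \<in> Pow W" "v \<in> moving (L p)" "v \<in> moving (L q)" "m p v \<noteq> m q v" "anti p v" for p q
    proof -
      have "\<exists>z\<in>m p ` Z p \<union> Z q. (v, z) \<in> (R p q)\<^sup>*"
        unfolding R_def
      proof (rule steps_terminal)
        show "partner (L p) (m p)" "partner (L q) (m q)" "margin (L p) (Z p)" "margin (L q) (Z q)"
          using mZ by auto
        show "tight T" if "T \<in> L p \<union> L q" for T using LT2 that .
        show "v \<in> moving (L p) \<inter> moving (L q)" "m p v \<noteq> m q v" using pq by auto
        show False if "w \<noteq> v" "below (L p) v w" "below (L p) w v" for w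
          using that pq(6) unfolding anti_def by blast
      qed
      then show ?thesis using pq(1,2) unfolding ZZ_def by blast
    qed
    obtain z12 where "z12 \<in> ZZ" "(v, z12) \<in> (R p1 p2)\<^sup>*"
      using leave[OF p1(1) p2(1) p1(2) p2(2) _ p1(4)] p1(3) p2(3) u(1) by auto
    moreover obtain z13 where "z13 \<in> ZZ" "(v, z13) \<in> (R p1 p3)\<^sup>*"
      using leave[OF p1(1) p3(1) p1(2) p3(2) _ p1(4)] p1(3) p3(3) u(2) by auto
    moreover obtain z23 where "z23 \<in> ZZ" "(v, z23) \<in> (R p2 p3)\<^sup>*"
      using leave[OF p2(1) p3(1) p2(2) p3(2) _ p2(4)] p2(3) p3(3) u(3) by auto
    ultimately show ?thesis using p1(1,4) p2(1,4) p3(1,4) by blast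
  qed
  define Cod where "Cod = Pow W \<times> Pow W \<times> Pow W \<times> ZZ \<times> ZZ \<times> ZZ"
  define good where "good v d \<longleftrightarrow> (case d of (p1, p2, p3, z12, z13, z23) \<Rightarrow>
      anti p1 v \<and> anti p2 v \<and> anti p3 v \<and>
      (v, z12) \<in> (R p1 p2)\<^sup>* \<and> (v, z13) \<in> (R p1 p3)\<^sup>* \<and> (v, z23) \<in> (R p2 p3)\<^sup>*)" for v d
  have "\<forall>v\<in>G. \<exists>d. d \<in> Cod \<and> good v d"
  proof
    fix v assume "v \<in> G"
    from data[OF this] obtain p1 p2 p3 z12 z13 z23
      where "p1 \<in> Pow W" "p2 \<in> Pow W" "p3 \<in> Pow W" "z12 \<in> ZZ" "z13 \<in> ZZ" "z23 \<in> ZZ"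
        "anti p1 v \<and> anti p2 v \<and> anti p3 v \<and>
        (v, z12) \<in> (R p1 p2)\<^sup>* \<and> (v, z13) \<in> (R p1 p3)\<^sup>* \<and> (v, z23) \<in> (R p2 p3)\<^sup>*"
      by (elim bexE)
    then have "(p1, p2, p3, z12, z13, z23) \<in> Cod \<and> good v (p1, p2, p3, z12, z13, z23)"
      unfolding Cod_def good_def by simp
    then show "\<exists>d. d \<in> Cod \<and> good v d" by (rule exI)
  qed
  then obtain d where d: "\<And>v. v \<in> G \<Longrightarrow> d v \<in> Cod \<and> good v (d v)" by metis
  have comp: "below (L p) y x \<and> below (L q) x y \<or> below (L p) x y \<and> below (L q) y x"
    if "(x, z) \<in> (R p q)\<^sup>*" "(y, z) \<in> (R p q)\<^sup>*" for p q x y z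
  proof (rule steps_comparable)
    show "partner (L p) (m p)" "partner (L q) (m q)" using mZ by auto
    show "tight T" if "T \<in> L p \<union> L q" for T using LT2 that .
  qed (use that in \<open>unfold R_def\<close>)
  have "inj_on d G"
  proof (rule inj_onI, rule ccontr)
    fix v w assume vw: "v \<in> G" "w \<in> G" "d v = d w" "v \<noteq> w"
    obtain p1 p2 p3 z12 z13 z23 where dv: "d v = (p1, p2, p3, z12, z13, z23)" by (cases "d v")
    have gv: "good v (p1, p2, p3, z12, z13, z23)" and gw: "good w (p1, p2, p3, z12, z13, z23)"
      using d[OF vw(1)] d[OF vw(2)] vw(3) dv by auto
    have a: "\<not> (below (L p1) v w \<and> below (L p1) w v)" "\<not> (below (L p2) v w \<and> below (L p2) w v)"
      "\<not> (below (L p3) v w \<and> below (L p3) w v)"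
      using gv vw(4) unfolding good_def anti_def by auto
    \<comment> \<open>With equal codes, v and w are comparable in all three classes, with opposite
      directions in every two of them. The relations are strict by \<open>anti\<close>, but two of
      three directions must agree.\<close>
    have "below (L p1) w v \<and> below (L p2) v w \<or> below (L p1) v w \<and> below (L p2) w v"
      "below (L p1) w v \<and> below (L p3) v w \<or> below (L p1) v w \<and> below (L p3) w v"
      "below (L p2) w v \<and> below (L p3) v w \<or> below (L p2) v w \<and> below (L p3) w v"
      using comp[of v _ p1 p2 w] comp[of v _ p1 p3 w] comp[of v _ p2 p3 w] gv gw
      unfolding good_def by auto
    then show False using a by argo
  qed
  moreover have finCod: "finite Cod" unfolding Cod_def using finW finZZ by simp
  moreover have "d ` G \<subseteq> Cod" using d by blast
  ultimately have "card G \<le> card Cod" using card_inj_on_le by blast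
  also have "card Cod = (2 ^ card W) ^ 3 * card ZZ ^ 3"
    unfolding Cod_def using finW by (simp add: card_cartesian_product card_Pow power3_eq_cube)
  also have "\<dots> \<le> (2 ^ (2 * r)) ^ 3 * (2 ^ (2 * r) * (8 * r)) ^ 3"
    using cW cZZ by (intro mult_mono power_mono) (auto simp: power_increasing)
  finally have cG: "card G \<le> (2 ^ (2 * r)) ^ 3 * (2 ^ (2 * r) * (8 * r)) ^ 3" .
  have "card (\<Union>w\<in>W. {y. adj w y}) \<le> (\<Sum>w\<in>W. card {y. adj w y})"
    using finW by (rule card_UN_le)
  also have "\<dots> \<le> (\<Sum>w\<in>W. r)" unfolding r_def using degree_bound by (intro sum_mono)
  also have "\<dots> = card W * r" by simp
  also have "\<dots> \<le> 2 * r * r" using cW by simp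
  finally have cN: "card (\<Union>w\<in>W. {y. adj w y}) \<le> 2 * r * r" .
  have finNb: "finite (\<Union>w\<in>W. {y. adj w y})"
    by (rule finite_subset[OF _ finite_X]) (use adj_in2 in auto)
  have finG: "finite G" unfolding G_def using finite_X by simp
  have "card {v \<in> X. 3 \<le> card {y. adj v y}} \<le> card (G \<union> (W \<union> (\<Union>w\<in>W. {y. adj w y})))"
    by (rule card_mono) (use finG finW finNb in \<open>auto simp: G_def\<close>)
  also have "\<dots> \<le> card G + (card W + card (\<Union>w\<in>W. {y. adj w y}))"
    by (meson add_left_mono card_Un_le le_trans)
  finally show ?thesis
    using cG cW cN unfolding branch_limit_def Let_def r_def[symmetric] by linarith
qed simp

end

section \<open>Facets and the rank condition\<close>

definition tight_set :: "'v wgraph \<Rightarrow> 'v set \<Rightarrow> bool" where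
  "tight_set G S \<longleftrightarrow> S \<subseteq> verts G \<and> sum (weight G) S - int (num_induced_edges G S) = beta G"

lemma beta_upper:
  assumes "finite (verts G)" "S \<subseteq> verts G"
  shows "sum (weight G) S - int (num_induced_edges G S) \<le> beta G"
  unfolding beta_def using assms by (intro Max_ge) auto

lemma weighted_graph_finite_edges:
  assumes "weighted_graph G"
  shows "finite (edges G)"
proof -
  have "edges G \<subseteq> Pow (verts G)" "finite (verts G)" using assms unfolding weighted_graph_def by auto
  then show ?thesis using finite_subset by blast
qed

text \<open>The directions of F have codimension 1 among those of P, and f vanishes on them but not
  at d. So a basis of the former together with d is a basis of the latter, and
  \<open>g - g d / f d * f\<close> vanishes on it. The finite spanning set V makes all these bases
  finite in a space of infinite dimension.\<close>

lemma facet_functional_proportional: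
  fixes P F :: "'a::real_vector set" and f g :: "'a \<Rightarrow> real"
  assumes V: "finite V" "P \<subseteq> span V" and FP: "F \<subseteq> P" "F \<noteq> {}"
    and dim: "affine_dimension F = affine_dimension P - 1"
    and lin: "linear f" "linear g"
    and const: "\<And>x y. x \<in> F \<Longrightarrow> y \<in> F \<Longrightarrow> f x = f y" "\<And>x y. x \<in> F \<Longrightarrow> y \<in> F \<Longrightarrow> g x = g y"
    and d: "d \<in> {x - y |x y. x \<in> P \<and> y \<in> P}" "f d \<noteq> 0"
    and e: "e \<in> {x - y |x y. x \<in> P \<and> y \<in> P}"
  shows "g e = g d / f d * f e"
proof -
  define DP where "DP = {x - y |x y. x \<in> P \<and> y \<in> P}"
  define DF where "DF = {x - y |x y. x \<in> F \<and> y \<in> F}"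
  have DFP: "DF \<subseteq> DP" using FP(1) unfolding DF_def DP_def by blast
  have DPV: "DP \<subseteq> span V" unfolding DP_def using V(2) span_diff by blast
  have dims: "dim DP = dim DF + 1"
    using dim FP unfolding affine_dimension_def DF_def DP_def by (auto split: if_splits)
  have DF0: "f y = 0" "g y = 0" if y: "y \<in> DF" for y
  proof -
    obtain u v where uv: "y = u - v" "u \<in> F" "v \<in> F" using y unfolding DF_def by blast
    show "f y = 0" unfolding uv(1) linear_diff[OF lin(1)] using const(1)[OF uv(2,3)] by simp
    show "g y = 0" unfolding uv(1) linear_diff[OF lin(2)] using const(2)[OF uv(2,3)] by simp
  qed
  obtain B where B: "B \<subseteq> DF" "independent B" "DF \<subseteq> span B" "card B = dim DF"
    using basis_exists by blast
  have finB: "finite B" using independent_span_bound[OF V(1) B(2)] B(1) DFP DPV by blast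
  have "f x = 0" if "x \<in> span B" for x
    using linear_eq_0_on_span[OF lin(1) _ that] DF0(1) B(1) by blast
  then have dB: "d \<notin> span B" using d(2) by blast
  then have ind: "independent (insert d B)" using B(2) independent_insertI by blast
  moreover have "insert d B \<subseteq> DP" using d(1) B(1) DFP unfolding DP_def by blast
  ultimately obtain B' where B': "insert d B \<subseteq> B'" "B' \<subseteq> DP" "independent B'" "DP \<subseteq> span B'"
    using maximal_independent_subset_extend by metis
  have finB': "finite B'" using independent_span_bound[OF V(1) B'(3)] B'(2) DPV by blast
  have "card B' = dim DP" using basis_card_eq_dim[OF B'(2,4,3)] .
  moreover have "d \<notin> B" using dB span_base by blast
  then have "card (insert d B) = dim DF + 1" using finB B(4) by simp
  ultimately have "insert d B = B'" using dims B'(1) finB' by (metis card_subset_eq)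
  then have "e \<in> span (insert d B)" using e B'(4) unfolding DP_def by blast
  moreover define h where "h x = g x - g d / f d * f x" for x
  have "linear h"
    unfolding h_def
    by (rule linearI) (simp_all add: linear_add[OF lin(1)] linear_add[OF lin(2)]
      linear_scale[OF lin(1)] linear_scale[OF lin(2)] algebra_simps add_divide_distrib)
  moreover have "h x = 0" if "x \<in> insert d B" for x
    using that d(2) DF0 B(1) unfolding h_def by auto
  ultimately have "h e = 0" using linear_eq_0_on_span by blast
  then show ?thesis unfolding h_def by simp
qed

definition edge_pairs :: "'v wgraph \<Rightarrow> ('v \<times> 'v) set" where
  "edge_pairs G = {(v, w). v \<in> verts G \<and> w \<in> verts G \<and> {v, w} \<in> edges G}"

text \<open>Lifts arbitrary coefficients on the vertices and edges of the graph to the space of the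
  polytope, where they can be compared with the facet functional.\<close>

definition weighted_lhs :: "('v \<Rightarrow> 'n) \<Rightarrow> ('v \<Rightarrow> 'n) \<Rightarrow> 'v wgraph \<Rightarrow> ('v \<Rightarrow> real) \<Rightarrow> ('v set \<Rightarrow> real)
    \<Rightarrow> ('n \<times> 'n \<Rightarrow>\<^sub>0 real) \<Rightarrow> real" where
  "weighted_lhs i i' G zv ze x =
     (\<Sum>v\<in>verts G. zv v * Poly_Mapping.lookup x (i v, i' v))
     - (\<Sum>(v, w)\<in>edge_pairs G. ze {v, w} * Poly_Mapping.lookup x (i v, i' w))"

lemma graphical_lhs_eq_weighted:
  "graphical_lhs i i' G = weighted_lhs i i' G (\<lambda>v. of_int (weight G v)) (\<lambda>_. 1)"
  unfolding graphical_lhs_def weighted_lhs_def edge_pairs_def by (auto simp: fun_eq_iff)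

lemma lookup_scaleR: "Poly_Mapping.lookup (c *\<^sub>R x) p = c * Poly_Mapping.lookup x p"
  for x :: "'a \<Rightarrow>\<^sub>0 real"
proof -
  have "finite {i. c *\<^sub>R Poly_Mapping.lookup x i \<noteq> 0}"
    by (rule finite_subset[OF _ finite_lookup[of x]]) auto
  then show ?thesis
    unfolding scaleR_poly_mapping_def by (simp add: Abs_poly_mapping_inverse)
qed

lemma linear_weighted_lhs: "linear (weighted_lhs i i' G zv ze)"
proof (rule linearI)
  show "weighted_lhs i i' G zv ze (x + y) = weighted_lhs i i' G zv ze x + weighted_lhs i i' G zv ze y" for x y
    unfolding weighted_lhs_def
    by (simp add: lookup_add distrib_left sum.distrib case_prod_unfold)
  show "weighted_lhs i i' G zv ze (c *\<^sub>R x) = c *\<^sub>R weighted_lhs i i' G zv ze x" for c x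
    unfolding weighted_lhs_def
    by (simp add: lookup_scaleR sum_distrib_left right_diff_distrib case_prod_unfold algebra_simps)
qed

lemma finite_arcs: "finite N \<Longrightarrow> finite (arcs N)"
  by (rule finite_subset[of _ "N \<times> N"]) (auto simp: arcs_def)

text \<open>Swapping two neighbours in a linear ordering changes only the coordinates of that pair.\<close>

lemma swap_vector_in_differences:
  fixes N :: "nat set"
  assumes N: "finite N" and ij: "i \<in> N" "j \<in> N" "i \<noteq> j"
  shows "Poly_Mapping.single (i, j) 1 - Poly_Mapping.single (j, i) 1
     \<in> {x - y |x y. x \<in> linear_ordering_polytope N \<and> y \<in> linear_ordering_polytope N}"
proof -
  define M where "M = N - {i, j}"
  define Q where "Q = {i, j} \<times> M \<union> {(a, b). a \<in> M \<and> b \<in> M \<and> a < b}"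
  have "Q \<subseteq> N \<times> N" unfolding Q_def M_def using ij by auto
  then have finQ: "finite Q" using N by (simp add: finite_subset)
  have ord: "insert (a, b) Q \<subseteq> arcs N \<and> strict_linear_order_on N (insert (a, b) Q)"
    if ab: "(a, b) = (i, j) \<or> (a, b) = (j, i)" for a b
  proof
    show "insert (a, b) Q \<subseteq> arcs N" using ab ij unfolding arcs_def Q_def M_def by auto
    have "trans (insert (a, b) Q)"
      unfolding trans_def using ab ij(3) unfolding Q_def M_def by auto
    moreover have "irrefl (insert (a, b) Q)"
      unfolding irrefl_def using ab ij(3) unfolding Q_def M_def by auto
    moreover have "total_on N (insert (a, b) Q)"
      unfolding total_on_def using ab unfolding Q_def M_def by auto
    ultimately show "strict_linear_order_on N (insert (a, b) Q)"
      unfolding strict_linear_order_on_def by blast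
  qed
  have inc: "incidence_vector (insert p Q) = Poly_Mapping.single p 1 + incidence_vector Q" if "p \<notin> Q" for p
    unfolding incidence_vector_def using finQ that by simp
  have notin: "(i, j) \<notin> Q" "(j, i) \<notin> Q" unfolding Q_def M_def by auto
  have "incidence_vector (insert (i, j) Q) \<in> linear_ordering_polytope N"
    "incidence_vector (insert (j, i) Q) \<in> linear_ordering_polytope N"
    unfolding linear_ordering_polytope_def using ord by (auto intro!: hull_inc)
  moreover have "Poly_Mapping.single (i, j) 1 - Poly_Mapping.single (j, i) 1
     = incidence_vector (insert (i, j) Q) - incidence_vector (insert (j, i) Q)"
    using inc notin by simp
  ultimately show ?thesis by blast
qed

section \<open>Orderings on the facet and tight sets\<close>

locale facet_setting =
  fixes G :: "'v wgraph" and N :: "nat set" and i i' :: "'v \<Rightarrow> nat"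
  assumes wg: "weighted_graph G" and ground: "ground_set_for N i i' (verts G)"
begin

lemma fin: "finite (verts G)" "finite N"
  using wg ground unfolding weighted_graph_def ground_set_for_def by auto

lemma finite_pairs: "finite (edge_pairs G)"
  by (rule finite_subset[of _ "verts G \<times> verts G"]) (use fin in \<open>auto simp: edge_pairs_def\<close>)

lemma pairs_neq: "(v, w) \<in> edge_pairs G \<Longrightarrow> v \<noteq> w"
  using wg unfolding edge_pairs_def weighted_graph_def by force

lemma inj: "v \<in> verts G \<Longrightarrow> w \<in> verts G \<Longrightarrow> i v = i w \<longleftrightarrow> v = w"
  "v \<in> verts G \<Longrightarrow> w \<in> verts G \<Longrightarrow> i' v = i' w \<longleftrightarrow> v = w"
  "v \<in> verts G \<Longrightarrow> w \<in> verts G \<Longrightarrow> i v \<noteq> i' w"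
  using ground unfolding ground_set_for_def inj_on_def by blast+

lemma in_N: "v \<in> verts G \<Longrightarrow> i v \<in> N" "v \<in> verts G \<Longrightarrow> i' v \<in> N"
  using ground unfolding ground_set_for_def by auto

text \<open>A direction of the polytope. Its negative term sits at an arc that starts in a primed
  copy, where every \<open>weighted_lhs\<close> vanishes, so this direction reads off a single
  coefficient.\<close>

definition "swap_vec p = Poly_Mapping.single (i (fst p), i' (snd p)) (1::real) - Poly_Mapping.single (i' (snd p), i (fst p)) 1"

lemma lookup_swap_vec:
  assumes "v \<in> verts G" "w \<in> verts G" "v0 \<in> verts G" "w0 \<in> verts G"
  shows "Poly_Mapping.lookup (swap_vec (v0, w0)) (i v, i' w) = (if v = v0 \<and> w = w0 then 1 else 0)"
  using assms inj unfolding swap_vec_def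
  by (auto simp: lookup_minus lookup_single when_def)

lemma weighted_lhs_swap_vertex:
  assumes v0: "v0 \<in> verts G"
  shows "weighted_lhs i i' G zv ze (swap_vec (v0, v0)) = zv v0"
proof -
  have "(\<Sum>v\<in>verts G. zv v * Poly_Mapping.lookup (swap_vec (v0, v0)) (i v, i' v))
     = (\<Sum>v\<in>verts G. if v = v0 then zv v else 0)"
    by (rule sum.cong) (use v0 in \<open>auto simp: lookup_swap_vec\<close>)
  moreover have "(\<Sum>(v, w)\<in>edge_pairs G. ze {v, w} * Poly_Mapping.lookup (swap_vec (v0, v0)) (i v, i' w)) = 0"
  proof (rule sum.neutral, safe)
    fix v w assume vw: "(v, w) \<in> edge_pairs G"
    then have "v \<in> verts G" "w \<in> verts G" unfolding edge_pairs_def by auto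
    then show "ze {v, w} * Poly_Mapping.lookup (swap_vec (v0, v0)) (i v, i' w) = 0"
      using lookup_swap_vec[OF _ _ v0 v0] pairs_neq[OF vw] by auto
  qed
  ultimately show ?thesis unfolding weighted_lhs_def using fin v0 by simp
qed

lemma weighted_lhs_swap_edge:
  assumes vw0: "(v0, w0) \<in> edge_pairs G"
  shows "weighted_lhs i i' G zv ze (swap_vec (v0, w0)) = - ze {v0, w0}"
proof -
  have in0: "v0 \<in> verts G" "w0 \<in> verts G" "v0 \<noteq> w0" using vw0 pairs_neq unfolding edge_pairs_def by auto
  have "(\<Sum>v\<in>verts G. zv v * Poly_Mapping.lookup (swap_vec (v0, w0)) (i v, i' v)) = 0"
    by (rule sum.neutral) (use in0 in \<open>auto simp: lookup_swap_vec\<close>)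
  moreover have "(\<Sum>(v, w)\<in>edge_pairs G. ze {v, w} * Poly_Mapping.lookup (swap_vec (v0, w0)) (i v, i' w))
     = (\<Sum>p\<in>edge_pairs G. if p = (v0, w0) then ze {v0, w0} else 0)"
    by (rule sum.cong) (use in0 in \<open>auto simp: lookup_swap_vec edge_pairs_def split: if_splits\<close>)
  ultimately show ?thesis unfolding weighted_lhs_def using finite_pairs vw0 by simp
qed

lemma weighted_lhs_incidence:
  assumes L: "L \<subseteq> arcs N"
  shows "weighted_lhs i i' G zv ze (incidence_vector L) =
    (\<Sum>v\<in>{v \<in> verts G. (i v, i' v) \<in> L}. zv v)
    - (\<Sum>e\<in>edges G. ze e * real (card {p \<in> edge_pairs G. {fst p, snd p} = e \<and> (i (fst p), i' (snd p)) \<in> L}))"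
proof -
  have finL: "finite L" using L finite_arcs[OF fin(2)] finite_subset by blast
  let ?Q = "{p \<in> edge_pairs G. (i (fst p), i' (snd p)) \<in> L}"
  have "(\<Sum>v\<in>verts G. zv v * Poly_Mapping.lookup (incidence_vector L) (i v, i' v))
      = (\<Sum>v\<in>verts G. if (i v, i' v) \<in> L then zv v else 0)"
    by (rule sum.cong) (auto simp: lookup_incidence_vector[OF finL])
  also have "\<dots> = (\<Sum>v\<in>{v \<in> verts G. (i v, i' v) \<in> L}. zv v)"
    using fin(1) by (simp add: sum.inter_filter)
  finally have 1: "(\<Sum>v\<in>verts G. zv v * Poly_Mapping.lookup (incidence_vector L) (i v, i' v)) = \<dots>" .
  have "(\<Sum>(v, w)\<in>edge_pairs G. ze {v, w} * Poly_Mapping.lookup (incidence_vector L) (i v, i' w))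
      = (\<Sum>p\<in>edge_pairs G. if (i (fst p), i' (snd p)) \<in> L then ze {fst p, snd p} else 0)"
    by (rule sum.cong) (auto simp: lookup_incidence_vector[OF finL])
  also have "\<dots> = (\<Sum>p\<in>?Q. ze {fst p, snd p})"
    using finite_pairs by (simp add: sum.inter_filter)
  also have "\<dots> = (\<Sum>e\<in>edges G. \<Sum>p\<in>{p \<in> ?Q. {fst p, snd p} = e}. ze {fst p, snd p})"
    by (rule sum.group[symmetric])
      (use finite_pairs weighted_graph_finite_edges[OF wg] in \<open>auto simp: edge_pairs_def\<close>)
  also have "\<dots> = (\<Sum>e\<in>edges G. ze e * real (card {p \<in> edge_pairs G. {fst p, snd p} = e \<and> (i (fst p), i' (snd p)) \<in> L}))"
  proof (rule sum.cong)
    fix e assume "e \<in> edges G"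
    have "{p \<in> ?Q. {fst p, snd p} = e} = {p \<in> edge_pairs G. {fst p, snd p} = e \<and> (i (fst p), i' (snd p)) \<in> L}"
      by auto
    moreover have "(\<Sum>p\<in>{p \<in> ?Q. {fst p, snd p} = e}. ze {fst p, snd p}) = (\<Sum>p\<in>{p \<in> ?Q. {fst p, snd p} = e}. ze e)"
      by (rule sum.cong) auto
    ultimately show "(\<Sum>p\<in>{p \<in> ?Q. {fst p, snd p} = e}. ze {fst p, snd p})
      = ze e * real (card {p \<in> edge_pairs G. {fst p, snd p} = e \<and> (i (fst p), i' (snd p)) \<in> L})"
      by simp
  qed simp
  finally show ?thesis unfolding weighted_lhs_def using 1 by simp
qed

text \<open>An ordering \<open>L\<close> selects the set \<open>S\<close> of vertices \<open>v\<close> that precede their copy; if it attains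
  equality, then \<open>S\<close> is tight and every edge inside \<open>S\<close> contributes exactly one arc.\<close>

lemma tight_ordering:
  assumes L: "L \<subseteq> arcs N" "strict_linear_order_on N L"
  shows "graphical_lhs i i' G (incidence_vector L) \<le> of_int (beta G)"
    and "graphical_lhs i i' G (incidence_vector L) = of_int (beta G) \<Longrightarrow>
      \<exists>S. tight_set G S \<and> (\<forall>zv ze. weighted_lhs i i' G zv ze (incidence_vector L) =
        (\<Sum>v\<in>S. zv v) - (\<Sum>e\<in>{e \<in> edges G. e \<subseteq> S}. ze e))"
proof -
  define S where "S = {v \<in> verts G. (i v, i' v) \<in> L}"
  define n where "n e = card {p \<in> edge_pairs G. {fst p, snd p} = e \<and> (i (fst p), i' (snd p)) \<in> L}" for e
  define m where "m e = (if e \<subseteq> S then 1 else 0 :: nat)" for e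
  have finE: "finite (edges G)" using weighted_graph_finite_edges[OF wg] .
  have tr: "trans L" "irrefl L" "total_on N L" using L(2) unfolding strict_linear_order_on_def by auto
  have mn: "m e \<le> n e" if e: "e \<in> edges G" for e
  proof (cases "e \<subseteq> S")
    case True
    obtain v w where vw: "e = {v, w}" "v \<noteq> w"
      using wg e unfolding weighted_graph_def by (meson card_2_iff)
    have in_S: "v \<in> S" "w \<in> S" using True vw by auto
    then have vs: "v \<in> verts G" "w \<in> verts G" "(i v, i' v) \<in> L" "(i w, i' w) \<in> L" unfolding S_def by auto
    \<comment> \<open>Otherwise the ordering would contain the cycle through \<open>i v\<close>,
      \<open>i' v\<close>, \<open>i w\<close>, \<open>i' w\<close> and back to
      \<open>i v\<close>.\<close>
    have "(i v, i' w) \<in> L \<or> (i w, i' v) \<in> L"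
    proof (rule ccontr)
      assume no: "\<not> ?thesis"
      have "(i' w, i v) \<in> L" using tr(3) no in_N vs inj(3)[of v w] unfolding total_on_def by metis
      moreover have "(i' v, i w) \<in> L" using tr(3) no in_N vs inj(3)[of w v] unfolding total_on_def by metis
      ultimately have "(i v, i v) \<in> L" using tr(1) vs unfolding trans_def by meson
      then show False using tr(2) unfolding irrefl_def by blast
    qed
    then have "{p \<in> edge_pairs G. {fst p, snd p} = e \<and> (i (fst p), i' (snd p)) \<in> L} \<noteq> {}"
    proof
      assume "(i v, i' w) \<in> L"
      then have "(v, w) \<in> {p \<in> edge_pairs G. {fst p, snd p} = e \<and> (i (fst p), i' (snd p)) \<in> L}"
        using vs vw e unfolding edge_pairs_def by auto
      then show ?thesis by blast
    next
      assume "(i w, i' v) \<in> L"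
      then have "(w, v) \<in> {p \<in> edge_pairs G. {fst p, snd p} = e \<and> (i (fst p), i' (snd p)) \<in> L}"
        using vs vw e unfolding edge_pairs_def by (auto simp: insert_commute)
      then show ?thesis by blast
    qed
    then have "0 < n e" unfolding n_def using finite_pairs by (simp add: card_gt_0_iff)
    then show ?thesis unfolding m_def by simp
  qed (simp add: m_def)
  have summ: "(\<Sum>e\<in>edges G. c e * real (m e)) = (\<Sum>e\<in>{e \<in> edges G. e \<subseteq> S}. c e)" for c
  proof -
    have "(\<Sum>e\<in>edges G. c e * real (m e)) = (\<Sum>e\<in>edges G. if e \<subseteq> S then c e else 0)"
      by (rule sum.cong) (auto simp: m_def)
    then show ?thesis using finE by (simp add: sum.inter_filter)
  qed
  have lhs: "graphical_lhs i i' G (incidence_vector L) = of_int (sum (weight G) S) - (\<Sum>e\<in>edges G. real (n e))"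
    unfolding graphical_lhs_eq_weighted weighted_lhs_incidence[OF L(1)] S_def[symmetric] n_def[symmetric] by simp
  have ind: "real (num_induced_edges G S) = (\<Sum>e\<in>edges G. real (m e))"
    using summ[of "\<lambda>_. 1"] unfolding num_induced_edges_def by simp
  have le: "(\<Sum>e\<in>edges G. real (m e)) \<le> (\<Sum>e\<in>edges G. real (n e))"
    using mn by (intro sum_mono) simp
  have SV: "S \<subseteq> verts G" unfolding S_def by auto
  have "real_of_int (sum (weight G) S - int (num_induced_edges G S)) \<le> of_int (beta G)"
    using beta_upper[OF fin(1) SV] by linarith
  then have b: "of_int (sum (weight G) S) - (\<Sum>e\<in>edges G. real (m e)) \<le> real_of_int (beta G)"
    using ind by simp
  show "graphical_lhs i i' G (incidence_vector L) \<le> of_int (beta G)"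
    using lhs b le by linarith
  assume eq: "graphical_lhs i i' G (incidence_vector L) = of_int (beta G)"
  \<comment> \<open>With m in place of n the left-hand side is still at most \<open>beta G\<close>,
    so equality leaves no slack between the two sums, and hence none in any term.\<close>
  have eqs: "(\<Sum>e\<in>edges G. real (m e)) = (\<Sum>e\<in>edges G. real (n e))" using lhs b le eq by linarith
  have "n e = m e" if "e \<in> edges G" for e
    using sum_mono_inv[OF eqs _ that finE] mn by simp
  then have "weighted_lhs i i' G zv ze (incidence_vector L) =
      (\<Sum>v\<in>S. zv v) - (\<Sum>e\<in>{e \<in> edges G. e \<subseteq> S}. ze e)" for zv ze
    unfolding weighted_lhs_incidence[OF L(1)] S_def[symmetric] n_def[symmetric] summ[symmetric] by simp
  moreover have "real_of_int (sum (weight G) S - int (num_induced_edges G S)) = of_int (beta G)"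
    using lhs eq eqs ind by simp
  then have "tight_set G S" unfolding tight_set_def using SV of_int_eq_iff by blast
  ultimately show "\<exists>S. tight_set G S \<and> (\<forall>zv ze. weighted_lhs i i' G zv ze (incidence_vector L) =
        (\<Sum>v\<in>S. zv v) - (\<Sum>e\<in>{e \<in> edges G. e \<subseteq> S}. ze e))" by blast
qed

end

text \<open>Every ordering on the facet selects a tight set, so such coefficients give a functional
  that is constant on the facet. It is proportional to the facet functional, and the swap vectors
  compare the two coefficient by coefficient.\<close>

theorem facet_defining_rank:
  fixes zv :: "'v \<Rightarrow> real" and ze :: "'v set \<Rightarrow> real"
  assumes facet: "facet_defining_graph G"
    and k: "\<And>S. tight_set G S \<Longrightarrow> (\<Sum>v\<in>S. zv v) - (\<Sum>e\<in>{e \<in> edges G. e \<subseteq> S}. ze e) = k"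
  shows "\<exists>\<mu>. (\<forall>v\<in>verts G. zv v = \<mu> * of_int (weight G v)) \<and> (\<forall>e\<in>edges G. ze e = \<mu>)"
proof -
  obtain N :: "nat set" and i i' where wg: "weighted_graph G" and ground: "ground_set_for N i i' (verts G)"
    and df: "defines_facet (graphical_lhs i i' G) (of_int (beta G)) (linear_ordering_polytope N)"
    using facet unfolding facet_defining_graph_def by blast
  interpret facet_setting G N i i' using wg ground by unfold_locales
  define V where "V = incidence_vector ` {L. L \<subseteq> arcs N \<and> strict_linear_order_on N L}"
  define P where "P = linear_ordering_polytope N"
  have P: "P = convex hull V" unfolding P_def V_def linear_ordering_polytope_def ..
  have finV: "finite V" unfolding V_def using finite_arcs[OF fin(2)] by simp
  define f where "f = graphical_lhs i i' G"
  define g where "g = weighted_lhs i i' G zv ze"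
  define F where "F = {x \<in> P. f x = of_int (beta G)}"
  have lin: "linear f" "linear g" unfolding f_def g_def graphical_lhs_eq_weighted by (rule linear_weighted_lhs)+
  have facetF: "is_facet_of F P" using df unfolding defines_facet_def F_def P_def f_def by blast
  have V1: "f x \<le> of_int (beta G)" if "x \<in> V" for x
    using that tight_ordering(1) unfolding V_def f_def by blast
  have V2: "g x = k" if x: "x \<in> V" "f x = of_int (beta G)" for x
  proof -
    obtain L where L: "L \<subseteq> arcs N" "strict_linear_order_on N L" "x = incidence_vector L"
      using x(1) unfolding V_def by blast
    obtain S where S: "tight_set G S" "g x = (\<Sum>v\<in>S. zv v) - (\<Sum>e\<in>{e \<in> edges G. e \<subseteq> S}. ze e)"
      using tight_ordering(2)[OF L(1,2)] x(2) L(3) unfolding f_def g_def by blast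
    then show ?thesis using k by simp
  qed
  \<comment> \<open>In a convex combination that attains the bound, only orderings that attain it
    themselves have nonzero coefficients.\<close>
  have gF: "g x = k" if xF: "x \<in> F" for x
  proof -
    obtain u where u: "\<forall>y\<in>V. 0 \<le> u y" "sum u V = 1" "(\<Sum>y\<in>V. u y *\<^sub>R y) = x"
      using xF unfolding F_def P convex_hull_finite[OF finV] by blast
    have fx: "f x = (\<Sum>y\<in>V. u y * f y)" "g x = (\<Sum>y\<in>V. u y * g y)"
      unfolding u(3)[symmetric] by (simp_all add: linear_sum[OF lin(1)] linear_sum[OF lin(2)] linear_scale[OF lin(1)] linear_scale[OF lin(2)])
    have "(\<Sum>y\<in>V. u y * (of_int (beta G) - f y)) = 0"
      using fx(1) xF u(2) unfolding F_def by (simp add: right_diff_distrib sum_subtractf sum_distrib_right[symmetric])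
    then have "\<forall>y\<in>V. u y * (of_int (beta G) - f y) = 0"
      using u(1) V1 by (subst (asm) sum_nonneg_eq_0_iff) (auto simp: finV)
    then have "u y * g y = u y * k" if "y \<in> V" for y
      using V2[OF that] that by auto
    then have "g x = (\<Sum>y\<in>V. u y * k)" unfolding fx(2) by (intro sum.cong) auto
    then show ?thesis using u(2) by (simp add: sum_distrib_right[symmetric])
  qed
  have DPv: "swap_vec (v, w) \<in> {x - y |x y. x \<in> P \<and> y \<in> P}" if "v \<in> verts G" "w \<in> verts G" for v w
    using swap_vector_in_differences[OF fin(2), of "i v" "i' w"] in_N that inj(3)[OF that]
    unfolding swap_vec_def P_def by simp
  have fv: "f (swap_vec (v, v)) = of_int (weight G v)" "g (swap_vec (v, v)) = zv v" if "v \<in> verts G" for v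
    unfolding f_def g_def graphical_lhs_eq_weighted using weighted_lhs_swap_vertex[OF that] by auto
  have fe: "f (swap_vec (v, w)) = - 1" "g (swap_vec (v, w)) = - ze {v, w}" if "(v, w) \<in> edge_pairs G" for v w
    unfolding f_def g_def graphical_lhs_eq_weighted using weighted_lhs_swap_edge[OF that] by auto
  obtain r where r: "r \<in> verts G" using wg unfolding weighted_graph_def by fastforce
  have fr: "f (swap_vec (r, r)) \<noteq> 0" using fv(1)[OF r] r wg unfolding weighted_graph_def by auto
  define \<mu> where "\<mu> = g (swap_vec (r, r)) / f (swap_vec (r, r))"
  have ratio: "g e = \<mu> * f e" if "e \<in> {x - y |x y. x \<in> P \<and> y \<in> P}" for e
    unfolding \<mu>_def
  proof (rule facet_functional_proportional[OF finV _ _ _ _ lin])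
    show "P \<subseteq> span V" unfolding P using convex_hull_subset_span by blast
    show "F \<subseteq> P" unfolding F_def by blast
    show "F \<noteq> {}" "affine_dimension F = affine_dimension P - 1" using facetF unfolding is_facet_of_def by auto
    show "f x = f y" if "x \<in> F" "y \<in> F" for x y using that unfolding F_def by simp
    show "g x = g y" if "x \<in> F" "y \<in> F" for x y using that gF by simp
    show "swap_vec (r, r) \<in> {x - y |x y. x \<in> P \<and> y \<in> P}" using DPv[OF r r] .
  qed (use fr that in auto)
  have "zv v = \<mu> * of_int (weight G v)" if "v \<in> verts G" for v
    using ratio[OF DPv[OF that that]] fv[OF that] by simp
  moreover have "ze e = \<mu>" if e: "e \<in> edges G" for e
  proof -
    obtain v w where vw: "e = {v, w}" "v \<noteq> w"
      using wg e unfolding weighted_graph_def by (meson card_2_iff)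
    then have "(v, w) \<in> edge_pairs G" "v \<in> verts G" "w \<in> verts G"
      using wg e unfolding weighted_graph_def edge_pairs_def by auto
    then show ?thesis using ratio[OF DPv[of v w]] fe[of v w] vw by simp
  qed
  ultimately show ?thesis by blast
qed

section \<open>Reduction to unit weights\<close>

text \<open>From here on the facet condition enters only through \<open>rank\<close>.\<close>

locale ranked_graph =
  fixes G :: "'v wgraph" and lam :: nat
  assumes wg: "weighted_graph G" and lam: "subdefect G = int lam"
    and rank: "\<And>(zv :: 'v \<Rightarrow> real) ze k.
      (\<And>S. tight_set G S \<Longrightarrow> (\<Sum>v\<in>S. zv v) - (\<Sum>e\<in>{e \<in> edges G. e \<subseteq> S}. ze e) = k) \<Longrightarrow>
      \<exists>\<mu>. (\<forall>v\<in>verts G. zv v = \<mu> * of_int (weight G v)) \<and> (\<forall>e\<in>edges G. ze e = \<mu>)"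
begin

abbreviation "V \<equiv> verts G"
abbreviation "E \<equiv> edges G"

definition "wt v = nat (weight G v)"

lemma finV: "finite V" and finE: "finite E"
  using wg weighted_graph_finite_edges[OF wg] unfolding weighted_graph_def by auto

lemma edge_sub: "e \<in> E \<Longrightarrow> v \<in> e \<Longrightarrow> v \<in> V"
  using wg unfolding weighted_graph_def by blast

lemma edge_card: "e \<in> E \<Longrightarrow> card e = 2"
  using wg unfolding weighted_graph_def by blast

lemma edge_finite: "e \<in> E \<Longrightarrow> finite e"
  using edge_card by (metis card.infinite zero_neq_numeral)

lemma edge_ends: assumes "e \<in> E" "u \<in> e" obtains v where "v \<in> e" "v \<noteq> u" "e = {u, v}"
proof -
  obtain x y where "e = {x, y}" "x \<noteq> y" using edge_card[OF assms(1)] by (meson card_2_iff)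
  then show ?thesis using assms(2) that[of x] that[of y] by auto
qed

lemma weight_pos: "v \<in> V \<Longrightarrow> 0 < weight G v"
  using wg unfolding weighted_graph_def by blast

lemma wt_pos: "v \<in> V \<Longrightarrow> 0 < wt v"
  using weight_pos unfolding wt_def by auto

lemma int_wt: "v \<in> V \<Longrightarrow> int (wt v) = weight G v"
  using weight_pos[of v] unfolding wt_def by auto

lemma third_vertex: "\<exists>w\<in>V. w \<noteq> u \<and> w \<noteq> v"
proof (rule ccontr)
  assume "\<not> ?thesis"
  then have "V \<subseteq> {u, v}" by blast
  then have "card V \<le> card {u, v}" by (intro card_mono) auto
  also have "\<dots> \<le> 2" by (simp add: card_insert_if)
  finally show False using wg unfolding weighted_graph_def by simp
qed

lemma beta_nonneg: "0 \<le> beta G"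
proof -
  have "{} \<notin> E" using edge_card by fastforce
  then have "{e \<in> E. e \<subseteq> {}} = {}" by auto
  then have "num_induced_edges G {} = 0" unfolding num_induced_edges_def by (metis card.empty)
  then show ?thesis using beta_upper[OF finV, of "{}"] by simp
qed

text \<open>If every tight set met e, the number of its ends in S, minus 1 if e lies inside S, would
  always be 1. This functional vanishes at a third vertex of the graph, so \<open>rank\<close> would
  make it zero.\<close>

lemma exists_tight_missing:
  assumes e: "e \<in> E"
  shows "\<exists>S. tight_set G S \<and> S \<inter> e = {}"
proof (rule ccontr)
  assume no: "\<not> ?thesis"
  obtain u v where uv: "e = {u, v}" "u \<noteq> v" using edge_card[OF e] by (meson card_2_iff)
  define zv :: "'v \<Rightarrow> real" where "zv w = (if w \<in> e then 1 else 0)" for w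
  define ze :: "'v set \<Rightarrow> real" where "ze d = (if d = e then 1 else 0)" for d
  have k: "(\<Sum>v\<in>S. zv v) - (\<Sum>d\<in>{d \<in> E. d \<subseteq> S}. ze d) = 1" if S: "tight_set G S" for S
  proof -
    have finS: "finite S" using S finV finite_subset unfolding tight_set_def by blast
    have "(\<Sum>v\<in>S. zv v) = real (card (S \<inter> e))"
      unfolding zv_def using finS by (simp add: sum.If_cases Int_def)
    moreover have "(\<Sum>d\<in>{d \<in> E. d \<subseteq> S}. ze d) = (if e \<subseteq> S then 1 else 0)"
      unfolding ze_def using finE e by simp
    moreover have "S \<inter> e \<noteq> {}" using no S by blast
    then have "card (S \<inter> e) = (if e \<subseteq> S then 2 else 1)"
      using uv by (cases "u \<in> S"; cases "v \<in> S") auto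
    ultimately show ?thesis by simp
  qed
  obtain \<mu> where \<mu>: "\<forall>v\<in>V. zv v = \<mu> * of_int (weight G v)" using rank[OF k] by blast
  obtain w where w: "w \<in> V" "w \<noteq> u" "w \<noteq> v" using third_vertex by blast
  then have "\<mu> = 0" using \<mu> weight_pos[OF w(1)] uv unfolding zv_def by auto
  then have "zv u = 0" using \<mu> edge_sub[OF e] uv by auto
  then show False unfolding zv_def uv by simp
qed

text \<open>The auxiliary graph has a vertex \<open>Inl (v, i)\<close> for every vertex \<open>v\<close> and every \<open>i\<close> below its
  weight, and replaces every edge \<open>e = uv\<close> by the path \<open>u, Inr (e, u), Inr (e, v), v\<close>. Tight sets
  of the weighted graph become maximum stable sets, and the defect stays the same.\<close>

type_synonym 'a gadget = "('a \<times> nat) + ('a set \<times> 'a)"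

definition BX :: "'v gadget set" where
  "BX = Inl ` (SIGMA v:V. {..<wt v}) \<union> Inr ` (SIGMA e:E. e)"

definition BE :: "'v gadget set set" where
  "BE = {{Inl (v, i), Inr (e, v)} |v i e. v \<in> V \<and> i < wt v \<and> e \<in> E \<and> v \<in> e}
      \<union> {{Inr (e, u), Inr (e, v)} |e u v. e \<in> E \<and> u \<in> e \<and> v \<in> e \<and> u \<noteq> v}"

definition "\<alpha>B = nat (beta G) + card E"

lemma BX_iff [simp]:
  "Inl (v, i) \<in> BX \<longleftrightarrow> v \<in> V \<and> i < wt v" "Inr (e, u) \<in> BX \<longleftrightarrow> e \<in> E \<and> u \<in> e"
  unfolding BX_def by auto

lemma BE_iff [simp]:
  "{Inl p, Inl q} \<notin> BE"
  "{Inl (v, i), Inr (e, u)} \<in> BE \<longleftrightarrow> u = v \<and> v \<in> V \<and> i < wt v \<and> e \<in> E \<and> v \<in> e"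
  "{Inr (e, u), Inl (v, i)} \<in> BE \<longleftrightarrow> u = v \<and> v \<in> V \<and> i < wt v \<and> e \<in> E \<and> v \<in> e"
  "{Inr (e, u), Inr (d, v)} \<in> BE \<longleftrightarrow> e = d \<and> e \<in> E \<and> u \<in> e \<and> v \<in> e \<and> u \<noteq> v"
  unfolding BE_def by (auto simp: doubleton_eq_iff)

lemma BE_irrefl: "{x} \<notin> BE"
  unfolding BE_def by (auto simp: doubleton_eq_iff)

lemma BE_in: "{x, y} \<in> BE \<Longrightarrow> x \<in> BX"
  by (cases x; cases y) auto

lemma finite_BX: "finite BX"
  unfolding BX_def using finV finE edge_finite by auto

lemma finite_BE: "finite BE"
proof -
  have "BE \<subseteq> Pow BX" unfolding BE_def by auto
  then show ?thesis using finite_BX finite_subset by blast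
qed

lemma sum_wt: "S \<subseteq> V \<Longrightarrow> int (\<Sum>v\<in>S. wt v) = sum (weight G) S"
  unfolding of_nat_sum by (rule sum.cong) (auto simp: int_wt)

lemma card_BX: "card BX = 2 * \<alpha>B + lam"
proof -
  have "card BX = card (Inl ` (SIGMA v:V. {..<wt v}) :: 'v gadget set) + card (Inr ` (SIGMA e:E. e) :: 'v gadget set)"
    unfolding BX_def by (rule card_Un_disjoint) (use finV finE edge_finite in auto)
  also have "card (Inl ` (SIGMA v:V. {..<wt v}) :: 'v gadget set) = (\<Sum>v\<in>V. wt v)"
    using finV by (subst card_image) (auto simp: card_SigmaI)
  also have "card (Inr ` (SIGMA e:E. e) :: 'v gadget set) = (\<Sum>e\<in>E. card e)"
    using finE edge_finite by (subst card_image) (auto simp: card_SigmaI)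
  also have "(\<Sum>e\<in>E. card e) = 2 * card E" using edge_card by simp
  finally have "int (card BX) = sum (weight G) V + 2 * int (card E)" using sum_wt[of V] by simp
  moreover have "int \<alpha>B = beta G + int (card E)" unfolding \<alpha>B_def using beta_nonneg by simp
  ultimately show ?thesis using lam unfolding subdefect_def by linarith
qed

lemma induced_edges_split:
  "card {e \<in> E. \<not> e \<subseteq> S} + num_induced_edges G S = card E"
proof -
  have "card ({e \<in> E. \<not> e \<subseteq> S} \<union> {e \<in> E. e \<subseteq> S}) = card {e \<in> E. \<not> e \<subseteq> S} + card {e \<in> E. e \<subseteq> S}"
    by (rule card_Un_disjoint) (use finE in auto)
  moreover have "{e \<in> E. \<not> e \<subseteq> S} \<union> {e \<in> E. e \<subseteq> S} = E" by blast
  ultimately show ?thesis unfolding num_induced_edges_def by simp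
qed

text \<open>Let S consist of the vertices with a copy in T. An edge contributes at most one of its
  two halves, and none if it lies inside S, because a half is adjacent to all copies of its vertex.
  So T has at most \<open>a(S) - ||S|| + card E\<close> elements.\<close>

lemma BE_stable_bound:
  assumes T: "stable_in BX (\<lambda>x y. {x, y} \<in> BE) T"
  shows "card T \<le> \<alpha>B"
proof -
  have TX: "T \<subseteq> BX" and st: "\<And>x y. x \<in> T \<Longrightarrow> y \<in> T \<Longrightarrow> {x, y} \<notin> BE"
    using T unfolding stable_in_def by auto
  define S where "S = {v \<in> V. \<exists>i. Inl (v, i) \<in> T}"
  define P where "P = {p. Inr p \<in> T}"
  have SV: "S \<subseteq> V" unfolding S_def by auto
  have finS: "finite S" using SV finV finite_subset by blast
  have P_sub: "P \<subseteq> (SIGMA e:E. e)" using TX unfolding P_def by fastforce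
  have finP: "finite P" using P_sub finE edge_finite by (metis (no_types, lifting) finite_SigmaI finite_subset)
  have inj: "inj_on fst P"
  proof (rule inj_onI)
    fix p q assume pq: "p \<in> P" "q \<in> P" "fst p = fst q"
    obtain e u where p: "p = (e, u)" by (cases p)
    obtain v where q: "q = (e, v)" using pq(3) p by (cases q) auto
    have "e \<in> E" "u \<in> e" "v \<in> e" using P_sub pq p q by auto
    moreover have "{Inr (e, u), Inr (e, v)} \<notin> BE" using st pq p q unfolding P_def by blast
    ultimately show "p = q" using p q by simp
  qed
  have "fst ` P \<subseteq> {e \<in> E. \<not> e \<subseteq> S}"
  proof
    fix e assume "e \<in> fst ` P"
    then obtain u where eu: "(e, u) \<in> P" by force
    then have e: "e \<in> E" "u \<in> e" using P_sub by auto
    have "u \<notin> S"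
    proof
      assume "u \<in> S"
      then obtain i where i: "Inl (u, i) \<in> T" unfolding S_def by blast
      then have "{Inl (u, i), Inr (e, u)} \<in> BE" using e edge_sub TX by auto
      then show False using st[OF i] eu unfolding P_def by blast
    qed
    then show "e \<in> {e \<in> E. \<not> e \<subseteq> S}" using e by blast
  qed
  then have "card (fst ` P) \<le> card {e \<in> E. \<not> e \<subseteq> S}" using finE by (intro card_mono) auto
  then have cP: "card P \<le> card {e \<in> E. \<not> e \<subseteq> S}" using card_image[OF inj] by simp
  have "T \<subseteq> Inl ` (SIGMA v:S. {..<wt v}) \<union> Inr ` P"
  proof
    fix x assume x: "x \<in> T"
    show "x \<in> Inl ` (SIGMA v:S. {..<wt v}) \<union> Inr ` P"
    proof (cases x)
      case (Inl p)
      then obtain v i where "x = Inl (v, i)" by (cases p) auto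
      then have "v \<in> S" "i < wt v" using x TX unfolding S_def by auto
      then show ?thesis using \<open>x = Inl (v, i)\<close> by blast
    next
      case (Inr p)
      then show ?thesis using x unfolding P_def by blast
    qed
  qed
  then have "card T \<le> card (Inl ` (SIGMA v:S. {..<wt v}) \<union> Inr ` P :: 'v gadget set)"
    by (rule card_mono[rotated]) (use finS finP in auto)
  also have "\<dots> \<le> card (Inl ` (SIGMA v:S. {..<wt v}) :: 'v gadget set) + card (Inr ` P :: 'v gadget set)"
    by (rule card_Un_le)
  also have "card (Inl ` (SIGMA v:S. {..<wt v}) :: 'v gadget set) = (\<Sum>v\<in>S. wt v)"
    using finS by (subst card_image) (auto simp: card_SigmaI)
  also have "card (Inr ` P :: 'v gadget set) = card P" by (rule card_image) auto
  finally have "int (card T) \<le> int (\<Sum>v\<in>S. wt v) + int (card P)" by linarith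
  then have "int (card T) \<le> sum (weight G) S + int (card {e \<in> E. \<not> e \<subseteq> S})"
    using sum_wt[OF SV] cP by linarith
  also have "\<dots> = sum (weight G) S - int (num_induced_edges G S) + int (card E)"
    using induced_edges_split[of S] by linarith
  also have "\<dots> \<le> beta G + int (card E)" using beta_upper[OF finV SV] by linarith
  finally show ?thesis unfolding \<alpha>B_def using beta_nonneg by linarith
qed

text \<open>An edge not inside S can contribute the half at an end outside S. If both ends are
  outside S, the choice is free, and \<open>gadget_rank\<close> exploits this freedom.\<close>

definition "valid_choice S c \<longleftrightarrow> (\<forall>e\<in>E. \<not> e \<subseteq> S \<longrightarrow> c e \<in> e - S)"

definition unif :: "'v set \<Rightarrow> ('v set \<Rightarrow> 'v) \<Rightarrow> 'v gadget set" where
  "unif S c = Inl ` (SIGMA v:S. {..<wt v}) \<union> Inr ` (\<lambda>e. (e, c e)) ` {e \<in> E. \<not> e \<subseteq> S}"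

lemma unif_iff [simp]:
  "Inl (v, i) \<in> unif S c \<longleftrightarrow> v \<in> S \<and> i < wt v"
  "Inr (e, u) \<in> unif S c \<longleftrightarrow> e \<in> E \<and> \<not> e \<subseteq> S \<and> u = c e"
  unfolding unif_def by auto

lemma valid_choice_exists: "\<exists>c. valid_choice S c"
proof -
  have "\<forall>e. \<exists>u. e \<in> E \<longrightarrow> \<not> e \<subseteq> S \<longrightarrow> u \<in> e - S" by blast
  then show ?thesis unfolding valid_choice_def by metis
qed

lemma sum_unif:
  fixes \<zeta> :: "'v gadget \<Rightarrow> 'b::comm_monoid_add"
  assumes S: "S \<subseteq> V"
  shows "sum \<zeta> (unif S c) = (\<Sum>v\<in>S. \<Sum>i<wt v. \<zeta> (Inl (v, i))) + (\<Sum>e\<in>{e \<in> E. \<not> e \<subseteq> S}. \<zeta> (Inr (e, c e)))"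
proof -
  have finS: "finite S" using S finV finite_subset by blast
  have "sum \<zeta> (unif S c) = sum \<zeta> (Inl ` (SIGMA v:S. {..<wt v})) + sum \<zeta> (Inr ` (\<lambda>e. (e, c e)) ` {e \<in> E. \<not> e \<subseteq> S})"
    unfolding unif_def by (rule sum.union_disjoint) (use finS finE in auto)
  also have "sum \<zeta> (Inl ` (SIGMA v:S. {..<wt v})) = (\<Sum>p\<in>(SIGMA v:S. {..<wt v}). \<zeta> (Inl p))"
    by (subst sum.reindex) auto
  also have "\<dots> = (\<Sum>v\<in>S. \<Sum>i<wt v. \<zeta> (Inl (v, i)))"
    using finS by (subst sum.Sigma) (auto simp: case_prod_unfold)
  also have "sum \<zeta> (Inr ` (\<lambda>e. (e, c e)) ` {e \<in> E. \<not> e \<subseteq> S}) = (\<Sum>e\<in>{e \<in> E. \<not> e \<subseteq> S}. \<zeta> (Inr (e, c e)))"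
    by (subst sum.reindex, simp add: inj_on_def)+ (simp add: o_def)
  finally show ?thesis .
qed

lemma card_unif:
  assumes S: "tight_set G S"
  shows "card (unif S c) = \<alpha>B"
proof -
  have SV: "S \<subseteq> V" using S unfolding tight_set_def by blast
  have "card (unif S c) = (\<Sum>v\<in>S. wt v) + card {e \<in> E. \<not> e \<subseteq> S}"
    using sum_unif[OF SV, of "\<lambda>_. 1::nat" c] by simp
  then have "int (card (unif S c)) = sum (weight G) S + int (card {e \<in> E. \<not> e \<subseteq> S})"
    using sum_wt[OF SV] by simp
  also have "\<dots> = beta G + int (card E)"
    using induced_edges_split[of S] S unfolding tight_set_def by linarith
  finally show ?thesis unfolding \<alpha>B_def using beta_nonneg by linarith
qed

lemma unif_stable:
  assumes S: "S \<subseteq> V" and c: "valid_choice S c" and xy: "x \<in> unif S c" "y \<in> unif S c"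
  shows "{x, y} \<notin> BE"
proof (cases x)
  case (Inl p)
  show ?thesis
  proof (cases y)
    case (Inr q)
    then show ?thesis using Inl xy c unfolding valid_choice_def by (cases p; cases q) auto
  qed (simp add: Inl)
next
  case (Inr p)
  show ?thesis
  proof (cases y)
    case (Inl q)
    then show ?thesis using Inr xy c unfolding valid_choice_def by (cases p; cases q) auto
  next
    case (Inr q)
    then show ?thesis using \<open>x = Inr p\<close> xy by (cases p; cases q) auto
  qed
qed

lemma unif_sub:
  assumes S: "S \<subseteq> V" and c: "valid_choice S c"
  shows "unif S c \<subseteq> BX"
proof
  fix x assume x: "x \<in> unif S c"
  show "x \<in> BX"
  proof (cases x)
    case (Inl p)
    then show ?thesis using x S by (cases p) auto
  next
    case (Inr p)
    then show ?thesis using x c unfolding valid_choice_def by (cases p) auto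
  qed
qed

text \<open>Changing the choice at e for a tight set that misses e shows that both halves of e carry
  the same value. With the halves merged and the copies added up, \<open>rank\<close> applies.
  Single copies remain undetermined, as \<open>unif S c\<close> contains either all copies of a
  vertex or none.\<close>

lemma gadget_rank:
  fixes \<zeta> :: "'v gadget \<Rightarrow> real"
  assumes k: "\<And>S c. tight_set G S \<Longrightarrow> valid_choice S c \<Longrightarrow> sum \<zeta> (unif S c) = k"
  shows "\<exists>\<mu>. (\<forall>v\<in>V. (\<Sum>i<wt v. \<zeta> (Inl (v, i))) = \<mu> * real (wt v)) \<and> (\<forall>e\<in>E. \<forall>u\<in>e. \<zeta> (Inr (e, u)) = \<mu>)"
proof -
  define zv where "zv v = (\<Sum>i<wt v. \<zeta> (Inl (v, i)))" for v
  define ze where "ze e = \<zeta> (Inr (e, SOME u. u \<in> e))" for e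
  have same: "\<zeta> (Inr (e, u)) = \<zeta> (Inr (e, v))" if e: "e \<in> E" "u \<in> e" "v \<in> e" for e u v
  proof -
    obtain S where S: "tight_set G S" "S \<inter> e = {}" using exists_tight_missing[OF e(1)] by blast
    have SV: "S \<subseteq> V" using S unfolding tight_set_def by blast
    obtain c where c: "valid_choice S c" using valid_choice_exists by blast
    have ne: "\<not> e \<subseteq> S" using S(2) e(2) by blast
    have val: "valid_choice S (c(e := w))" if "w \<in> e" for w
      using c that S(2) unfolding valid_choice_def by auto
    have "sum \<zeta> (unif S (c(e := w))) = (\<Sum>v\<in>S. zv v) + ((\<Sum>d\<in>{d \<in> E. \<not> d \<subseteq> S} - {e}. \<zeta> (Inr (d, c d))) + \<zeta> (Inr (e, w)))" for w
    proof -
      have "(\<Sum>d\<in>{d \<in> E. \<not> d \<subseteq> S}. \<zeta> (Inr (d, (c(e := w)) d)))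
        = \<zeta> (Inr (e, (c(e := w)) e)) + (\<Sum>d\<in>{d \<in> E. \<not> d \<subseteq> S} - {e}. \<zeta> (Inr (d, (c(e := w)) d)))"
        by (rule sum.remove) (use finE e(1) ne in auto)
      also have "(\<Sum>d\<in>{d \<in> E. \<not> d \<subseteq> S} - {e}. \<zeta> (Inr (d, (c(e := w)) d))) = (\<Sum>d\<in>{d \<in> E. \<not> d \<subseteq> S} - {e}. \<zeta> (Inr (d, c d)))"
        by (rule sum.cong) auto
      finally show ?thesis unfolding sum_unif[OF SV] zv_def by simp
    qed
    from this[of u] this[of v] show ?thesis using k[OF S(1) val[OF e(2)]] k[OF S(1) val[OF e(3)]] by simp
  qed
  have ze: "\<zeta> (Inr (e, u)) = ze e" if "e \<in> E" "u \<in> e" for e u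
    unfolding ze_def using same[OF that someI[of "\<lambda>u. u \<in> e" u]] that by simp
  have "(\<Sum>v\<in>S. zv v) - (\<Sum>e\<in>{e \<in> E. e \<subseteq> S}. ze e) = k - sum ze E" if S: "tight_set G S" for S
  proof -
    have SV: "S \<subseteq> V" using S unfolding tight_set_def by blast
    obtain c where c: "valid_choice S c" using valid_choice_exists by blast
    have "(\<Sum>e\<in>{e \<in> E. \<not> e \<subseteq> S}. \<zeta> (Inr (e, c e))) = (\<Sum>e\<in>{e \<in> E. \<not> e \<subseteq> S}. ze e)"
      by (rule sum.cong) (use c ze in \<open>auto simp: valid_choice_def\<close>)
    moreover have "sum ze ({e \<in> E. \<not> e \<subseteq> S} \<union> {e \<in> E. e \<subseteq> S}) = sum ze {e \<in> E. \<not> e \<subseteq> S} + sum ze {e \<in> E. e \<subseteq> S}"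
      by (rule sum.union_disjoint) (use finE in auto)
    moreover have "{e \<in> E. \<not> e \<subseteq> S} \<union> {e \<in> E. e \<subseteq> S} = E" by blast
    ultimately show ?thesis
      using k[OF S c] unfolding sum_unif[OF SV] zv_def[symmetric] by simp
  qed
  from rank[OF this] obtain \<mu> where \<mu>: "\<forall>v\<in>V. zv v = \<mu> * of_int (weight G v)" "\<forall>e\<in>E. ze e = \<mu>" by blast
  have "zv v = \<mu> * real (wt v)" if "v \<in> V" for v
    using \<mu>(1) that int_wt[OF that] by (metis of_int_of_nat_eq)
  then show ?thesis using \<mu>(2) ze unfolding zv_def by auto
qed

end

section \<open>The critical subgraph of the auxiliary graph\<close>

context ranked_graph
begin

text \<open>Deleting edges cannot lower the stability number, so an upper bound is enough to keep
  it. A smallest edge set of this kind is critical.\<close>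

definition "preserving F \<longleftrightarrow> F \<subseteq> BE \<and> (\<forall>S. stable_in BX (\<lambda>x y. {x, y} \<in> F) S \<longrightarrow> card S \<le> \<alpha>B)"

definition "F = (SOME F. preserving F \<and> (\<forall>F'. preserving F' \<longrightarrow> card F \<le> card F'))"

lemma F_minimal: "preserving F" "preserving F' \<Longrightarrow> card F \<le> card F'"
proof -
  have "preserving BE" unfolding preserving_def using BE_stable_bound by blast
  then have "\<exists>F. preserving F \<and> (\<forall>F'. preserving F' \<longrightarrow> card F \<le> card F')"
    using ex_has_least_nat[of preserving BE card] by blast
  from someI_ex[OF this] show "preserving F" "preserving F' \<Longrightarrow> card F \<le> card F'"
    unfolding F_def by blast+
qed

lemma F_sub: "F \<subseteq> BE"
  using F_minimal(1) unfolding preserving_def by blast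

lemma finite_F: "finite F"
  using F_sub finite_BE finite_subset by blast

abbreviation "adjF x y \<equiv> {x, y} \<in> F"

lemma F_stable_bound: "stable_in BX adjF S \<Longrightarrow> card S \<le> \<alpha>B"
  using F_minimal(1) unfolding preserving_def by blast

lemma unif_stable_F:
  assumes "tight_set G S" "valid_choice S c"
  shows "stable_in BX adjF (unif S c)"
  using unif_stable[of S c] unif_sub[of S c] assms F_sub unfolding stable_in_def tight_set_def by blast

lemma unif_extend:
  assumes S: "tight_set G S" "valid_choice S c" and x: "x \<in> BX" "x \<notin> unif S c"
  shows "\<exists>y\<in>unif S c. adjF x y"
proof (rule ccontr)
  assume no: "\<not> ?thesis"
  have "{x} \<notin> F" using BE_irrefl F_sub by blast
  then have "stable_in BX adjF (insert x (unif S c))"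
    using unif_stable_F[OF S] x(1) no unfolding stable_in_def by (auto simp: insert_commute)
  then have "card (insert x (unif S c)) \<le> \<alpha>B" by (rule F_stable_bound)
  moreover have "finite (unif S c)"
    using finite_subset[OF unif_sub finite_BX] S unfolding tight_set_def by blast
  ultimately show False using card_unif[OF S(1), of c] x(2) by simp
qed

lemma gadget_zero:
  fixes \<zeta> :: "'v gadget \<Rightarrow> real"
  assumes k: "\<And>S c. tight_set G S \<Longrightarrow> valid_choice S c \<Longrightarrow> sum \<zeta> (unif S c) = k"
    and z: "(\<exists>w\<in>V. (\<Sum>i<wt w. \<zeta> (Inl (w, i))) = 0) \<or> (\<exists>e\<in>E. \<exists>u\<in>e. \<zeta> (Inr (e, u)) = 0)"
  shows "\<And>v. v \<in> V \<Longrightarrow> (\<Sum>i<wt v. \<zeta> (Inl (v, i))) = 0" "\<And>e u. e \<in> E \<Longrightarrow> u \<in> e \<Longrightarrow> \<zeta> (Inr (e, u)) = 0"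
proof -
  obtain \<mu> where \<mu>: "\<forall>v\<in>V. (\<Sum>i<wt v. \<zeta> (Inl (v, i))) = \<mu> * real (wt v)" "\<forall>e\<in>E. \<forall>u\<in>e. \<zeta> (Inr (e, u)) = \<mu>"
    using gadget_rank[OF k] by blast
  have "\<mu> = 0"
    using z
  proof
    assume "\<exists>w\<in>V. (\<Sum>i<wt w. \<zeta> (Inl (w, i))) = 0"
    then obtain w where w: "w \<in> V" "\<mu> * real (wt w) = 0" using \<mu>(1) by auto
    then show ?thesis using wt_pos[OF w(1)] by simp
  qed (use \<mu>(2) in auto)
  then show "\<And>v. v \<in> V \<Longrightarrow> (\<Sum>i<wt v. \<zeta> (Inl (v, i))) = 0" "\<And>e u. e \<in> E \<Longrightarrow> u \<in> e \<Longrightarrow> \<zeta> (Inr (e, u)) = 0"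
    using \<mu> by auto
qed

lemma sum_indicator:
  fixes T :: "'a set"
  assumes "finite T"
  shows "(\<Sum>x\<in>T. if x \<in> A then 1 else 0 :: real) = real (card (T \<inter> A))"
  using assms by (simp add: sum.If_cases Int_def)

lemma finite_unif: "tight_set G S \<Longrightarrow> valid_choice S c \<Longrightarrow> finite (unif S c)"
  using finite_subset[OF unif_sub finite_BX] unfolding tight_set_def by blast

text \<open>An indicator is nonnegative, so a vanishing sum over the copies of a vertex forces each
  single copy to vanish, which \<open>gadget_rank\<close> by itself does not give.\<close>

lemma indicator_zero:
  assumes A: "A \<subseteq> BX" and k: "\<And>S c. tight_set G S \<Longrightarrow> valid_choice S c \<Longrightarrow> card (unif S c \<inter> A) = k"
    and z: "(\<exists>w\<in>V. \<forall>i. Inl (w, i) \<notin> A) \<or> (\<exists>e\<in>E. \<exists>u\<in>e. Inr (e, u) \<notin> A)"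
  shows "A = {}"
proof -
  define \<zeta> :: "'v gadget \<Rightarrow> real" where "\<zeta> x = (if x \<in> A then 1 else 0)" for x
  have k': "sum \<zeta> (unif S c) = real k" if "tight_set G S" "valid_choice S c" for S c
    unfolding \<zeta>_def using k[OF that] finite_unif[OF that] by (simp add: sum_indicator)
  have "(\<exists>w\<in>V. (\<Sum>i<wt w. \<zeta> (Inl (w, i))) = 0) \<or> (\<exists>e\<in>E. \<exists>u\<in>e. \<zeta> (Inr (e, u)) = 0)"
    using z
  proof
    assume "\<exists>w\<in>V. \<forall>i. Inl (w, i) \<notin> A"
    then obtain w where "w \<in> V" "\<forall>i. Inl (w, i) \<notin> A" by blast
    then have "w \<in> V" "(\<Sum>i<wt w. \<zeta> (Inl (w, i))) = 0" unfolding \<zeta>_def by auto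
    then show ?thesis by blast
  qed (auto simp: \<zeta>_def)
  note zero = gadget_zero[OF k' this]
  have "x \<notin> A" for x
  proof
    assume x: "x \<in> A"
    show False
    proof (cases x)
      case (Inl p)
      then obtain v i where vi: "x = Inl (v, i)" by (cases p) auto
      then have v: "v \<in> V" "i < wt v" using x A by auto
      have "(\<Sum>i<wt v. \<zeta> (Inl (v, i))) = 0" using zero(1) v by blast
      then have "\<forall>i\<in>{..<wt v}. \<zeta> (Inl (v, i)) = 0"
        by (subst (asm) sum_nonneg_eq_0_iff) (auto simp: \<zeta>_def)
      then have "\<zeta> (Inl (v, i)) = 0" using v by blast
      then show False using vi x unfolding \<zeta>_def by simp
    next
      case (Inr p)
      then obtain e u where eu: "x = Inr (e, u)" by (cases p) auto
      then have "e \<in> E" "u \<in> e" using x A by auto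
      then show False using zero(2)[of e u] x eu unfolding \<zeta>_def by auto
    qed
  qed
  then show ?thesis by blast
qed

text \<open>If x had at most one neighbour, x together with its neighbour would meet each set
  \<open>unif S c\<close> exactly once: such a set is stable and cannot be extended. But two
  vertices of the auxiliary graph belong to at most two vertices of \<open>G\<close>, and a third
  one makes the indicator vanish.\<close>

lemma F_degree:
  assumes x: "x \<in> BX"
  shows "\<exists>y z. y \<noteq> z \<and> adjF x y \<and> adjF x z"
proof (rule ccontr)
  assume no: "\<not> ?thesis"
  define A where "A = insert x {y. adjF x y}"
  have A_sub: "\<exists>y. A \<subseteq> {x, y}"
    using no unfolding A_def by blast
  then obtain y where y: "A \<subseteq> {x, y}" by blast
  have AX: "A \<subseteq> BX" unfolding A_def using x BE_in F_sub by (auto simp: insert_commute)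
  have "card (unif S c \<inter> A) = 1" if S: "tight_set G S" "valid_choice S c" for S c
  proof -
    have "unif S c \<inter> A \<noteq> {}" using unif_extend[OF S x] unfolding A_def by blast
    moreover have "p = q" if pq: "p \<in> unif S c \<inter> A" "q \<in> unif S c \<inter> A" for p q
    proof -
      have "\<not> adjF p q" "\<not> adjF q p" using pq unif_stable_F[OF S] unfolding stable_in_def by blast+
      then show ?thesis using pq y unfolding A_def by blast
    qed
    ultimately obtain p where "unif S c \<inter> A = {p}" by blast
    then show ?thesis by simp
  qed
  moreover have "(\<exists>w\<in>V. \<forall>i. Inl (w, i) \<notin> A)"
  proof -
    define o1 where "o1 = (case x of Inl p \<Rightarrow> fst p | Inr q \<Rightarrow> snd q)"
    define o2 where "o2 = (case y of Inl p \<Rightarrow> fst p | Inr q \<Rightarrow> snd q)"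
    obtain w where w: "w \<in> V" "w \<noteq> o1" "w \<noteq> o2" using third_vertex by blast
    then have "Inl (w, i) \<notin> A" for i using y unfolding o1_def o2_def by (auto split: sum.splits)
    then show ?thesis using w(1) by blast
  qed
  ultimately have "A = {}" using indicator_zero[OF AX] by blast
  then show False unfolding A_def by blast
qed

text \<open>By minimality, deleting the edge admits a stable set Q of more than
  \<open>\<alpha>B\<close> vertices, which must contain both ends. R is what remains without them,
  cut down to \<open>\<alpha>B - 1\<close> vertices.\<close>

lemma F_critical:
  assumes xy: "adjF x y"
  shows "\<exists>R. x \<notin> R \<and> y \<notin> R \<and> stable_in BX adjF (insert x R) \<and> card (insert x R) = \<alpha>B
    \<and> stable_in BX adjF (insert y R) \<and> card (insert y R) = \<alpha>B"
proof -
  have "card (F - {{x, y}}) < card F" by (rule card_Diff1_less[OF finite_F xy])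
  then have "\<not> preserving (F - {{x, y}})" using F_minimal(2) by (meson not_le)
  then obtain Q where Q: "stable_in BX (\<lambda>p q. {p, q} \<in> F - {{x, y}}) Q" "\<alpha>B < card Q"
    using F_sub unfolding preserving_def by (meson Diff_subset not_le order_trans)
  have finQ: "finite Q" using Q(1) finite_BX finite_subset unfolding stable_in_def by blast
  have notF: "\<not> stable_in BX adjF Q" using Q(2) F_stable_bound by (meson not_le)
  then obtain p q where pq: "p \<in> Q" "q \<in> Q" "{p, q} \<in> F" using Q(1) unfolding stable_in_def by blast
  then have "{p, q} = {x, y}" using Q(1) unfolding stable_in_def by blast
  then have xyQ: "x \<in> Q" "y \<in> Q" using pq by (auto simp: doubleton_eq_iff)
  have neq: "x \<noteq> y" using xy BE_irrefl F_sub by auto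
  have "card (Q - {x, y}) = card Q - 2" using xyQ neq finQ by (simp add: card_Diff_subset)
  moreover have "0 < \<alpha>B"
  proof -
    have "E \<noteq> {}" using xy F_sub unfolding BE_def by blast
    then have "0 < card E" using finE by (simp add: card_gt_0_iff)
    then show ?thesis unfolding \<alpha>B_def by simp
  qed
  ultimately have "\<alpha>B - 1 \<le> card (Q - {x, y})" using Q(2) by linarith
  then obtain R where R: "R \<subseteq> Q - {x, y}" "card R = \<alpha>B - 1" using obtain_subset_with_card_n by metis
  have finR: "finite R" using R(1) finQ finite_subset by blast
  have st: "stable_in BX adjF (insert w R)" if w: "w = x \<or> w = y" for w
    unfolding stable_in_def
  proof (intro conjI ballI)
    show "insert w R \<subseteq> BX" using w xyQ R(1) Q(1) unfolding stable_in_def by blast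
    fix a b assume ab: "a \<in> insert w R" "b \<in> insert w R"
    have "{a, b} \<noteq> {x, y}" using ab w R(1) neq by (auto simp: doubleton_eq_iff)
    then show "\<not> adjF a b" using ab w xyQ R(1) Q(1) unfolding stable_in_def by blast
  qed
  have "card (insert w R) = \<alpha>B" if "w = x \<or> w = y" for w
    using that R \<open>0 < \<alpha>B\<close> finR by (auto simp: card_insert_if)
  then show ?thesis using st R(1) by (intro exI[of _ R]) auto
qed

sublocale H: alpha_critical BX adjF \<alpha>B lam
proof
  show "finite BX" by (rule finite_BX)
  show "adjF x y \<Longrightarrow> adjF y x" for x y by (simp add: insert_commute)
  show "\<not> adjF x x" for x using BE_irrefl F_sub by auto
  show "adjF x y \<Longrightarrow> x \<in> BX" for x y using BE_in F_sub by blast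
  show "x \<in> BX \<Longrightarrow> \<exists>y. adjF x y" for x using F_degree by blast
  show "stable_in BX adjF S \<Longrightarrow> card S \<le> \<alpha>B" for S by (rule F_stable_bound)
  show "adjF x y \<Longrightarrow> \<exists>R. x \<notin> R \<and> y \<notin> R \<and> stable_in BX adjF (insert x R) \<and> card (insert x R) = \<alpha>B
    \<and> stable_in BX adjF (insert y R) \<and> card (insert y R) = \<alpha>B" for x y by (rule F_critical)
  show "card BX = 2 * \<alpha>B + lam" by (rule card_BX)
qed

lemma unif_tight: "tight_set G S \<Longrightarrow> valid_choice S c \<Longrightarrow> H.tight (unif S c)"
  unfolding H.tight_def using unif_stable_F card_unif by blast

text \<open>For a tight set that misses e, choose the half at u. The half at v then needs a
  neighbour in the resulting set; no copy of v is selected, so only the half at u can be this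
  neighbour.\<close>

lemma middle_edge:
  assumes e: "e \<in> E" "u \<in> e" "v \<in> e" "u \<noteq> v"
  shows "adjF (Inr (e, u)) (Inr (e, v))"
proof (rule ccontr)
  assume no: "\<not> ?thesis"
  obtain S where S: "tight_set G S" "S \<inter> e = {}" using exists_tight_missing[OF e(1)] by blast
  have SV: "S \<subseteq> V" using S unfolding tight_set_def by blast
  obtain c where c: "valid_choice S c" using valid_choice_exists by blast
  have "valid_choice S (c(e := u))" using c e(2) S(2) unfolding valid_choice_def by auto
  then obtain y where y: "y \<in> unif S (c(e := u))" "adjF (Inr (e, v)) y"
    using unif_extend[OF S(1), of "c(e := u)" "Inr (e, v)"] e by auto
  then have yB: "{Inr (e, v), y} \<in> BE" using F_sub by blast
  show False
  proof (cases y)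
    case (Inl p)
    then show ?thesis using y(1) yB e S(2) by (cases p) auto
  next
    case (Inr q)
    then show ?thesis using y yB no by (cases q) (auto simp: insert_commute)
  qed
qed

text \<open>Maximum stable sets can be recombined along a union C of components, so all of them meet
  C in the same number of vertices, and likewise its complement. Any half of an edge is missing from
  one of the two, which is then empty by \<open>indicator_zero\<close>.\<close>

lemma F_connected:
  assumes C: "C \<subseteq> BX" "C \<noteq> {}" and closed: "\<And>x y. x \<in> C \<Longrightarrow> adjF x y \<Longrightarrow> y \<in> C"
  shows "C = BX"
proof (rule ccontr)
  assume ne: "C \<noteq> BX"
  have le: "card (T \<inter> C) \<le> card (T' \<inter> C)" if T: "H.tight T" and T': "H.tight T'" for T T'
  proof -
    have fin: "finite T" "finite T'" using T T' H.tight_finite by auto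
    have cl: "y \<in> C \<Longrightarrow> adjF x y \<Longrightarrow> x \<in> C" for x y using closed[of y x] by (simp add: insert_commute)
    have "stable_in BX adjF ((T \<inter> C) \<union> (T' - C))"
      using H.tight_stable[OF T] H.tight_stable[OF T'] closed cl unfolding stable_in_def by blast
    then have "card ((T \<inter> C) \<union> (T' - C)) \<le> \<alpha>B" by (rule F_stable_bound)
    moreover have "card ((T \<inter> C) \<union> (T' - C)) = card (T \<inter> C) + card (T' - C)"
      by (rule card_Un_disjoint) (use fin in auto)
    ultimately show ?thesis using card_Int_Diff[OF fin(2), of C] H.tight_card[OF T'] by linarith
  qed
  obtain S0 where S0: "tight_set G S0"
  proof -
    have "beta G \<in> (\<lambda>S. sum (weight G) S - int (num_induced_edges G S)) ` Pow V"
      unfolding beta_def using finV by (intro Max_in) auto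
    then show ?thesis using that unfolding tight_set_def by auto
  qed
  obtain c0 where c0: "valid_choice S0 c0" using valid_choice_exists by blast
  have k: "card (unif S c \<inter> C) = card (unif S0 c0 \<inter> C)" if "tight_set G S" "valid_choice S c" for S c
    using le[OF unif_tight[OF that] unif_tight[OF S0 c0]] le[OF unif_tight[OF S0 c0] unif_tight[OF that]]
    by linarith
  have k': "card (unif S c \<inter> (BX - C)) = \<alpha>B - card (unif S0 c0 \<inter> C)" if S: "tight_set G S" "valid_choice S c" for S c
  proof -
    have "unif S c \<inter> (BX - C) = unif S c - C" using H.tight_sub[OF unif_tight[OF S]] by blast
    then show ?thesis
      using card_Int_Diff[OF finite_unif[OF S], of C] k[OF S] card_unif[OF S(1), of c] by simp
  qed
  obtain x where "x \<in> C" using C by blast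
  then obtain y where xy: "adjF x y" using F_degree C(1) by blast
  have "\<exists>e\<in>E. \<exists>u\<in>e. Inr (e, u) \<in> BX"
  proof -
    have "{x, y} \<in> BE" using xy F_sub by blast
    then show ?thesis unfolding BE_def BX_iff by blast
  qed
  then obtain e u where eu: "e \<in> E" "u \<in> e" by blast
  show False
  proof (cases "Inr (e, u) \<in> C")
    case True
    have "BX - C = {}"
    proof (rule indicator_zero[OF _ k'])
      show "(\<exists>w\<in>V. \<forall>i. Inl (w, i) \<notin> BX - C) \<or> (\<exists>e\<in>E. \<exists>u\<in>e. Inr (e, u) \<notin> BX - C)"
        using eu True by blast
    qed auto
    then show False using ne C(1) by blast
  next
    case False
    have "C = {}"
    proof (rule indicator_zero[OF C(1) k])
      show "(\<exists>w\<in>V. \<forall>i. Inl (w, i) \<notin> C) \<or> (\<exists>e\<in>E. \<exists>u\<in>e. Inr (e, u) \<notin> C)"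
        using eu False by blast
    qed
    then show False using C(2) by blast
  qed
qed

end

section \<open>Lanes of vertices of degree two\<close>

lemma rtrancl_distinct_path:
  assumes "(x, y) \<in> R\<^sup>*"
  shows "\<exists>p. p \<noteq> [] \<and> hd p = x \<and> last p = y \<and> distinct p \<and> set p \<subseteq> R\<^sup>* `` {x} \<and>
    successively (\<lambda>a b. (a, b) \<in> R) p"
  using assms
proof (induction rule: rtrancl_induct)
  case base
  show ?case by (rule exI[of _ "[x]"]) simp
next
  case (step y z)
  then obtain p where p: "p \<noteq> []" "hd p = x" "last p = y" "distinct p" "set p \<subseteq> R\<^sup>* `` {x}"
    "successively (\<lambda>a b. (a, b) \<in> R) p" by blast
  show ?case
  proof (cases "z \<in> set p")
    case True
    then obtain a b where ab: "p = a @ z # b" using split_list by metis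
    show ?thesis
    proof (intro exI[of _ "a @ [z]"] conjI)
      show "hd (a @ [z]) = x" using p(2) ab by (cases a) auto
      show "successively (\<lambda>a b. (a, b) \<in> R) (a @ [z])"
        using p(6) unfolding ab by (auto simp: successively_append_iff)
    qed (use p ab in auto)
  next
    case False
    have "(x, z) \<in> R\<^sup>*" using step.hyps by (rule rtrancl_into_rtrancl)
    then show ?thesis
      using p False step.hyps(2)
      by (intro exI[of _ "p @ [z]"]) (auto simp: successively_append_iff)
  qed
qed

context alpha_critical
begin

lemma path_inner_nbrs:
  assumes p: "distinct p" "successively adj p" and deg: "card {y. adj (p ! l) y} = 2"
    and l: "0 < l" "Suc l < length p"
  shows "{y. adj (p ! l) y} = {p ! (l - 1), p ! Suc l}"
proof (rule card_seteq[symmetric])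
  have all: "adj (p ! i) (p ! Suc i)" if "Suc i < length p" for i
    using p(2) that unfolding successively_conv_nth by blast
  have "adj (p ! (l - 1)) (p ! Suc (l - 1))" "adj (p ! l) (p ! Suc l)"
    using all[of "l - 1"] all[of l] l by auto
  then show "{p ! (l - 1), p ! Suc l} \<subseteq> {y. adj (p ! l) y}" using l adj_sym by auto
  have "p ! (l - 1) \<noteq> p ! Suc l" using p(1) l by (simp add: nth_eq_iff_index_eq)
  then show "card {y. adj (p ! l) y} \<le> card {p ! (l - 1), p ! Suc l}" using deg by simp
  show "finite {y. adj (p ! l) y}" by (rule finite_subset[OF _ finite_X]) (use adj_in2 in auto)
qed

text \<open>Between two consecutive missed edges of such a path a stable set could be enlarged.\<close>

lemma path_missed_once:
  assumes T: "tight T" and p: "distinct p" "successively adj p"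
    and deg: "\<And>x. x \<in> set p \<Longrightarrow> card {y. adj x y} = 2"
  shows "card {i. Suc i < length p \<and> p ! i \<notin> T \<and> p ! Suc i \<notin> T} \<le> 1" (is "card ?M \<le> 1")
proof (rule ccontr)
  have finM: "finite ?M" by (rule finite_subset[of _ "{..<length p}"]) auto
  assume "\<not> ?thesis"
  then have "\<not> (\<forall>a\<in>?M. \<forall>b\<in>?M. a = b)" using card_le_Suc0_iff_eq[OF finM] by simp
  then obtain i j' where ij': "i \<in> ?M" "j' \<in> ?M" "i < j'" using linorder_neqE_nat by meson
  \<comment> \<open>The next missed edge after i. None is missed in between, so membership in T
    alternates from \<open>p ! Suc i\<close> to \<open>p ! j\<close>, which are both outside
    T.\<close>
  define j where "j = (LEAST j. j \<in> ?M \<and> i < j)"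
  have j: "j \<in> ?M" "i < j" unfolding j_def using LeastI[of "\<lambda>j. j \<in> ?M \<and> i < j" j'] ij' by auto
  have jmin: "l \<notin> ?M" if "i < l" "l < j" for l
    using not_less_Least[of l "\<lambda>j. j \<in> ?M \<and> i < j"] that unfolding j_def by blast
  have jl: "Suc j < length p" using j by blast
  have alt: "Suc i + t \<le> j \<Longrightarrow> p ! (Suc i + t) \<in> T \<longleftrightarrow> odd t" for t
  proof (induction t)
    case 0
    then show ?case using ij'(1) by simp
  next
    case (Suc t)
    let ?l = "Suc i + t"
    have l: "i < ?l" "?l < j" using Suc.prems by auto
    then have "p ! ?l \<in> T \<or> p ! Suc ?l \<in> T" using jmin[OF l] jl by auto
    moreover have "adj (p ! ?l) (p ! Suc ?l)" using p(2) l jl unfolding successively_conv_nth by auto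
    then have "\<not> (p ! ?l \<in> T \<and> p ! Suc ?l \<in> T)" using stableD[OF tight_stable[OF T]] by blast
    ultimately show ?case using Suc by auto
  qed
  obtain s where s: "j = Suc i + 2 * s"
  proof -
    have "p ! (Suc i + (j - Suc i)) \<notin> T" using j by auto
    then have "even (j - Suc i)" using alt[of "j - Suc i"] j(2) by simp
    then show ?thesis using that j(2) by (metis Suc_leI dvdE le_add_diff_inverse)
  qed
  \<comment> \<open>Every second vertex from \<open>p ! Suc i\<close> to \<open>p ! j\<close>. These
    \<open>s + 1\<close> vertices are outside T, and their neighbours in T are among the s vertices
    between them, because \<open>p ! i\<close> and \<open>p ! Suc j\<close> are outside T as
    well.\<close>
  define S where "S = (\<lambda>u. p ! (Suc i + 2 * u)) ` {..s}"
  have nb: "y = p ! (i + 2 * u) \<or> y = p ! (Suc (Suc i) + 2 * u)" if "adj (p ! (Suc i + 2 * u)) y" "u \<le> s" for u y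
  proof -
    have "{y. adj (p ! (Suc i + 2 * u)) y} = {p ! (Suc i + 2 * u - 1), p ! Suc (Suc i + 2 * u)}"
      by (rule path_inner_nbrs[OF p]) (use deg that(2) s jl in auto)
    then show ?thesis using that(1) by auto
  qed
  have ST: "S \<inter> T = {}"
  proof -
    have "p ! (Suc i + 2 * u) \<notin> T" if "u \<le> s" for u
      using alt[of "2 * u"] that s by simp
    then show ?thesis unfolding S_def by blast
  qed
  have "inj_on (\<lambda>u. p ! (Suc i + 2 * u)) {..s}"
    using p(1) s jl by (auto simp: inj_on_def nth_eq_iff_index_eq)
  then have cS: "card S = Suc s" unfolding S_def by (simp add: card_image)
  have "set p \<subseteq> X"
  proof
    fix x assume "x \<in> set p"
    from deg[OF this] have "card {y. adj x y} \<noteq> 0" by simp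
    then have "{y. adj x y} \<noteq> {}" by (metis card.empty)
    then show "x \<in> X" using adj_in by blast
  qed
  then have SX: "S \<subseteq> X" unfolding S_def using s jl by (auto simp: subset_iff)
  have stS: "indset S"
    unfolding stable_in_def
  proof (intro conjI ballI notI)
    fix x y assume "x \<in> S" "y \<in> S" "adj x y"
    then obtain u w where uw: "u \<le> s" "w \<le> s" "y = p ! (Suc i + 2 * w)" "adj (p ! (Suc i + 2 * u)) y"
      unfolding S_def by blast
    from nb[OF uw(4,1)] show False
    proof
      assume "y = p ! (i + 2 * u)"
      then have "Suc i + 2 * w = i + 2 * u"
        using uw p(1) s jl by (simp add: nth_eq_iff_index_eq)
      then show False by presburger
    next
      assume "y = p ! (Suc (Suc i) + 2 * u)"
      then have "Suc i + 2 * w = Suc (Suc i) + 2 * u"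
        using uw p(1) s jl by (simp add: nth_eq_iff_index_eq)
      then show False by presburger
    qed
  qed (fact SX)
  have "nbrs S \<inter> T \<subseteq> (\<lambda>u. p ! (Suc (Suc i) + 2 * u)) ` {..<s}"
  proof
    fix y assume y: "y \<in> nbrs S \<inter> T"
    then obtain u where u: "u \<le> s" "adj (p ! (Suc i + 2 * u)) y" unfolding nbrs_def S_def by blast
    from nb[OF u(2,1)] show "y \<in> (\<lambda>u. p ! (Suc (Suc i) + 2 * u)) ` {..<s}"
    proof
      assume a: "y = p ! (i + 2 * u)"
      show ?thesis
      proof (cases u)
        case 0
        then show ?thesis using a y ij'(1) by auto
      next
        case (Suc u')
        then have "y = p ! (Suc (Suc i) + 2 * u')" "u' < s" using a u by auto
        then show ?thesis by blast
      qed
    next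
      assume a: "y = p ! (Suc (Suc i) + 2 * u)"
      have "u \<noteq> s"
      proof
        assume "u = s"
        then have "y = p ! Suc j" using a s by simp
        then show False using y j(1) by blast
      qed
      then show ?thesis using a u(1) by auto
    qed
  qed
  then have "card (nbrs S \<inter> T) \<le> card ((\<lambda>u. p ! (Suc (Suc i) + 2 * u)) ` {..<s})"
    by (intro card_mono) auto
  also have "\<dots> \<le> s" using card_image_le[of "{..<s}"] by simp
  finally show False using stable_card_le_nbrs_tight[OF T stS ST] cS by linarith
qed

text \<open>Every edge of the path has exactly one end in T or is missed. So twice the count, plus
  the number of missed edges, is the number of edges plus the contributions of the two ends. At most
  one edge is missed, and this is the remainder that \<open>div\<close> cuts off.\<close>

lemma path_card:
  assumes T: "tight T" and p: "p \<noteq> []" "distinct p" "successively adj p"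
    and deg: "\<And>x. x \<in> set p \<Longrightarrow> card {y. adj x y} = 2"
  shows "card (T \<inter> set p) = (length p - 1 + of_bool (hd p \<in> T) + of_bool (last p \<in> T)) div 2"
proof -
  define n where "n = length p - 1"
  have n: "length p = Suc n" using p(1) unfolding n_def by simp
  define b :: "nat \<Rightarrow> nat" where "b i = of_bool (p ! i \<in> T)" for i
  define M where "M = {i. Suc i < length p \<and> p ! i \<notin> T \<and> p ! Suc i \<notin> T}"
  have M1: "card M \<le> 1" unfolding M_def by (rule path_missed_once[OF T p(2,3) deg])
  have Mn: "M = {i \<in> {..<n}. p ! i \<notin> T \<and> p ! Suc i \<notin> T}" unfolding M_def n by auto
  have one: "b i + b (Suc i) + of_bool (p ! i \<notin> T \<and> p ! Suc i \<notin> T) = 1" if "i < n" for i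
  proof -
    have "adj (p ! i) (p ! Suc i)" using p(3) that n unfolding successively_conv_nth by auto
    then have "\<not> (p ! i \<in> T \<and> p ! Suc i \<in> T)" using stableD[OF tight_stable[OF T]] by blast
    then show ?thesis unfolding b_def by auto
  qed
  have "n = (\<Sum>i<n. 1)" by simp
  also have "\<dots> = (\<Sum>i<n. b i + b (Suc i) + of_bool (p ! i \<notin> T \<and> p ! Suc i \<notin> T))"
    by (rule sum.cong) (use one in auto)
  also have "\<dots> = (\<Sum>i<n. b i) + (\<Sum>i<n. b (Suc i)) + card M"
    unfolding Mn by (simp add: sum.distrib sum_of_bool_eq Int_def)
  finally have 1: "n = (\<Sum>i<n. b i) + (\<Sum>i<n. b (Suc i)) + card M" .
  have 2: "(\<Sum>i<Suc n. b i) = (\<Sum>i<n. b i) + b n" by simp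
  have 3: "(\<Sum>i<Suc n. b i) = b 0 + (\<Sum>i<n. b (Suc i))" by (rule sum.lessThan_Suc_shift)
  have "inj_on (\<lambda>i. p ! i) {..<Suc n}" using p(2) n by (auto simp: inj_on_def nth_eq_iff_index_eq)
  moreover have "T \<inter> set p = (\<lambda>i. p ! i) ` {i \<in> {..<Suc n}. p ! i \<in> T}"
    using n by (auto simp: set_conv_nth)
  moreover have "inj_on (\<lambda>i. p ! i) {i \<in> {..<Suc n}. p ! i \<in> T}"
    by (rule inj_on_subset[OF calculation(1)]) auto
  ultimately have "card (T \<inter> set p) = card {i \<in> {..<Suc n}. p ! i \<in> T}"
    by (simp only: card_image)
  also have "\<dots> = (\<Sum>i<Suc n. b i)" unfolding b_def by (simp add: sum_of_bool_eq Int_def del: sum.lessThan_Suc)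
  finally have 4: "card (T \<inter> set p) = (\<Sum>i<Suc n. b i)" .
  have 5: "of_bool (hd p \<in> T) = b 0" "of_bool (last p \<in> T) = b n"
    unfolding b_def using p(1) n by (auto simp: hd_conv_nth last_conv_nth)
  have "2 * card (T \<inter> set p) + card M = n + b 0 + b n" using 1 2 3 4 by linarith
  then show ?thesis unfolding 5 n_def[symmetric] using M1 by linarith
qed

end

text \<open>\<open>exit_limit\<close> bounds the neighbours of the branching vertices, the hub
  included. \<open>weight_limit\<close> adds the copies on lanes, which are told apart by exits, and
  the branching copies. \<open>core_limit\<close> adds the owners of branching vertices and the core
  vertices told apart by pairs of exits.\<close>

definition exit_limit :: "nat \<Rightarrow> nat" where
  "exit_limit lam = (branch_limit lam + 1) * missed_limit lam"

definition weight_limit :: "nat \<Rightarrow> nat" where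
  "weight_limit lam = exit_limit lam + (branch_limit lam + 1)"

definition core_limit :: "nat \<Rightarrow> nat" where
  "core_limit lam = branch_limit lam + 1 + exit_limit lam ^ 2"

section \<open>Lanes and the core of the weighted graph\<close>

context ranked_graph
begin

definition own :: "'v gadget \<Rightarrow> 'v" where
  "own x = (case x of Inl p \<Rightarrow> fst p | Inr q \<Rightarrow> snd q)"

lemma own_simps [simp]: "own (Inl (v, i)) = v" "own (Inr (e, u)) = u"
  unfolding own_def by auto

lemma finite_nbrsF: "finite {y. adjF x y}"
  by (rule finite_subset[OF _ finite_BX]) (use H.adj_in2 in auto)

text \<open>The hub makes sure that no component of the remaining vertices of degree 2 is a cycle.\<close>

definition "hub = (SOME x. x \<in> BX)"
definition "branching = insert hub {x \<in> BX. 3 \<le> card {y. adjF x y}}"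
definition "passing = BX - branching"
definition "lane = {(x, y). adjF x y \<and> x \<in> passing \<and> y \<in> passing}\<^sup>*"
definition "exits = (\<Union>w\<in>branching. {y. adjF w y})"

lemma hub_in: "hub \<in> BX"
proof -
  obtain v where "v \<in> V" using third_vertex by blast
  then have "Inl (v, 0) \<in> BX" using wt_pos by simp
  then show ?thesis unfolding hub_def some_in_eq by blast
qed

lemma finite_branching: "finite branching"
  unfolding branching_def using finite_BX by simp

lemma card_branching: "card branching \<le> branch_limit lam + 1"
proof -
  have "card branching \<le> Suc (card {x \<in> BX. 3 \<le> card {y. adjF x y}})"
    unfolding branching_def by (simp add: card_insert_if finite_BX)
  then show ?thesis using H.card_branch_vertices by linarith
qed

lemma card_exits: "card exits \<le> exit_limit lam" and finite_exits: "finite exits"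
proof -
  have "card exits \<le> (\<Sum>w\<in>branching. card {y. adjF w y})"
    unfolding exits_def using finite_branching by (rule card_UN_le)
  also have "\<dots> \<le> (\<Sum>w\<in>branching. missed_limit lam)" by (intro sum_mono) (rule H.degree_bound)
  also have "\<dots> = card branching * missed_limit lam" by simp
  also have "\<dots> \<le> exit_limit lam"
    unfolding exit_limit_def using card_branching by (rule mult_le_mono1)
  finally show "card exits \<le> exit_limit lam" .
  show "finite exits" unfolding exits_def using finite_branching finite_nbrsF by blast
qed

lemma passing_degree:
  assumes "x \<in> passing"
  shows "card {y. adjF x y} = 2"
proof -
  have x: "x \<in> BX" "\<not> 3 \<le> card {y. adjF x y}" using assms unfolding passing_def branching_def by auto
  obtain y z where yz: "y \<noteq> z" "adjF x y" "adjF x z" using F_degree[OF x(1)] by blast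
  then have "card {y, z} \<le> card {y. adjF x y}" by (intro card_mono finite_nbrsF) auto
  then show ?thesis using x(2) yz(1) by simp
qed

lemma lane_sym: "(x, y) \<in> lane \<Longrightarrow> (y, x) \<in> lane"
proof -
  have "sym {(x, y). adjF x y \<and> x \<in> passing \<and> y \<in> passing}"
    by (auto intro!: symI simp: insert_commute)
  then have "sym lane" unfolding lane_def by (rule sym_rtrancl)
  then show "(x, y) \<in> lane \<Longrightarrow> (y, x) \<in> lane" by (rule symD)
qed

lemma lane_trans: "(x, y) \<in> lane \<Longrightarrow> (y, z) \<in> lane \<Longrightarrow> (x, z) \<in> lane"
  unfolding lane_def by (rule rtrancl_trans)

lemma lane_passing: "(x, y) \<in> lane \<Longrightarrow> x \<in> passing \<Longrightarrow> y \<in> passing"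
  unfolding lane_def by (erule rtranclE) auto

text \<open>Without an exit the lane of x would be closed under adjacency, hence all of
  \<open>BX\<close> by connectedness, but the hub is not a passing vertex.\<close>

lemma lane_exit:
  assumes x: "x \<in> passing"
  shows "\<exists>z\<in>exits. (x, z) \<in> lane"
proof (rule ccontr)
  assume no: "\<not> ?thesis"
  define C where "C = lane `` {x}"
  have Cp: "C \<subseteq> passing" unfolding C_def using lane_passing x by blast
  have "C = BX"
  proof (rule F_connected)
    show "C \<subseteq> BX" using Cp unfolding passing_def by blast
    show "C \<noteq> {}" unfolding C_def lane_def by blast
    fix y z assume y: "y \<in> C" and yz: "adjF y z"
    have "z \<in> passing"
    proof (rule ccontr)
      assume "z \<notin> passing"
      then have "z \<in> branching" using H.adj_in2[OF yz] unfolding passing_def by blast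
      then have "y \<in> exits" using yz unfolding exits_def by (auto simp: insert_commute)
      then show False using no y unfolding C_def by blast
    qed
    then have "(y, z) \<in> lane" using y yz Cp unfolding lane_def by (intro r_into_rtrancl) auto
    then show "z \<in> C" using y lane_trans unfolding C_def by blast
  qed
  then have "hub \<in> passing" using hub_in Cp by blast
  then show False unfolding passing_def branching_def by blast
qed

text \<open>Lanes are counted by their exits: vertices with the same key lie on the same
  lane.\<close>

definition "key x = (SOME z. z \<in> exits \<and> (x, z) \<in> lane)"

lemma key: "x \<in> passing \<Longrightarrow> key x \<in> exits \<and> (x, key x) \<in> lane"
  unfolding key_def by (rule someI_ex) (use lane_exit in blast)

lemma key_eq: "x \<in> passing \<Longrightarrow> y \<in> passing \<Longrightarrow> key x = key y \<Longrightarrow> (x, y) \<in> lane"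
  using key lane_sym lane_trans by metis

lemma Inl_nbr: "adjF (Inl (v, i)) y \<Longrightarrow> \<exists>e\<in>E. v \<in> e \<and> y = Inr (e, v)"
proof -
  assume "adjF (Inl (v, i)) y"
  then have yB: "{Inl (v, i), y} \<in> BE" using F_sub by blast
  show ?thesis
  proof (cases y)
    case (Inl p)
    then show ?thesis using yB by simp
  next
    case (Inr q)
    then obtain e u where "y = Inr (e, u)" by (cases q) auto
    then show ?thesis using yB by simp
  qed
qed

text \<open>A copy belongs to \<open>unif S c\<close> exactly if its vertex belongs to S, so by
  \<open>path_card\<close> the count depends only on v and w. The half at v on the path serves later
  to read off the factor \<mu>.\<close>

lemma lane_path:
  assumes xy: "(Inl (v, i), Inl (w, j)) \<in> lane" and x: "Inl (v, i) \<in> passing"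
    and ne: "Inl (v, i) \<noteq> (Inl (w, j) :: 'v gadget)"
  obtains p where "set p \<subseteq> passing" "set p \<subseteq> lane `` {Inl (v, i)}" "Inl (v, i) \<in> set p" "Inl (w, j) \<in> set p"
    "\<exists>e\<in>E. v \<in> e \<and> Inr (e, v) \<in> set p"
    "\<And>S c. tight_set G S \<Longrightarrow> valid_choice S c \<Longrightarrow>
      card (unif S c \<inter> set p) = (length p - 1 + of_bool (v \<in> S) + of_bool (w \<in> S)) div 2"
proof -
  have "\<exists>p. p \<noteq> [] \<and> hd p = Inl (v, i) \<and> last p = Inl (w, j) \<and> distinct p \<and> set p \<subseteq> lane `` {Inl (v, i)} \<and>
    successively (\<lambda>a b. (a, b) \<in> {(x, y). adjF x y \<and> x \<in> passing \<and> y \<in> passing}) p"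
    using rtrancl_distinct_path[OF xy[unfolded lane_def]] unfolding lane_def .
  then obtain p where p: "p \<noteq> []" "hd p = Inl (v, i)" "last p = Inl (w, j)" "distinct p" "set p \<subseteq> lane `` {Inl (v, i)}"
    "successively (\<lambda>a b. (a, b) \<in> {(x, y). adjF x y \<and> x \<in> passing \<and> y \<in> passing}) p" by blast
  have suc: "successively adjF p" using p(6) unfolding successively_conv_nth by auto
  have pass: "set p \<subseteq> passing" using p(5) lane_passing x by blast
  have in_p: "Inl (v, i) \<in> set p" "Inl (w, j) \<in> set p"
    using p(1) hd_in_set[of p] last_in_set[of p] unfolding p(2,3) by blast+
  obtain q where q: "p = Inl (v, i) # q" using p(1,2) by (cases p) auto
  then obtain y q' where "q = y # q'" using p(3) ne by (cases q) auto
  then have "adjF (Inl (v, i)) y" "y \<in> set p" using suc q by auto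
  then have half: "\<exists>e\<in>E. v \<in> e \<and> Inr (e, v) \<in> set p" using Inl_nbr by blast
  have lt: "i < wt v" "j < wt w" using in_p pass unfolding passing_def by auto
  have "card (unif S c \<inter> set p) = (length p - 1 + of_bool (v \<in> S) + of_bool (w \<in> S)) div 2"
    if S: "tight_set G S" "valid_choice S c" for S c
  proof -
    have "card (unif S c \<inter> set p) = (length p - 1 + of_bool (hd p \<in> unif S c) + of_bool (last p \<in> unif S c)) div 2"
      by (rule H.path_card[OF unif_tight[OF S] p(1,4) suc]) (use passing_degree pass in blast)
    then show ?thesis unfolding p(2,3) using lt by simp
  qed
  then show thesis using that pass p(5) in_p half by blast
qed

text \<open>If both ends are copies of v, the count on the path is a constant plus 1 for v in S, so
  the path minus one end copy has a constant count. The half on the path forces the factor 1, and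
  the copies of v would have to add up to \<open>wt v\<close>; but the subtracted copy gives 0 and
  the others at most 1.\<close>

lemma lane_one_copy:
  assumes l: "(Inl (v, i), Inl (v, j)) \<in> lane" and i: "Inl (v, i) \<in> passing"
  shows "i = j"
proof (rule ccontr)
  assume "i \<noteq> j"
  then have "Inl (v, i) \<noteq> (Inl (v, j) :: 'v gadget)" by simp
  from lane_path[OF l i this] obtain p where p: "set p \<subseteq> passing" "Inl (v, i) \<in> set p" "\<exists>e\<in>E. v \<in> e \<and> Inr (e, v) \<in> set p"
    "\<And>S c. tight_set G S \<Longrightarrow> valid_choice S c \<Longrightarrow>
      card (unif S c \<inter> set p) = (length p - 1 + of_bool (v \<in> S) + of_bool (v \<in> S)) div 2"
    by metis
  have v: "v \<in> V" "i < wt v" using i unfolding passing_def by auto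
  define \<zeta> :: "'v gadget \<Rightarrow> real" where
    "\<zeta> x = (if x \<in> set p then 1 else 0) - (if x \<in> {Inl (v, i)} then 1 else 0)" for x
  have k: "sum \<zeta> (unif S c) = real ((length p - 1) div 2)" if S: "tight_set G S" "valid_choice S c" for S c
  proof -
    have "sum \<zeta> (unif S c) = real (card (unif S c \<inter> set p)) - real (card (unif S c \<inter> {Inl (v, i)}))"
      unfolding \<zeta>_def sum_subtractf using finite_unif[OF S] by (simp only: sum_indicator)
    moreover have "card (unif S c \<inter> {Inl (v, i)}) = of_bool (v \<in> S)" using v(2) by simp
    ultimately show ?thesis using p(4)[OF S] by (cases "v \<in> S") auto
  qed
  obtain \<mu> where \<mu>: "\<forall>v\<in>V. (\<Sum>i<wt v. \<zeta> (Inl (v, i))) = \<mu> * real (wt v)" "\<forall>e\<in>E. \<forall>u\<in>e. \<zeta> (Inr (e, u)) = \<mu>"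
    using gadget_rank[OF k] by blast
  have "\<mu> = 1" using \<mu>(2) p(3) unfolding \<zeta>_def by fastforce
  then have "real (wt v) = (\<Sum>j<wt v. \<zeta> (Inl (v, j)))" using \<mu>(1) v(1) by simp
  also have "\<dots> \<le> (\<Sum>j<wt v. if j \<in> - {i} then 1 else 0)"
    by (rule sum_mono) (auto simp: \<zeta>_def p(2))
  also have "\<dots> = real (card ({..<wt v} \<inter> - {i}))" by (rule sum_indicator) simp
  also have "{..<wt v} \<inter> - {i} = {..<wt v} - {i}" by blast
  also have "card ({..<wt v} - {i}) = wt v - 1" using v(2) by simp
  finally show False using v(2) by linarith
qed

text \<open>The numbers of selected vertices on two disjoint lanes between copies of the same vertices
  are linearly dependent, which contradicts the rank condition.\<close>

lemma lane_pair:
  assumes vw: "v \<noteq> w" and i: "i1 \<noteq> i2"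
    and pass: "Inl (v, i1) \<in> passing" "Inl (v, i2) \<in> passing"
    and l1: "(Inl (v, i1), Inl (w, j1)) \<in> lane" and l2: "(Inl (v, i2), Inl (w, j2)) \<in> lane"
  shows False
proof -
  have "Inl (v, i1) \<noteq> (Inl (w, j1) :: 'v gadget)" using vw by simp
  from lane_path[OF l1 pass(1) this] obtain p where p: "set p \<subseteq> passing" "set p \<subseteq> lane `` {Inl (v, i1)}"
    "Inl (v, i1) \<in> set p" "Inl (w, j1) \<in> set p" "\<exists>e\<in>E. v \<in> e \<and> Inr (e, v) \<in> set p"
    "\<And>S c. tight_set G S \<Longrightarrow> valid_choice S c \<Longrightarrow>
      card (unif S c \<inter> set p) = (length p - 1 + of_bool (v \<in> S) + of_bool (w \<in> S)) div 2"
    by metis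
  have "Inl (v, i2) \<noteq> (Inl (w, j2) :: 'v gadget)" using vw by simp
  from lane_path[OF l2 pass(2) this] obtain q where q: "set q \<subseteq> passing" "set q \<subseteq> lane `` {Inl (v, i2)}"
    "Inl (v, i2) \<in> set q"
    "\<And>S c. tight_set G S \<Longrightarrow> valid_choice S c \<Longrightarrow>
      card (unif S c \<inter> set q) = (length q - 1 + of_bool (v \<in> S) + of_bool (w \<in> S)) div 2"
    by metis
  have v: "v \<in> V" "i1 < wt v" "i2 < wt v" using pass unfolding passing_def by auto
  have "Inl (w, j1) \<in> passing" using p(1,4) by blast
  then have w: "w \<in> V" "j1 < wt w" unfolding passing_def by auto
  have disj: "set p \<inter> set q = {}"
  proof (rule ccontr)
    assume "\<not> ?thesis"
    then obtain x where "(Inl (v, i1), x) \<in> lane" "(Inl (v, i2), x) \<in> lane" using p(2) q(2) by blast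
    then have "(Inl (v, i1), Inl (v, i2)) \<in> lane" using lane_sym lane_trans by blast
    then show False using lane_one_copy pass(1) i by blast
  qed
  have p_only: "Inl (v, i) \<in> set p \<longleftrightarrow> i = i1" for i
    using p(2,3) lane_one_copy[OF _ pass(1)] by blast
  have q_only: "Inl (v, i) \<in> set q \<longleftrightarrow> i = i2" for i
    using q(2,3) lane_one_copy[OF _ pass(2)] by blast
  obtain e where e: "e \<in> E" "v \<in> e" "Inr (e, v) \<in> set p" using p(5) by blast
  then have e': "Inr (e, v) \<notin> set q" using disj by blast
  define k1 k2 where "k1 = length p - 1" and "k2 = length q - 1"
  show False
  proof (cases "even (k1 + k2)")
    case True
    \<comment> \<open>Equal parity: both counts are rounded alike, so their difference is constant.
      The copies \<open>i1\<close> and \<open>i2\<close> cancel in the sum over v, which forces the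
      functional to vanish, although it is 1 at the half on p.\<close>
    define \<zeta> :: "'v gadget \<Rightarrow> real" where
      "\<zeta> x = (if x \<in> set p then 1 else 0) - (if x \<in> set q then 1 else 0)" for x
    have k: "sum \<zeta> (unif S c) = (real k1 - real k2) / 2" if S: "tight_set G S" "valid_choice S c" for S c
    proof -
      define s :: nat where "s = of_bool (v \<in> S) + of_bool (w \<in> S)"
      have "sum \<zeta> (unif S c) = real (card (unif S c \<inter> set p)) - real (card (unif S c \<inter> set q))"
        unfolding \<zeta>_def sum_subtractf using finite_unif[OF S] by (simp only: sum_indicator)
      also have "\<dots> = real ((k1 + s) div 2) - real ((k2 + s) div 2)"
        using p(6)[OF S] q(4)[OF S] unfolding k1_def k2_def s_def by (simp add: add.assoc)
      also have "\<dots> = (real k1 - real k2) / 2"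
      proof -
        have "int (2 * ((k1 + s) div 2)) - int (2 * ((k2 + s) div 2)) = int k1 - int k2"
          using True by presburger
        then have "real_of_int (int (2 * ((k1 + s) div 2)) - int (2 * ((k2 + s) div 2))) = real_of_int (int k1 - int k2)"
          by simp
        then show ?thesis by simp
      qed
      finally show ?thesis .
    qed
    have "(\<Sum>i<wt v. \<zeta> (Inl (v, i))) = real (card ({..<wt v} \<inter> {i1})) - real (card ({..<wt v} \<inter> {i2}))"
      unfolding \<zeta>_def sum_subtractf p_only q_only by (simp add: sum_indicator[symmetric])
    then have "(\<Sum>i<wt v. \<zeta> (Inl (v, i))) = 0" using v by simp
    then have "(\<exists>w\<in>V. (\<Sum>i<wt w. \<zeta> (Inl (w, i))) = 0) \<or> (\<exists>e\<in>E. \<exists>u\<in>e. \<zeta> (Inr (e, u)) = 0)"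
      using v(1) by blast
    from gadget_zero(2)[OF k this e(1,2)] have "\<zeta> (Inr (e, v)) = 0" .
    then show False unfolding \<zeta>_def using e e' by simp
  next
    case False
    \<comment> \<open>Different parity: exactly one count is rounded, so their sum is s plus a
      constant, and removing the end copies of the first path removes s. The half on p forces the
      factor 1, while only \<open>i2\<close> remains in the sum over v; so v would have weight 1 and
      not two copies.\<close>
    define \<zeta> :: "'v gadget \<Rightarrow> real" where
      "\<zeta> x = (if x \<in> set p then 1 else 0) + (if x \<in> set q then 1 else 0)
        - (if x \<in> {Inl (v, i1), Inl (w, j1)} then 1 else 0)" for x
    have k: "sum \<zeta> (unif S c) = (real k1 + real k2 - 1) / 2" if S: "tight_set G S" "valid_choice S c" for S c
    proof -
      define s :: nat where "s = of_bool (v \<in> S) + of_bool (w \<in> S)"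
      have "sum \<zeta> (unif S c) = real (card (unif S c \<inter> set p)) + real (card (unif S c \<inter> set q))
          - real (card (unif S c \<inter> {Inl (v, i1), Inl (w, j1)}))"
        unfolding \<zeta>_def sum_subtractf sum.distrib using finite_unif[OF S] by (simp only: sum_indicator)
      also have "card (unif S c \<inter> {Inl (v, i1), Inl (w, j1)}) = s"
        using v w vw unfolding s_def by (auto simp: Int_insert_right)
      also have "real (card (unif S c \<inter> set p)) + real (card (unif S c \<inter> set q)) - real s
          = real ((k1 + s) div 2) + real ((k2 + s) div 2) - real s"
        using p(6)[OF S] q(4)[OF S] unfolding k1_def k2_def s_def by (simp add: add.assoc)
      also have "\<dots> = (real k1 + real k2 - 1) / 2"
      proof -
        have "int (2 * ((k1 + s) div 2)) + int (2 * ((k2 + s) div 2)) - 2 * int s = int k1 + int k2 - 1"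
          using False by presburger
        then have "real_of_int (int (2 * ((k1 + s) div 2)) + int (2 * ((k2 + s) div 2)) - 2 * int s) = real_of_int (int k1 + int k2 - 1)"
          by simp
        then show ?thesis by simp
      qed
      finally show ?thesis .
    qed
    obtain \<mu> where \<mu>: "\<forall>v\<in>V. (\<Sum>i<wt v. \<zeta> (Inl (v, i))) = \<mu> * real (wt v)" "\<forall>e\<in>E. \<forall>u\<in>e. \<zeta> (Inr (e, u)) = \<mu>"
      using gadget_rank[OF k] by blast
    have "\<mu> = \<zeta> (Inr (e, v))" using \<mu>(2) e(1,2) by simp
    also have "\<dots> = 1" unfolding \<zeta>_def using e e' by simp
    finally have "real (wt v) = (\<Sum>i<wt v. \<zeta> (Inl (v, i)))" using \<mu>(1) v(1) by simp
    also have "\<dots> = (\<Sum>i<wt v. if i \<in> {i2} then 1 else 0)"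
      by (rule sum.cong) (use vw i in \<open>auto simp: \<zeta>_def p_only q_only\<close>)
    also have "\<dots> = real (card ({..<wt v} \<inter> {i2}))" by (rule sum_indicator) simp
    also have "\<dots> = 1" using v by simp
    finally have "wt v = 1" by simp
    then show False using v i by simp
  qed
qed

text \<open>Passing copies of v lie on different lanes by \<open>lane_one_copy\<close> and so have
  different keys; all other copies are branching.\<close>

theorem weight_bound:
  assumes v: "v \<in> V"
  shows "wt v \<le> weight_limit lam"
proof -
  let ?I = "{i \<in> {..<wt v}. Inl (v, i) \<in> passing}" and ?J = "{i \<in> {..<wt v}. Inl (v, i) \<notin> passing}"
  have "inj_on (\<lambda>i. key (Inl (v, i))) ?I"
  proof (rule inj_onI)
    fix i j assume "i \<in> ?I" "j \<in> ?I" "key (Inl (v, i)) = key (Inl (v, j))"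
    then show "i = j" using key_eq[of "Inl (v, i)" "Inl (v, j)"] lane_one_copy[of v i j] by blast
  qed
  moreover have "(\<lambda>i. key (Inl (v, i))) ` ?I \<subseteq> exits" using key by blast
  ultimately have "card ?I \<le> card exits" using card_inj_on_le[OF _ _ finite_exits] by blast
  moreover have "card ?J \<le> card branching"
  proof (rule card_inj_on_le)
    show "inj_on (\<lambda>i. Inl (v, i) :: 'v gadget) ?J" by (simp add: inj_on_def)
    show "(\<lambda>i. Inl (v, i)) ` ?J \<subseteq> branching" using v unfolding passing_def by auto
  qed (fact finite_branching)
  moreover have "wt v = card ?I + card ?J"
  proof -
    have "card (?I \<union> ?J) = card ?I + card ?J" by (rule card_Un_disjoint) auto
    moreover have "?I \<union> ?J = {..<wt v}" by blast
    ultimately show ?thesis by simp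
  qed
  ultimately show ?thesis unfolding weight_limit_def using card_exits card_branching by linarith
qed

text \<open>A half has degree at least 2, and its only possible neighbour besides the copies of its
  vertex is the other half of the edge.\<close>

lemma half_has_copy:
  assumes e: "e \<in> E" "v \<in> e"
  shows "\<exists>i<wt v. adjF (Inl (v, i)) (Inr (e, v))"
proof -
  obtain u where u: "u \<in> e" "u \<noteq> v" "e = {v, u}" using edge_ends[OF e] by blast
  obtain y z where yz: "y \<noteq> z" "adjF (Inr (e, v)) y" "adjF (Inr (e, v)) z"
    using F_degree[of "Inr (e, v)"] e by auto
  have nb: "(\<exists>i<wt v. x = Inl (v, i)) \<or> x = Inr (e, u)" if "adjF (Inr (e, v)) x" for x
  proof -
    have xB: "{Inr (e, v), x} \<in> BE" using that F_sub by blast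
    have other: "w = u" if "w \<in> e" "w \<noteq> v" for w using that u by blast
    show ?thesis
    proof (cases x)
      case (Inl p)
      then show ?thesis using xB by (cases p) auto
    next
      case (Inr q)
      then show ?thesis using xB other by (cases q) auto
    qed
  qed
  have "\<exists>i<wt v. y = Inl (v, i) \<or> z = Inl (v, i)" using yz(1) nb[OF yz(2)] nb[OF yz(3)] by blast
  then show ?thesis using yz(2,3) by (auto simp: insert_commute)
qed

theorem degree_bound:
  assumes v: "v \<in> V"
  shows "card {e \<in> E. v \<in> e} \<le> weight_limit lam * missed_limit lam"
proof -
  have "(\<lambda>e. Inr (e, v)) ` {e \<in> E. v \<in> e} \<subseteq> (\<Union>i\<in>{..<wt v}. {y. adjF (Inl (v, i)) y})"
    using half_has_copy by blast
  then have "card ((\<lambda>e. Inr (e, v) :: 'v gadget) ` {e \<in> E. v \<in> e}) \<le> card (\<Union>i\<in>{..<wt v}. {y. adjF (Inl (v, i)) y})"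
    using finite_nbrsF by (intro card_mono) auto
  also have "\<dots> \<le> (\<Sum>i\<in>{..<wt v}. card {y. adjF (Inl (v, i)) y})" by (rule card_UN_le) simp
  also have "\<dots> \<le> (\<Sum>i\<in>{..<wt v}. missed_limit lam)" by (intro sum_mono) (rule H.degree_bound)
  also have "\<dots> = wt v * missed_limit lam" by simp
  also have "\<dots> \<le> weight_limit lam * missed_limit lam" using weight_bound[OF v] by (rule mult_le_mono1)
  finally show ?thesis by (subst (asm) card_image) (auto simp: inj_on_def)
qed

text \<open>Double counting of the pairs of a copy of v and an adjacent half at v. A copy has two
  such halves; a half has one such copy, since its second neighbour is the other half by
  \<open>middle_edge\<close>.\<close>

lemma tame_degree:
  assumes v: "v \<in> V" and tame: "\<And>x. x \<in> BX \<Longrightarrow> own x = v \<Longrightarrow> x \<in> passing"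
  shows "card {e \<in> E. v \<in> e} = 2 * wt v"
proof -
  let ?D = "{e \<in> E. v \<in> e}"
  define P where "P = {(i, e). i < wt v \<and> e \<in> ?D \<and> adjF (Inl (v, i)) (Inr (e, v))}"
  have row: "card {e \<in> ?D. adjF (Inl (v, i)) (Inr (e, v))} = 2" if "i < wt v" for i
  proof -
    have "Inl (v, i) \<in> passing" using tame[of "Inl (v, i)"] that v by simp
    then have "2 = card {y. adjF (Inl (v, i)) y}" by (rule passing_degree[symmetric])
    also have "{y. adjF (Inl (v, i)) y} = (\<lambda>e. Inr (e, v)) ` {e \<in> ?D. adjF (Inl (v, i)) (Inr (e, v))}"
      using Inl_nbr by blast
    also have "card \<dots> = card {e \<in> ?D. adjF (Inl (v, i)) (Inr (e, v))}"
      by (rule card_image) (simp add: inj_on_def)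
    finally show ?thesis by (rule sym)
  qed
  have col: "card {i \<in> {..<wt v}. adjF (Inl (v, i)) (Inr (e, v))} = 1" if e: "e \<in> ?D" for e
  proof -
    have e': "e \<in> E" "v \<in> e" using e by auto
    obtain u where u: "u \<in> e" "u \<noteq> v" "e = {v, u}" using edge_ends[OF e'] by blast
    have "Inr (e, v) \<in> passing" using tame[of "Inr (e, v)"] e' by simp
    then have two: "card {y. adjF (Inr (e, v)) y} = 2" by (rule passing_degree)
    have m: "adjF (Inr (e, v)) (Inr (e, u))" using middle_edge[OF e' u(1)] u(2) by blast
    have "{y. adjF (Inr (e, v)) y} = insert (Inr (e, u)) ((\<lambda>i. Inl (v, i)) ` {i \<in> {..<wt v}. adjF (Inl (v, i)) (Inr (e, v))})"
    proof (intro equalityI subsetI)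
      fix y assume "y \<in> {y. adjF (Inr (e, v)) y}"
      then have y: "adjF (Inr (e, v)) y" by simp
      then have yB: "{Inr (e, v), y} \<in> BE" using F_sub by blast
      show "y \<in> insert (Inr (e, u)) ((\<lambda>i. Inl (v, i)) ` {i \<in> {..<wt v}. adjF (Inl (v, i)) (Inr (e, v))})"
      proof (cases y)
        case (Inl p)
        obtain w i where "p = (w, i)" by (cases p)
        then show ?thesis using Inl y yB by (auto simp: insert_commute)
      next
        case (Inr q)
        have other: "w = u" if "w \<in> e" "w \<noteq> v" for w using that u by blast
        show ?thesis using Inr yB other by (cases q) auto
      qed
    next
      fix y assume "y \<in> insert (Inr (e, u)) ((\<lambda>i. Inl (v, i)) ` {i \<in> {..<wt v}. adjF (Inl (v, i)) (Inr (e, v))})"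
      then show "y \<in> {y. adjF (Inr (e, v)) y}" using m by (auto simp: insert_commute)
    qed
    then have "card {y. adjF (Inr (e, v)) y} = Suc (card ((\<lambda>i. Inl (v, i) :: 'v gadget) ` {i \<in> {..<wt v}. adjF (Inl (v, i)) (Inr (e, v))}))"
      by (auto simp: card_insert_if)
    also have "card ((\<lambda>i. Inl (v, i) :: 'v gadget) ` {i \<in> {..<wt v}. adjF (Inl (v, i)) (Inr (e, v))})
        = card {i \<in> {..<wt v}. adjF (Inl (v, i)) (Inr (e, v))}"
      by (rule card_image) (simp add: inj_on_def)
    finally show ?thesis using two by simp
  qed
  have finD: "finite ?D" using finE by simp
  have "(\<Sum>i\<in>{..<wt v}. card {e \<in> ?D. adjF (Inl (v, i)) (Inr (e, v))})
      = (\<Sum>e\<in>?D. card {i \<in> {..<wt v}. adjF (Inl (v, i)) (Inr (e, v))})"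
    by (rule sum_multicount_gen) (use finD in auto)
  then show ?thesis using row col by simp
qed

text \<open>A core vertex whose copies and halves are all passing has degree twice its weight, so
  its weight is not 1 and it has the copies 0 and 1. Two such vertices with the same pair of keys
  would be joined by two lanes, against \<open>lane_pair\<close>. Every other core vertex owns a
  branching vertex.\<close>

theorem card_core:
  "card {v \<in> V. \<not> (weight G v = 1 \<and> card {e \<in> E. v \<in> e} = 2)} \<le> core_limit lam"
proof -
  let ?C = "{v \<in> V. \<not> (weight G v = 1 \<and> card {e \<in> E. v \<in> e} = 2)}"
  define D where "D = {v \<in> ?C. \<forall>x\<in>BX. own x = v \<longrightarrow> x \<in> passing}"
  have D: "v \<in> V" "2 \<le> wt v" "\<And>i. i < wt v \<Longrightarrow> Inl (v, i) \<in> passing" if v: "v \<in> D" for v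
  proof -
    show vV: "v \<in> V" using v unfolding D_def by blast
    have "card {e \<in> E. v \<in> e} = 2 * wt v" using tame_degree[OF vV] v unfolding D_def by blast
    then have "wt v \<noteq> 1" using v int_wt[OF vV] unfolding D_def by auto
    then show "2 \<le> wt v" using wt_pos[OF vV] by linarith
    show "Inl (v, i) \<in> passing" if "i < wt v" for i using v vV that unfolding D_def by auto
  qed
  have "inj_on (\<lambda>v. (key (Inl (v, 0)), key (Inl (v, 1)))) D"
  proof (rule inj_onI, rule ccontr)
    fix v w assume vw: "v \<in> D" "w \<in> D" "(key (Inl (v, 0)), key (Inl (v, 1))) = (key (Inl (w, 0)), key (Inl (w, 1)))" "v \<noteq> w"
    have p: "Inl (v, 0) \<in> passing" "Inl (v, 1) \<in> passing" "Inl (w, 0) \<in> passing" "Inl (w, 1) \<in> passing"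
      using D(2,3)[OF vw(1)] D(2,3)[OF vw(2)] by auto
    have "(Inl (v, 0), Inl (w, 0)) \<in> lane" "(Inl (v, 1), Inl (w, 1)) \<in> lane"
      using key_eq p vw(3) by auto
    then show False using lane_pair[OF vw(4) _ p(1,2)] by simp
  qed
  moreover have "(\<lambda>v. (key (Inl (v, 0)), key (Inl (v, 1)))) ` D \<subseteq> exits \<times> exits"
  proof
    fix z assume "z \<in> (\<lambda>v. (key (Inl (v, 0)), key (Inl (v, 1)))) ` D"
    then obtain v where v: "v \<in> D" "z = (key (Inl (v, 0)), key (Inl (v, 1)))" by blast
    have "Inl (v, 0) \<in> passing" "Inl (v, 1) \<in> passing" using D(2,3)[OF v(1)] by auto
    then show "z \<in> exits \<times> exits" using key v(2) by blast
  qed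
  ultimately have "card D \<le> card (exits \<times> exits)" using card_inj_on_le finite_exits by blast
  also have "\<dots> = card exits ^ 2" by (simp add: power2_eq_square card_cartesian_product)
  also have "\<dots> \<le> exit_limit lam ^ 2" using card_exits by (rule power_mono) simp
  finally have cD: "card D \<le> exit_limit lam ^ 2" .
  have "?C - D \<subseteq> own ` branching"
  proof
    fix v assume "v \<in> ?C - D"
    then obtain x where "x \<in> BX" "own x = v" "x \<notin> passing" unfolding D_def by blast
    then show "v \<in> own ` branching" unfolding passing_def by blast
  qed
  then have "card (?C - D) \<le> card (own ` branching)" using finite_branching by (intro card_mono) auto
  also have "\<dots> \<le> branch_limit lam + 1" using card_image_le[OF finite_branching, of own] card_branching by linarith
  finally have "card (?C - D) \<le> branch_limit lam + 1" .
  moreover have "card ?C \<le> card (?C - D) + card D"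
  proof -
    have "card ?C \<le> card ((?C - D) \<union> D)"
      by (rule card_mono) (use finV in \<open>auto simp: D_def\<close>)
    then show ?thesis using card_Un_le le_trans by blast
  qed
  ultimately show ?thesis using cD unfolding core_limit_def by linarith
qed

text \<open>Adjacent vertices of the auxiliary graph have the same owner or owners that are adjacent
  in \<open>G\<close>, so connectedness passes from \<open>F\<close> to \<open>G\<close>.\<close>

theorem graph_connected:
  assumes K: "K \<subseteq> V" "K \<noteq> {}" and closed: "\<And>u v. u \<in> K \<Longrightarrow> {u, v} \<in> E \<Longrightarrow> v \<in> K"
  shows "K = V"
proof -
  define C where "C = {x \<in> BX. own x \<in> K}"
  obtain v where v: "v \<in> K" using K(2) by blast
  have "C = BX"
  proof (rule F_connected)
    show "C \<subseteq> BX" unfolding C_def by blast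
    have "Inl (v, 0) \<in> C" using v K(1) wt_pos unfolding C_def by auto
    then show "C \<noteq> {}" by blast
    fix x y assume x: "x \<in> C" and xy: "adjF x y"
    have yX: "y \<in> BX" using H.adj_in2[OF xy] .
    have xyB: "{x, y} \<in> BE" using xy F_sub by blast
    have "own y \<in> K"
    proof (cases "own y = own x")
      case True
      then show ?thesis using x unfolding C_def by simp
    next
      case False
      obtain e u w where eu: "x = Inr (e, u)" "y = Inr (e, w)"
        using xyB False by (cases x; cases y) auto
      then have e: "e \<in> E" "u \<in> e" "w \<in> e" "u \<noteq> w" using xyB by auto
      obtain z where "e = {u, z}" using edge_ends[OF e(1,2)] by blast
      then have "e = {u, w}" using e by auto
      then show ?thesis using closed[of u w] e(1) x eu unfolding C_def by simp
    qed
    then show "y \<in> C" using yX unfolding C_def by blast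
  qed
  have "u \<in> K" if "u \<in> V" for u
  proof -
    have "Inl (u, 0) \<in> BX" using that wt_pos by simp
    then have "Inl (u, 0) \<in> C" using \<open>C = BX\<close> by blast
    then show ?thesis unfolding C_def by simp
  qed
  then show ?thesis using K(1) by blast
qed

end

section \<open>Comparing subdivisions\<close>

text \<open>Exposes the family of paths, whose lengths have to be compared between different
  graphs.\<close>

definition uos_via :: "('v set \<Rightarrow> 'v list) \<Rightarrow> 'v wgraph \<Rightarrow> 'v wgraph \<Rightarrow> bool" where
  "uos_via P G H \<longleftrightarrow>
        (\<forall>e\<in>edges H. P e \<noteq> [] \<and> distinct (P e) \<and> even (length (P e)) \<and>
                     {hd (P e), last (P e)} = e \<and>
                     internal_verts (P e) \<inter> verts H = {}) \<and>
        (\<forall>e\<in>edges H. \<forall>e'\<in>edges H. e \<noteq> e' \<longrightarrow>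
                     internal_verts (P e) \<inter> internal_verts (P e') = {}) \<and>
        verts G = verts H \<union> (\<Union>e\<in>edges H. internal_verts (P e)) \<and>
        edges G = (\<Union>e\<in>edges H. path_edges (P e)) \<and>
        (\<forall>v\<in>verts H. weight G v = weight H v) \<and>
        (\<forall>v\<in>verts G - verts H. weight G v = 1)"

lemma unit_odd_subdivision_iff: "unit_odd_subdivision G H \<longleftrightarrow> (\<exists>P. uos_via P G H)"
  unfolding unit_odd_subdivision_def uos_via_def ..

lemma path_edges_Nil [simp]: "path_edges [] = {}" and path_edges_single [simp]: "path_edges [a] = {}"
  unfolding path_edges_def by auto

lemma path_edges_Cons: "path_edges (a # b # l) = insert {a, b} (path_edges (b # l))"
proof -
  have "{{(a # b # l) ! k, (a # b # l) ! Suc k} |k. Suc k < length (a # b # l)} =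
    insert {a, b} {{(b # l) ! k, (b # l) ! Suc k} |k. Suc k < length (b # l)}" (is "?L = insert _ ?R")
  proof (intro equalityI subsetI)
    fix e assume "e \<in> ?L"
    then obtain k where k: "e = {(a # b # l) ! k, (a # b # l) ! Suc k}" "Suc k < length (a # b # l)" by blast
    show "e \<in> insert {a, b} ?R"
    proof (cases k)
      case 0
      then show ?thesis using k by simp
    next
      case (Suc k')
      then have "e = {(b # l) ! k', (b # l) ! Suc k'}" "Suc k' < length (b # l)" using k by auto
      then show ?thesis by blast
    qed
  next
    fix e assume "e \<in> insert {a, b} ?R"
    then consider "e = {a, b}" | k where "e = {(b # l) ! k, (b # l) ! Suc k}" "Suc k < length (b # l)" by blast
    then show "e \<in> ?L"
    proof cases
      case 1
      then show ?thesis by (intro CollectI exI[of _ 0]) simp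
    next
      case 2
      then show ?thesis by (intro CollectI exI[of _ "Suc k"]) simp
    qed
  qed
  then show ?thesis unfolding path_edges_def .
qed

lemma path_edges_append: "path_edges (l1 @ a # l2) = path_edges (l1 @ [a]) \<union> path_edges (a # l2)"
proof (induction l1)
  case (Cons x l1)
  then show ?case by (cases l1) (auto simp: path_edges_Cons)
qed simp

lemma path_edges_sub: "e \<in> path_edges p \<Longrightarrow> e \<subseteq> set p"
  unfolding path_edges_def by auto

lemma path_edges_map: "path_edges (map f p) = (`) f ` path_edges p"
  by (induction p rule: induct_list012) (auto simp: path_edges_Cons)

lemma path_edges_rev: "path_edges (rev p) = path_edges p"
proof (induction p rule: induct_list012)
  case (3 a b l)
  have "path_edges (rev (a # b # l)) = path_edges (rev l @ b # [a])" by simp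
  also have "\<dots> = path_edges (rev l @ [b]) \<union> path_edges [b, a]" by (rule path_edges_append)
  also have "\<dots> = path_edges (rev (b # l)) \<union> {{a, b}}" by (simp add: path_edges_Cons insert_commute)
  finally show ?case using 3 by (simp add: path_edges_Cons)
qed auto

lemma internal_verts_rev: "internal_verts (rev p) = internal_verts p"
  unfolding internal_verts_def by (cases "p = []") (auto simp: hd_rev last_rev)

lemma internal_verts_nth:
  assumes "distinct p" "2 \<le> length p"
  shows "internal_verts p = {p ! j |j. 0 < j \<and> Suc j < length p}"
proof -
  have ne: "p \<noteq> []" using assms(2) by auto
  have ends: "hd p = p ! 0" "last p = p ! (length p - 1)"
    using ne by (auto simp: hd_conv_nth last_conv_nth)
  show ?thesis
  proof (intro equalityI subsetI)
    fix x assume "x \<in> internal_verts p"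
    then have x: "x \<in> set p" "x \<noteq> p ! 0" "x \<noteq> p ! (length p - 1)" unfolding internal_verts_def ends by auto
    then obtain j where j: "j < length p" "x = p ! j" by (auto simp: in_set_conv_nth)
    have "j \<noteq> 0" "j \<noteq> length p - 1" using x(2,3) j(2) by metis+
    then have "0 < j" "Suc j < length p" using j(1) by auto
    then show "x \<in> {p ! j |j. 0 < j \<and> Suc j < length p}" using j(2) by blast
  next
    fix x assume "x \<in> {p ! j |j. 0 < j \<and> Suc j < length p}"
    then obtain j where j: "x = p ! j" "0 < j" "Suc j < length p" by blast
    have "0 < length p" "j < length p" "length p - 1 < length p" "j \<noteq> length p - 1" using j by linarith+
    then have "p ! j \<noteq> p ! 0" "p ! j \<noteq> p ! (length p - 1)"
      using assms(1) j(2) nth_eq_iff_index_eq by (metis less_numeral_extra(3))+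
    then show "x \<in> internal_verts p" unfolding internal_verts_def ends using j by auto
  qed
qed

text \<open>The notion of subdivision does not confine the edges of R to its vertices, hence
  \<open>edges_in\<close>.\<close>

locale subdivided =
  fixes P :: "'v set \<Rightarrow> 'v list" and G R :: "'v wgraph"
  assumes via: "uos_via P G R" and edges_in: "\<And>e. e \<in> edges R \<Longrightarrow> e \<subseteq> verts R"
begin

lemmas via_conjs = via[unfolded uos_via_def, THEN conjunct1]
  via[unfolded uos_via_def, THEN conjunct2, THEN conjunct1]
  via[unfolded uos_via_def, THEN conjunct2, THEN conjunct2]

lemma path:
  assumes e: "e \<in> edges R"
  shows "P e \<noteq> []" "distinct (P e)" "even (length (P e))" "{hd (P e), last (P e)} = e"
    "internal_verts (P e) \<inter> verts R = {}"
  using bspec[OF via_conjs(1) e] by blast+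

lemmas internal_out = path(5)

lemma internal_disj: "e \<in> edges R \<Longrightarrow> e' \<in> edges R \<Longrightarrow> e \<noteq> e' \<Longrightarrow> internal_verts (P e) \<inter> internal_verts (P e') = {}"
  using via_conjs(2) by (elim ballE impE) auto

lemma verts_eq: "verts G = verts R \<union> (\<Union>e\<in>edges R. internal_verts (P e))"
  and edges_eq: "edges G = (\<Union>e\<in>edges R. path_edges (P e))"
  and weight_old: "v \<in> verts R \<Longrightarrow> weight G v = weight R v"
  and weight_new: "v \<in> verts G \<Longrightarrow> v \<notin> verts R \<Longrightarrow> weight G v = 1"
proof -
  note c = via_conjs(3)
  show "verts G = verts R \<union> (\<Union>e\<in>edges R. internal_verts (P e))" using c by (rule conjunct1)
  show "edges G = (\<Union>e\<in>edges R. path_edges (P e))" using c[THEN conjunct2] by (rule conjunct1)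
  show "v \<in> verts R \<Longrightarrow> weight G v = weight R v" using c[THEN conjunct2, THEN conjunct2, THEN conjunct1] by (rule bspec)
  show "v \<in> verts G \<Longrightarrow> v \<notin> verts R \<Longrightarrow> weight G v = 1"
    using c[THEN conjunct2, THEN conjunct2, THEN conjunct2] by simp
qed

lemma len: "e \<in> edges R \<Longrightarrow> 2 \<le> length (P e)"
proof -
  assume e: "e \<in> edges R"
  have "length (P e) \<noteq> 0" "length (P e) \<noteq> 1" using path(1,3)[OF e] by auto
  then show ?thesis by linarith
qed

lemma ends: assumes e: "e \<in> edges R"
  shows "P e ! 0 = hd (P e)" "P e ! (length (P e) - 1) = last (P e)"
    "P e ! 0 \<in> verts R" "P e ! (length (P e) - 1) \<in> verts R" "P e ! 0 \<noteq> P e ! (length (P e) - 1)"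
    "e = {P e ! 0, P e ! (length (P e) - 1)}"
proof -
  show h: "P e ! 0 = hd (P e)" "P e ! (length (P e) - 1) = last (P e)"
    using path(1)[OF e] by (auto simp: hd_conv_nth last_conv_nth)
  show e': "e = {P e ! 0, P e ! (length (P e) - 1)}" using path(4)[OF e] h by simp
  show "P e ! 0 \<in> verts R" "P e ! (length (P e) - 1) \<in> verts R" using edges_in[OF e] e' by blast+
  have "0 \<noteq> length (P e) - 1" using len[OF e] by linarith
  moreover have "0 < length (P e)" "length (P e) - 1 < length (P e)" using len[OF e] by linarith+
  ultimately show "P e ! 0 \<noteq> P e ! (length (P e) - 1)"
    using path(2)[OF e] nth_eq_iff_index_eq by metis
qed

lemma internal: "e \<in> edges R \<Longrightarrow> internal_verts (P e) = {P e ! j |j. 0 < j \<and> Suc j < length (P e)}"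
  using internal_verts_nth path(2) len by blast

lemma inner_out: "e \<in> edges R \<Longrightarrow> 0 < j \<Longrightarrow> Suc j < length (P e) \<Longrightarrow> P e ! j \<notin> verts R"
  using internal_out internal by blast

lemma inner_unique:
  assumes e: "e \<in> edges R" "e' \<in> edges R" and j: "0 < j" "Suc j < length (P e)" "j' < length (P e')"
    and eq: "P e ! j = P e' ! j'"
  shows "e = e' \<and> j = j'"
proof -
  have out: "P e' ! j' \<notin> verts R" using inner_out[OF e(1) j(1,2)] eq by simp
  then have "j' \<noteq> 0" "j' \<noteq> length (P e') - 1" using ends(3,4)[OF e(2)] by metis+
  then have j': "0 < j'" "Suc j' < length (P e')" using j(3) by auto
  have "P e ! j \<in> internal_verts (P e)" "P e ! j \<in> internal_verts (P e')"
    using internal e j j' eq by blast+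
  then have "e = e'" using internal_disj e by blast
  then show ?thesis using eq path(2)[OF e(1)] j j' by (simp add: nth_eq_iff_index_eq)
qed

text \<open>If one end of the edge is an inner vertex of its path, \<open>inner_unique\<close>
  locates it. Otherwise the path of e is a single edge with both ends in R, and then the same must
  hold for e'.\<close>

lemma edge_unique:
  assumes e: "e \<in> edges R" "e' \<in> edges R" and k: "Suc k < length (P e)" "Suc k' < length (P e')"
    and eq: "{P e ! k, P e ! Suc k} = {P e' ! k', P e' ! Suc k'}"
  shows "e = e' \<and> k = k'"
proof -
  have same: "e = e' \<Longrightarrow> k = k'"
  proof -
    assume ee: "e = e'"
    have "(k = k' \<and> Suc k = Suc k') \<or> (k = Suc k' \<and> Suc k = k')"
      using eq k path(2)[OF e(1)] unfolding ee by (auto simp: doubleton_eq_iff nth_eq_iff_index_eq)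
    then show ?thesis by auto
  qed
  have "e = e'"
  proof (cases "k = 0 \<and> Suc (Suc k) = length (P e)")
    case False
    then have "0 < k \<or> Suc (Suc k) < length (P e)" using k(1) by auto
    then obtain j where j: "j = k \<or> j = Suc k" "0 < j" "Suc j < length (P e)"
    proof
      assume "0 < k" then show ?thesis using that[of k] k(1) by simp
    next
      assume "Suc (Suc k) < length (P e)" then show ?thesis using that[of "Suc k"] by simp
    qed
    then have "P e ! j \<in> {P e' ! k', P e' ! Suc k'}" using eq by blast
    then have "P e ! j = P e' ! k' \<or> P e ! j = P e' ! Suc k'" by blast
    then obtain j' where "j' < length (P e')" "P e ! j = P e' ! j'" using k(2) Suc_lessD by metis
    then show ?thesis using inner_unique[OF e j(2,3)] by blast
  next
    case True
    then have "k = 0" "Suc k = length (P e) - 1" by linarith+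
    then have ek: "{P e ! k, P e ! Suc k} = e" using ends(6)[OF e(1)] by metis
    have "k' = 0 \<and> Suc (Suc k') = length (P e')"
    proof (rule ccontr)
      assume "\<not> ?thesis"
      then have "0 < k' \<or> Suc (Suc k') < length (P e')" using k(2) by auto
      then have "P e' ! k' \<notin> verts R \<or> P e' ! Suc k' \<notin> verts R"
        using inner_out[OF e(2), of k'] inner_out[OF e(2), of "Suc k'"] k(2) by auto
      then show False using ek eq edges_in[OF e(1)] by blast
    qed
    then have "k' = 0" "Suc k' = length (P e') - 1" by linarith+
    then have "{P e' ! k', P e' ! Suc k'} = e'" using ends(6)[OF e(2)] by metis
    then show ?thesis using ek eq by simp
  qed
  then show ?thesis using same by blast
qed

end

section \<open>Subdividing a subdivision further\<close>

lemma wgraph_iso_image: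
  assumes "inj_on f (verts G)"
  shows "wgraph_iso G \<lparr>verts = f ` verts G, edges = (`) f ` edges G,
    weight = \<lambda>y. weight G (inv_into (verts G) f y)\<rparr>"
  unfolding wgraph_iso_def
  by (rule exI[of _ f]) (use assms in \<open>auto simp: bij_betw_def inv_into_f_f\<close>)

text \<open>The first graph arises from the second one by lengthening the last edge of every path.\<close>

lemma subdivision_compare:
  fixes G R :: "'a wgraph" and H S :: "nat wgraph"
  assumes GR: "subdivided P0 G R" and HS: "subdivided Q H S"
    and finG: "finite (verts G)" and finH: "finite (verts H)"
    and g: "bij_betw g (verts R) (verts S)" "edges S = (`) g ` edges R"
      "\<And>v. v \<in> verts R \<Longrightarrow> weight S (g v) = weight R v"
    and len_le: "\<And>e. e \<in> edges R \<Longrightarrow> length (Q (g ` e)) \<le> length (P0 e)"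
  shows "\<exists>G' :: nat wgraph. unit_odd_subdivision G' H \<and> wgraph_iso G G'"
proof -
  interpret A0: subdivided P0 G R by (rule GR)
  interpret B: subdivided Q H S by (rule HS)
  \<comment> \<open>Turns the paths of G around where necessary, so that g maps the start of each
    path to the start of the corresponding path of H.\<close>
  define P where "P e = (if g (hd (P0 e)) = hd (Q (g ` e)) then P0 e else rev (P0 e))" for e
  have "uos_via P G R"
  proof -
    have "path_edges (P e) = path_edges (P0 e)" "internal_verts (P e) = internal_verts (P0 e)"
      "length (P e) = length (P0 e)" "distinct (P e) = distinct (P0 e)" "P e = [] \<longleftrightarrow> P0 e = []" for e
      unfolding P_def by (auto simp: path_edges_rev internal_verts_rev)
    moreover have "P0 e \<noteq> [] \<Longrightarrow> {hd (P e), last (P e)} = {hd (P0 e), last (P0 e)}" for e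
      unfolding P_def by (auto simp: hd_rev last_rev)
    ultimately show ?thesis using A0.via unfolding uos_via_def by auto
  qed
  then interpret A: subdivided P G R using A0.edges_in by unfold_locales
  define lQ where "lQ e = length (Q (g ` e))" for e
  define lP where "lP e = length (P e)" for e
  have lenP: "length (P e) = lP e" "length (Q (g ` e)) = lQ e" for e unfolding lQ_def lP_def by auto
  have gE: "g ` e \<in> edges S" if "e \<in> edges R" for e using that g(2) by blast
  have lens: "2 \<le> lQ e" "lQ e \<le> lP e" "even (lQ e)" "even (lP e)" if "e \<in> edges R" for e
    using B.len[OF gE[OF that]] len_le[OF that] B.path(3)[OF gE[OF that]] A.path(3)[OF that]
    unfolding lQ_def lP_def P_def by (auto split: if_splits)
  have inj_g: "inj_on g (verts R)" using g(1) unfolding bij_betw_def by blast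
  have g_edge_inj: "g ` e = g ` e' \<Longrightarrow> e = e'" if "e \<in> edges R" "e' \<in> edges R" for e e'
    using inj_on_image_eq_iff[OF inj_g] A0.edges_in that by blast
  have g_hd: "g (P e ! 0) = Q (g ` e) ! 0" and g_last: "g (P e ! (lP e - 1)) = Q (g ` e) ! (lQ e - 1)"
    if e: "e \<in> edges R" for e
  proof -
    have ge: "g ` e = {Q (g ` e) ! 0, Q (g ` e) ! (lQ e - 1)}" using B.ends(6)[OF gE[OF e]] unfolding lQ_def .
    have hd0: "P0 e \<noteq> []" using A0.path(1)[OF e] .
    have e2: "e = {P e ! 0, P e ! (lP e - 1)}" using A.ends(6)[OF e] unfolding lP_def .
    show h: "g (P e ! 0) = Q (g ` e) ! 0"
    proof (cases "g (hd (P0 e)) = hd (Q (g ` e))")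
      case True
      then show ?thesis using A.ends(1)[OF e] B.ends(1)[OF gE[OF e]] unfolding P_def by simp
    next
      case False
      have "hd (P0 e) \<in> e" using A0.path(4)[OF e] by blast
      then have "g (hd (P0 e)) = Q (g ` e) ! (lQ e - 1)"
        using False ge B.ends(1)[OF gE[OF e]] by (metis image_eqI insertE singletonD)
      moreover have "hd (P0 e) = P e ! (lP e - 1)"
        using False A.ends(2)[OF e] hd0 unfolding P_def lP_def by (simp add: last_rev)
      ultimately have l: "g (P e ! (lP e - 1)) = Q (g ` e) ! (lQ e - 1)" by simp
      have "g ` e = {g (P e ! 0), g (P e ! (lP e - 1))}" by (subst e2) simp
      moreover have "g (P e ! 0) \<noteq> g (P e ! (lP e - 1))"
        using inj_onD[OF inj_g] A.ends(3,4,5)[OF e] unfolding lP_def by metis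
      ultimately show ?thesis using ge l by (metis doubleton_eq_iff)
    qed
    have "g ` e = {g (P e ! 0), g (P e ! (lP e - 1))}" by (subst e2) simp
    then show "g (P e ! (lP e - 1)) = Q (g ` e) ! (lQ e - 1)"
      using ge h by (metis doubleton_eq_iff)
  qed
  obtain \<iota> :: "'a \<Rightarrow> nat" where \<iota>: "inj_on \<iota> (verts G)"
    using finite_imp_inj_to_nat_seg[OF finG] by blast
  obtain M where M: "\<And>v. v \<in> verts H \<Longrightarrow> v < M"
    using finH by (meson finite_nat_set_iff_bounded)
  \<comment> \<open>Inner vertices of the short path are matched with the long path by position,
    counted from the start. The surplus inner vertices of the long path become numbers from M on,
    which are no vertices of H.\<close>
  define pos where "pos x e j \<longleftrightarrow> e \<in> edges R \<and> 0 < j \<and> Suc j < lQ e \<and> x = P e ! j" for x e j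
  define f where "f x = (if x \<in> verts R then g x
      else if \<exists>e j. pos x e j then (THE y. \<exists>e j. pos x e j \<and> y = Q (g ` e) ! j) else M + \<iota> x)" for x
  have f_old: "f x = g x" if "x \<in> verts R" for x using that unfolding f_def by simp
  have f_pos: "f (P e ! j) = Q (g ` e) ! j" if e: "e \<in> edges R" and j: "0 < j" "Suc j < lQ e" for e j
  proof -
    have j': "Suc j < lP e" using j lens(2)[OF e] by simp
    have p: "pos (P e ! j) e j" unfolding pos_def using e j by simp
    have u: "e' = e \<and> j' = j" if "pos (P e ! j) e' j'" for e' j'
    proof -
      have "j' < length (P e')" "e' \<in> edges R" "P e ! j = P e' ! j'"
        using that lens(2)[of e'] unfolding pos_def lenP by auto
      then show ?thesis using A.inner_unique[OF e _ j(1)] j' unfolding lenP by blast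
    qed
    have "(THE y. \<exists>e' j'. pos (P e ! j) e' j' \<and> y = Q (g ` e') ! j') = Q (g ` e) ! j"
    proof (rule the_equality)
      show "\<exists>e' j'. pos (P e ! j) e' j' \<and> Q (g ` e) ! j = Q (g ` e') ! j'" using p by blast
      show "y = Q (g ` e) ! j" if "\<exists>e' j'. pos (P e ! j) e' j' \<and> y = Q (g ` e') ! j'" for y
        using that u by blast
    qed
    moreover have "P e ! j \<notin> verts R" using A.inner_out[OF e j(1)] j' unfolding lenP by blast
    ultimately show ?thesis unfolding f_def using p by auto
  qed
  have f_fresh: "f (P e ! j) = M + \<iota> (P e ! j)" if e: "e \<in> edges R" and j: "lQ e \<le> Suc j" "Suc j < lP e" for e j
  proof -
    have j0: "0 < j" using lens(1)[OF e] j(1) by simp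
    have "\<not> pos (P e ! j) e' j'" for e' j'
    proof
      assume p: "pos (P e ! j) e' j'"
      then have "j' < length (P e')" "e' \<in> edges R" "P e ! j = P e' ! j'"
        using lens(2)[of e'] unfolding pos_def lenP by auto
      then have "e' = e \<and> j' = j" using A.inner_unique[OF e _ j0] j(2) unfolding lenP by blast
      then show False using p j(1) unfolding pos_def by simp
    qed
    then have "\<not> (\<exists>e' j'. pos (P e ! j) e' j')" by blast
    moreover have "P e ! j \<notin> verts R" using A.inner_out[OF e j0] j(2) unfolding lenP by blast
    ultimately show ?thesis unfolding f_def by (simp only: if_False)
  qed
  have f_low: "f (P e ! j) = Q (g ` e) ! j" if e: "e \<in> edges R" and j: "Suc j < lQ e" for e j
  proof (cases "j = 0")
    case True
    then show ?thesis using g_hd[OF e] f_old[OF A.ends(3)[OF e]] by simp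
  qed (use f_pos e j in simp)
  have f_last: "f (P e ! (lP e - 1)) = Q (g ` e) ! (lQ e - 1)" if e: "e \<in> edges R" for e
    using g_last[OF e] f_old[OF A.ends(4)[OF e]] unfolding lenP by simp
  have vcases: "(x \<in> verts R) \<or> (\<exists>e j. pos x e j) \<or>
      (\<exists>e j. e \<in> edges R \<and> lQ e \<le> Suc j \<and> Suc j < lP e \<and> x = P e ! j)" if x: "x \<in> verts G" for x
  proof (cases "x \<in> verts R")
    case False
    then obtain e where e: "e \<in> edges R" "x \<in> internal_verts (P e)" using x A.verts_eq by blast
    then obtain j where j: "x = P e ! j" "0 < j" "Suc j < lP e" using A.internal[OF e(1)] unfolding lenP by blast
    show ?thesis
    proof (cases "Suc j < lQ e")
      case True
      then have "pos x e j" unfolding pos_def using e(1) j by simp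
      then show ?thesis by blast
    next
      case False
      then have "e \<in> edges R \<and> lQ e \<le> Suc j \<and> Suc j < lP e \<and> x = P e ! j" using e(1) j by simp
      then show ?thesis by blast
    qed
  qed simp
  have QH: "Q (g ` e) ! j \<in> verts H \<and> Q (g ` e) ! j \<notin> verts S" if "e \<in> edges R" "0 < j" "Suc j < lQ e" for e j
    using B.inner_out[OF gE[OF that(1)] that(2)] B.internal[OF gE[OF that(1)]] B.verts_eq gE[OF that(1)] that
    unfolding lenP by blast
  have SH: "verts S \<subseteq> verts H" using B.verts_eq by blast
  have gS: "g x \<in> verts S" if "x \<in> verts R" for x using g(1) that bij_betwE by blast
  have kind: "(x \<in> verts R \<and> f x \<in> verts S) \<or> ((\<exists>e j. pos x e j) \<and> f x \<in> verts H - verts S)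
      \<or> (x \<notin> verts R \<and> f x = M + \<iota> x)" if x: "x \<in> verts G" for x
    using vcases[OF x]
  proof (elim disjE exE)
    assume "x \<in> verts R" then show ?thesis using f_old gS by simp
  next
    fix e j assume p: "pos x e j"
    then have "f x = Q (g ` e) ! j" using f_pos unfolding pos_def by blast
    moreover have "e \<in> edges R" "0 < j" "Suc j < lQ e" using p unfolding pos_def by auto
    ultimately have "f x \<in> verts H - verts S" using QH by simp
    then show ?thesis using p by blast
  next
    fix e j assume a: "e \<in> edges R \<and> lQ e \<le> Suc j \<and> Suc j < lP e \<and> x = P e ! j"
    then have "0 < j" using lens(1)[of e] by auto
    then have "x \<notin> verts R" using A.inner_out[of e j] a unfolding lenP by blast
    moreover have "f x = M + \<iota> x" using f_fresh[of e j] a by simp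
    ultimately show ?thesis by simp
  qed
  have inj_f: "inj_on f (verts G)"
  proof (rule inj_onI)
    fix x y assume x: "x \<in> verts G" and y: "y \<in> verts G" and eq: "f x = f y"
    from kind[OF x] show "x = y"
    proof (elim disjE conjE exE)
      assume a: "x \<in> verts R" "f x \<in> verts S"
      then have "y \<in> verts R" using kind[OF y] eq M SH by fastforce
      then show ?thesis using a(1) eq f_old inj_onD[OF inj_g] by metis
    next
      fix e j assume p: "pos x e j" and "f x \<in> verts H - verts S"
      then have "\<exists>e j. pos y e j" using kind[OF y] eq M SH by fastforce
      then obtain e' j' where p': "pos y e' j'" by blast
      have "Q (g ` e) ! j = Q (g ` e') ! j'" using f_pos eq p p' unfolding pos_def by metis
      then have "g ` e = g ` e' \<and> j = j'"
        using B.inner_unique[OF gE gE] p p' unfolding pos_def lenP by (metis Suc_lessD)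
      then show ?thesis using p p' g_edge_inj unfolding pos_def by blast
    next
      assume a: "x \<notin> verts R" "f x = M + \<iota> x"
      then have "f y = M + \<iota> y" using kind[OF y] eq M SH by fastforce
      then show ?thesis using a(2) eq inj_onD[OF \<iota>] x y by simp
    qed
  qed
  define G' where "G' = \<lparr>verts = f ` verts G, edges = (`) f ` edges G,
    weight = \<lambda>y. weight G (inv_into (verts G) f y)\<rparr>"
  have iso: "wgraph_iso G G'" unfolding G'_def by (rule wgraph_iso_image[OF inj_f])
  have wG': "weight G' (f x) = weight G x" if "x \<in> verts G" for x
    unfolding G'_def using inj_f that by (simp add: inv_into_f_f)
  define lastE where "lastE e = {Q (g ` e) ! (lQ e - 2), Q (g ` e) ! (lQ e - 1)}" for e
  \<comment> \<open>Starts at the last vertex but one of the short path and so replaces its last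
    edge. It has \<open>lP e - lQ e + 2\<close> vertices, again an even number.\<close>
  define tail where "tail e = map f (drop (lQ e - 2) (P e))" for e
  \<comment> \<open>Different edges of R have different last edges in H, so \<open>THE\<close> finds
    the right tail. All other edges of H stay unchanged, as paths of two vertices.\<close>
  define pth where "pth \<epsilon> = (if \<exists>e\<in>edges R. \<epsilon> = lastE e then tail (THE e. e \<in> edges R \<and> \<epsilon> = lastE e)
      else (SOME l. \<exists>a b. l = [a, b] \<and> \<epsilon> = {a, b} \<and> a \<noteq> b))" for \<epsilon>
  have edge_unique: "e = e' \<and> k = k'" if "e \<in> edges R" "e' \<in> edges R" "Suc k < lQ e" "Suc k' < lQ e'"
    "{Q (g ` e) ! k, Q (g ` e) ! Suc k} = {Q (g ` e') ! k', Q (g ` e') ! Suc k'}" for e e' k k'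
    using B.edge_unique[OF gE gE, of e e' k k'] that g_edge_inj unfolding lenP by blast
  have lastE: "lastE e = {Q (g ` e) ! (lQ e - 2), Q (g ` e) ! Suc (lQ e - 2)}" "Suc (lQ e - 2) < lQ e"
    if "e \<in> edges R" for e
    using lens(1)[OF that] unfolding lastE_def by (auto simp: numeral_2_eq_2 Suc_diff_Suc)
  have pth_last: "pth (lastE e) = tail e" if e: "e \<in> edges R" for e
  proof -
    have "(THE e'. e' \<in> edges R \<and> lastE e = lastE e') = e"
    proof (rule the_equality)
      show "e' = e" if "e' \<in> edges R \<and> lastE e = lastE e'" for e'
        using edge_unique[OF e, of e' "lQ e - 2" "lQ e' - 2"] lastE[OF e] lastE[of e'] that by auto
    qed (use e in simp)
    then show ?thesis unfolding pth_def using e by auto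
  qed
  have edgesH: "\<exists>e\<in>edges R. \<exists>k. Suc k < lQ e \<and> \<epsilon> = {Q (g ` e) ! k, Q (g ` e) ! Suc k}"
    if "\<epsilon> \<in> edges H" for \<epsilon>
    using that unfolding B.edges_eq g(2) path_edges_def lQ_def by blast
  have pth_other: "\<exists>a b. pth \<epsilon> = [a, b] \<and> \<epsilon> = {a, b} \<and> a \<noteq> b"
    if \<epsilon>: "\<epsilon> \<in> edges H" and no: "\<not> (\<exists>e\<in>edges R. \<epsilon> = lastE e)" for \<epsilon>
  proof -
    obtain e k where ek: "e \<in> edges R" "Suc k < lQ e" "\<epsilon> = {Q (g ` e) ! k, Q (g ` e) ! Suc k}"
      using edgesH[OF \<epsilon>] by blast
    have "Q (g ` e) ! k \<noteq> Q (g ` e) ! Suc k"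
      using B.path(2)[OF gE[OF ek(1)]] ek(2) unfolding lQ_def by (simp add: nth_eq_iff_index_eq)
    then have "\<exists>l a b. l = [a, b] \<and> \<epsilon> = {a, b} \<and> a \<noteq> b" using ek(3) by blast
    from someI_ex[OF this] show ?thesis unfolding pth_def using no by simp
  qed
  have dropG: "set (drop n (P e)) \<subseteq> verts G" if "e \<in> edges R" for e n
  proof -
    have "set (P e) \<subseteq> internal_verts (P e) \<union> e" using A.path(4)[OF that] unfolding internal_verts_def by blast
    then show ?thesis using A.verts_eq A.edges_in[OF that] that set_drop_subset[of n "P e"] by blast
  qed
  have tail: "tail e \<noteq> []" "distinct (tail e)" "even (length (tail e))" "2 \<le> length (tail e)"
      "hd (tail e) = Q (g ` e) ! (lQ e - 2)" "last (tail e) = Q (g ` e) ! (lQ e - 1)"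
      "internal_verts (tail e) = (\<lambda>j. f (P e ! j)) ` {j. lQ e \<le> Suc j \<and> Suc j < lP e}"
    if e: "e \<in> edges R" for e
  proof -
    have lt: "length (tail e) = lP e - (lQ e - 2)" unfolding tail_def by (simp add: lenP)
    show l2: "2 \<le> length (tail e)" using lt lens[OF e] by linarith
    then show ne: "tail e \<noteq> []" by auto
    show "even (length (tail e))" using lt lens[OF e] by auto
    show d: "distinct (tail e)" unfolding tail_def
      using A.path(2)[OF e] inj_on_subset[OF inj_f dropG[OF e]] by (simp add: distinct_map)
    have nth: "tail e ! i = f (P e ! (lQ e - 2 + i))" if "i < length (tail e)" for i
      using that unfolding tail_def by (simp add: lenP)
    have "hd (tail e) = f (P e ! (lQ e - 2))" using nth[of 0] ne by (simp add: hd_conv_nth)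
    then show "hd (tail e) = Q (g ` e) ! (lQ e - 2)" using f_low[OF e, of "lQ e - 2"] lens(1)[OF e] by simp
    have "last (tail e) = f (P e ! (lQ e - 2 + (length (tail e) - 1)))"
      using nth[of "length (tail e) - 1"] ne l2 by (simp add: last_conv_nth)
    moreover have "lQ e - 2 + (length (tail e) - 1) = lP e - 1" using lt lens[OF e] by linarith
    ultimately show "last (tail e) = Q (g ` e) ! (lQ e - 1)" using f_last[OF e] by simp
    show "internal_verts (tail e) = (\<lambda>j. f (P e ! j)) ` {j. lQ e \<le> Suc j \<and> Suc j < lP e}"
      unfolding internal_verts_nth[OF d l2]
    proof (intro equalityI subsetI)
      fix x assume "x \<in> {tail e ! j |j. 0 < j \<and> Suc j < length (tail e)}"
      then obtain j where j: "x = tail e ! j" "0 < j" "Suc j < length (tail e)" by blast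
      then have "x = f (P e ! (lQ e - 2 + j))" using nth[of j] by simp
      moreover have "lQ e \<le> Suc (lQ e - 2 + j)" "Suc (lQ e - 2 + j) < lP e" using j lt lens[OF e] by linarith+
      ultimately show "x \<in> (\<lambda>j. f (P e ! j)) ` {j. lQ e \<le> Suc j \<and> Suc j < lP e}" by blast
    next
      fix x assume "x \<in> (\<lambda>j. f (P e ! j)) ` {j. lQ e \<le> Suc j \<and> Suc j < lP e}"
      then obtain j where j: "x = f (P e ! j)" "lQ e \<le> Suc j" "Suc j < lP e" by blast
      define i where "i = j - (lQ e - 2)"
      have i: "0 < i" "Suc i < length (tail e)" "lQ e - 2 + i = j" unfolding i_def using j lt lens[OF e] by linarith+
      then have "x = tail e ! i" using nth[of i] j(1) by simp
      then show "x \<in> {tail e ! j |j. 0 < j \<and> Suc j < length (tail e)}" using i by blast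
    qed
  qed
  have tail_fresh: "M \<le> y" if "e \<in> edges R" "y \<in> internal_verts (tail e)" for e y
    using that(2) unfolding tail(7)[OF that(1)] using f_fresh[OF that(1)] by auto
  have two: "internal_verts [a, b] = {}" for a b :: nat unfolding internal_verts_def by auto
  have dich: "(\<exists>e\<in>edges R. \<epsilon> = lastE e \<and> pth \<epsilon> = tail e) \<or> (\<exists>a b. pth \<epsilon> = [a, b] \<and> \<epsilon> = {a, b} \<and> a \<noteq> b)"
    if "\<epsilon> \<in> edges H" for \<epsilon>
    using pth_other[OF that] pth_last by blast
  have lastH: "lastE e \<in> edges H" if "e \<in> edges R" for e
    unfolding B.edges_eq lastE(1)[OF that] path_edges_def using gE[OF that] lastE(2)[OF that] unfolding lQ_def by blast
  have c1: "\<forall>\<epsilon>\<in>edges H. pth \<epsilon> \<noteq> [] \<and> distinct (pth \<epsilon>) \<and> even (length (pth \<epsilon>)) \<and>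
      {hd (pth \<epsilon>), last (pth \<epsilon>)} = \<epsilon> \<and> internal_verts (pth \<epsilon>) \<inter> verts H = {}"
  proof
    fix \<epsilon> assume "\<epsilon> \<in> edges H"
    from dich[OF this] show "pth \<epsilon> \<noteq> [] \<and> distinct (pth \<epsilon>) \<and> even (length (pth \<epsilon>)) \<and>
      {hd (pth \<epsilon>), last (pth \<epsilon>)} = \<epsilon> \<and> internal_verts (pth \<epsilon>) \<inter> verts H = {}"
    proof (elim disjE bexE exE)
      fix e assume e: "e \<in> edges R" and l: "\<epsilon> = lastE e \<and> pth \<epsilon> = tail e"
      have "internal_verts (tail e) \<inter> verts H = {}" using tail_fresh[OF e] M by fastforce
      moreover have "{hd (tail e), last (tail e)} = \<epsilon>"
        unfolding tail(5,6)[OF e] using l unfolding lastE_def by simp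
      moreover have p: "pth \<epsilon> = tail e" using l by blast
      ultimately show ?thesis unfolding p using tail(1,2,3)[OF e] by blast
    next
      fix a b assume ab: "pth \<epsilon> = [a, b] \<and> \<epsilon> = {a, b} \<and> a \<noteq> b"
      then have p: "pth \<epsilon> = [a, b]" by blast
      show ?thesis unfolding p using ab two by simp
    qed
  qed
  have c2: "\<forall>\<epsilon>\<in>edges H. \<forall>\<delta>\<in>edges H. \<epsilon> \<noteq> \<delta> \<longrightarrow> internal_verts (pth \<epsilon>) \<inter> internal_verts (pth \<delta>) = {}"
  proof (intro ballI impI)
    fix \<epsilon> \<delta> assume \<epsilon>: "\<epsilon> \<in> edges H" and \<delta>: "\<delta> \<in> edges H" and ne: "\<epsilon> \<noteq> \<delta>"
    show "internal_verts (pth \<epsilon>) \<inter> internal_verts (pth \<delta>) = {}"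
    proof (rule ccontr)
      assume a: "\<not> ?thesis"
      then have "internal_verts (pth \<epsilon>) \<noteq> {}" "internal_verts (pth \<delta>) \<noteq> {}" by blast+
      then obtain e d where e: "e \<in> edges R" "\<epsilon> = lastE e" "pth \<epsilon> = tail e"
        and d: "d \<in> edges R" "\<delta> = lastE d" "pth \<delta> = tail d"
        using dich[OF \<epsilon>] dich[OF \<delta>] two by metis
      obtain y where y: "y \<in> internal_verts (tail e)" "y \<in> internal_verts (tail d)" using a e(3) d(3) by auto
      obtain j where j: "y = f (P e ! j)" "lQ e \<le> Suc j" "Suc j < lP e" using y(1) unfolding tail(7)[OF e(1)] by blast
      obtain i where i: "y = f (P d ! i)" "lQ d \<le> Suc i" "Suc i < lP d" using y(2) unfolding tail(7)[OF d(1)] by blast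
      have pos: "0 < j" "0 < i" using j i lens(1)[OF e(1)] lens(1)[OF d(1)] by linarith+
      have "P e ! j \<in> verts G" "P d ! i \<in> verts G"
        using A.verts_eq A.internal[OF e(1)] A.internal[OF d(1)] e(1) d(1) pos j(3) i(3) unfolding lenP by blast+
      then have "P e ! j = P d ! i" using inj_onD[OF inj_f] j(1) i(1) by metis
      then have "e = d" using A.inner_unique[OF e(1) d(1) pos(1), of i] j(3) i(3) unfolding lenP by simp
      then show False using ne e(2) d(2) by simp
    qed
  qed
  have c3: "verts G' = verts H \<union> (\<Union>\<epsilon>\<in>edges H. internal_verts (pth \<epsilon>))"
  proof (intro equalityI subsetI)
    fix y assume "y \<in> verts G'"
    then obtain x where x: "x \<in> verts G" "y = f x" unfolding G'_def by auto
    from vcases[OF x(1)] show "y \<in> verts H \<union> (\<Union>\<epsilon>\<in>edges H. internal_verts (pth \<epsilon>))"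
    proof (elim disjE exE)
      assume "x \<in> verts R" then show ?thesis using x(2) f_old gS SH by auto
    next
      fix e j assume "pos x e j"
      then show ?thesis using x(2) f_pos QH unfolding pos_def by auto
    next
      fix e j assume a: "e \<in> edges R \<and> lQ e \<le> Suc j \<and> Suc j < lP e \<and> x = P e ! j"
      then have "y \<in> internal_verts (pth (lastE e))" using x(2) tail(7) pth_last by auto
      then show ?thesis using lastH a by blast
    qed
  next
    fix y assume "y \<in> verts H \<union> (\<Union>\<epsilon>\<in>edges H. internal_verts (pth \<epsilon>))"
    then consider "y \<in> verts S" | d where "d \<in> edges S" "y \<in> internal_verts (Q d)"
      | \<epsilon> where "\<epsilon> \<in> edges H" "y \<in> internal_verts (pth \<epsilon>)" using B.verts_eq by blast
    then show "y \<in> verts G'"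
    proof cases
      case 1
      then obtain x where "x \<in> verts R" "y = g x" using g(1) unfolding bij_betw_def by blast
      then have "y = f x" "x \<in> verts G" using f_old A.verts_eq by auto
      then show ?thesis unfolding G'_def by simp
    next
      case 2
      then obtain e where e: "e \<in> edges R" "d = g ` e" using g(2) by blast
      obtain j where j: "y = Q (g ` e) ! j" "0 < j" "Suc j < lQ e"
        using 2 e B.internal[OF gE[OF e(1)]] unfolding lenP by blast
      then have "y = f (P e ! j)" using f_pos[OF e(1)] by simp
      moreover have "Suc j < lP e" using j(3) lens(2)[OF e(1)] by linarith
      then have "P e ! j \<in> verts G"
        using A.verts_eq A.internal[OF e(1)] e(1) j(2) unfolding lenP by blast
      ultimately show ?thesis unfolding G'_def by simp
    next
      case 3
      have "internal_verts (pth \<epsilon>) \<noteq> {}" using 3(2) by blast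
      then obtain e where e: "e \<in> edges R" "pth \<epsilon> = tail e" using dich[OF 3(1)] two by metis
      then obtain j where j: "y = f (P e ! j)" "lQ e \<le> Suc j" "Suc j < lP e" using 3(2) tail(7)[OF e(1)] by auto
      then have "0 < j" using lens(1)[OF e(1)] by linarith
      then have "P e ! j \<in> verts G"
        using A.verts_eq A.internal[OF e(1)] e(1) j unfolding lenP by blast
      then show ?thesis using j(1) unfolding G'_def by simp
    qed
  qed
  have pe_two: "path_edges [a, b] = {{a, b}}" for a b :: nat by (simp add: path_edges_Cons)
  have c4: "edges G' = (\<Union>\<epsilon>\<in>edges H. path_edges (pth \<epsilon>))"
  proof (intro equalityI subsetI)
    fix \<epsilon> assume "\<epsilon> \<in> edges G'"
    then obtain e k where ek: "e \<in> edges R" "Suc k < lP e" "\<epsilon> = f ` {P e ! k, P e ! Suc k}"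
      unfolding G'_def A.edges_eq path_edges_def lenP by auto
    show "\<epsilon> \<in> (\<Union>\<epsilon>\<in>edges H. path_edges (pth \<epsilon>))"
    proof (cases "Suc (Suc k) < lQ e")
      case True
      then have \<epsilon>: "\<epsilon> = {Q (g ` e) ! k, Q (g ` e) ! Suc k}" using ek f_low[OF ek(1)] by simp
      have H: "\<epsilon> \<in> edges H"
        unfolding B.edges_eq path_edges_def using gE[OF ek(1)] True \<epsilon> unfolding lQ_def
        by (metis (mono_tags, lifting) Suc_lessD UN_I mem_Collect_eq)
      have "\<not> (\<exists>e'\<in>edges R. \<epsilon> = lastE e')"
      proof
        assume "\<exists>e'\<in>edges R. \<epsilon> = lastE e'"
        then obtain e' where e': "e' \<in> edges R" "\<epsilon> = lastE e'" by blast
        have "e = e' \<and> k = lQ e' - 2"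
          using edge_unique[OF ek(1) e'(1), of k "lQ e' - 2"] True e'(2) \<epsilon> lastE[OF e'(1)] by simp
        then have "k = lQ e - 2" by simp
        then show False using True by linarith
      qed
      then obtain a b where "pth \<epsilon> = [a, b]" "\<epsilon> = {a, b}" using pth_other[OF H] by blast
      then have "\<epsilon> \<in> path_edges (pth \<epsilon>)" using pe_two by simp
      then show ?thesis using H by blast
    next
      case False
      define i where "i = k - (lQ e - 2)"
      have i: "lQ e - 2 + i = k" "Suc i < lP e - (lQ e - 2)" unfolding i_def using False ek(2) lens[OF ek(1)] by linarith+
      then have \<epsilon>: "\<epsilon> = f ` {drop (lQ e - 2) (P e) ! i, drop (lQ e - 2) (P e) ! Suc i}"
        using ek(3) by (simp add: lenP)
      have "Suc i < length (drop (lQ e - 2) (P e))" using i(2) by (simp add: lenP)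
      then have "{drop (lQ e - 2) (P e) ! i, drop (lQ e - 2) (P e) ! Suc i} \<in> path_edges (drop (lQ e - 2) (P e))"
        unfolding path_edges_def by blast
      then have "\<epsilon> \<in> path_edges (tail e)"
        unfolding tail_def path_edges_map \<epsilon> by (rule imageI)
      then show ?thesis using pth_last[OF ek(1)] lastH[OF ek(1)] by force
    qed
  next
    fix \<epsilon> assume "\<epsilon> \<in> (\<Union>\<epsilon>\<in>edges H. path_edges (pth \<epsilon>))"
    then obtain \<delta> where \<delta>: "\<delta> \<in> edges H" "\<epsilon> \<in> path_edges (pth \<delta>)" by blast
    show "\<epsilon> \<in> edges G'"
    proof (cases "\<exists>e\<in>edges R. \<delta> = lastE e")
      case True
      then obtain e where e: "e \<in> edges R" "pth \<delta> = tail e" using pth_last by blast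
      have "\<epsilon> \<in> path_edges (tail e)" using \<delta>(2) e(2) by simp
      then obtain \<gamma> where \<gamma>: "\<gamma> \<in> path_edges (drop (lQ e - 2) (P e))" "\<epsilon> = f ` \<gamma>"
        unfolding tail_def path_edges_map by auto
      obtain i where "Suc i < length (drop (lQ e - 2) (P e))"
        "\<gamma> = {drop (lQ e - 2) (P e) ! i, drop (lQ e - 2) (P e) ! Suc i}"
        using \<gamma>(1) unfolding path_edges_def by blast
      then have i: "Suc i < lP e - (lQ e - 2)"
        "\<epsilon> = f ` {drop (lQ e - 2) (P e) ! i, drop (lQ e - 2) (P e) ! Suc i}"
        using \<gamma>(2) by (simp_all add: lenP)
      then have \<epsilon>: "\<epsilon> = f ` {P e ! (lQ e - 2 + i), P e ! Suc (lQ e - 2 + i)}" "Suc (lQ e - 2 + i) < lP e"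
        by (auto simp: lenP)
      have "{P e ! (lQ e - 2 + i), P e ! Suc (lQ e - 2 + i)} \<in> edges G"
        unfolding A.edges_eq path_edges_def lenP using e(1) \<epsilon>(2) by blast
      then have "\<epsilon> \<in> (`) f ` edges G" unfolding \<epsilon>(1) by (rule imageI)
      then show ?thesis unfolding G'_def by simp
    next
      case False
      then obtain a b where ab: "pth \<delta> = [a, b]" "\<delta> = {a, b}" using pth_other[OF \<delta>(1)] by blast
      then have \<epsilon>: "\<epsilon> = \<delta>" using \<delta>(2) pe_two by simp
      obtain e k where ek: "e \<in> edges R" "Suc k < lQ e" "\<delta> = {Q (g ` e) ! k, Q (g ` e) ! Suc k}"
        using edgesH[OF \<delta>(1)] by blast
      have "Suc k \<noteq> lQ e - 1"
      proof
        assume "Suc k = lQ e - 1"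
        then have "k = lQ e - 2" using ek(2) by linarith
        then show False using False ek lastE(1)[OF ek(1)] by blast
      qed
      then have "Suc (Suc k) < lQ e" using ek(2) by linarith
      then have "\<epsilon> = f ` {P e ! k, P e ! Suc k}" using \<epsilon> ek f_low[OF ek(1)] by simp
      moreover have "Suc k < lP e" using ek(2) lens(2)[OF ek(1)] by linarith
      then have "{P e ! k, P e ! Suc k} \<in> edges G"
        unfolding A.edges_eq path_edges_def lenP using ek(1) by blast
      ultimately have "\<epsilon> \<in> (`) f ` edges G" by (metis imageI)
      then show ?thesis unfolding G'_def by simp
    qed
  qed
  have c5: "\<forall>v\<in>verts H. weight G' v = weight H v"
  proof
    fix v assume v: "v \<in> verts H"
    show "weight G' v = weight H v"
    proof (cases "v \<in> verts S")
      case True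
      then obtain x where x: "x \<in> verts R" "v = g x" using g(1) unfolding bij_betw_def by blast
      then have "weight G' v = weight G x" using wG' f_old A.verts_eq by (metis UnI1)
      also have "\<dots> = weight R x" using A.weight_old x(1) .
      also have "\<dots> = weight H v" using g(3)[OF x(1)] B.weight_old[OF True] x(2) by simp
      finally show ?thesis .
    next
      case False
      then obtain d where d: "d \<in> edges S" "v \<in> internal_verts (Q d)" using v B.verts_eq by blast
      then obtain e where e: "e \<in> edges R" "d = g ` e" using g(2) by blast
      obtain j where j: "v = Q (g ` e) ! j" "0 < j" "Suc j < lQ e"
        using d e B.internal[OF gE[OF e(1)]] unfolding lenP by blast
      have j': "Suc j < lP e" using j(3) lens(2)[OF e(1)] by linarith
      have x: "P e ! j \<in> verts G" "P e ! j \<notin> verts R"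
        using A.verts_eq A.internal[OF e(1)] e(1) j(2) j' A.inner_out[OF e(1)] unfolding lenP by blast+
      have "weight G' v = 1" using wG'[OF x(1)] f_pos[OF e(1) j(2,3)] j(1) A.weight_new[OF x] by simp
      then show ?thesis using B.weight_new[OF v False] by simp
    qed
  qed
  have c6: "\<forall>v\<in>verts G' - verts H. weight G' v = 1"
  proof
    fix v assume v: "v \<in> verts G' - verts H"
    then obtain x where x: "x \<in> verts G" "v = f x" unfolding G'_def by auto
    have "x \<notin> verts R"
    proof
      assume "x \<in> verts R"
      then have "v \<in> verts S" using gS[of x] f_old[of x] x(2) by simp
      then show False using v SH by blast
    qed
    then show "weight G' v = 1" using wG'[OF x(1)] x(2) A.weight_new[OF x(1)] by simp
  qed
  have "uos_via pth G' H" unfolding uos_via_def using c1 c2 c3 c4 c5 c6 by blast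
  then show ?thesis using iso unit_odd_subdivision_iff by blast
qed

section \<open>Finite bases\<close>

definition degree :: "'v wgraph \<Rightarrow> 'v \<Rightarrow> nat" where
  "degree G v = card {e \<in> edges G. v \<in> e}"

definition core :: "'v wgraph \<Rightarrow> 'v set" where
  "core G = {v \<in> verts G. \<not> (weight G v = 1 \<and> degree G v = 2)}"

text \<open>The properties that are preserved by contraction. Connectedness prevents an unbounded
  number of short cycles, which could not be contracted any further.\<close>

definition bounded_core :: "nat \<Rightarrow> nat \<Rightarrow> nat \<Rightarrow> 'v wgraph \<Rightarrow> bool" where
  "bounded_core K D A G \<longleftrightarrow> finite (verts G) \<and> verts G \<noteq> {} \<and>
     (\<forall>e\<in>edges G. e \<subseteq> verts G \<and> card e = 2) \<and>
     (\<forall>U. U \<subseteq> verts G \<longrightarrow> U \<noteq> {} \<longrightarrow> (\<forall>u v. u \<in> U \<longrightarrow> {u, v} \<in> edges G \<longrightarrow> v \<in> U) \<longrightarrow> U = verts G) \<and>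
     card (core G) \<le> K \<and> (\<forall>v\<in>verts G. degree G v \<le> D) \<and>
     (\<forall>v\<in>verts G. 0 \<le> weight G v \<and> weight G v \<le> int A)"

lemma card_exchange:
  assumes "finite S" "a \<in> S" "b \<notin> S"
  shows "card (insert b (S - {a})) = card S"
proof -
  have "card (insert b (S - {a})) = Suc (card (S - {a}))" using assms by simp
  then show ?thesis using card_Suc_Diff1[OF assms(1,2)] by simp
qed

locale core_graph =
  fixes K D A :: nat and G :: "'v wgraph"
  assumes bc: "bounded_core K D A G"
begin

lemma fin: "finite (verts G)" and ne: "verts G \<noteq> {}"
  and edge: "e \<in> edges G \<Longrightarrow> e \<subseteq> verts G \<and> card e = 2"
  and core_le: "card (core G) \<le> K" and degree_le: "v \<in> verts G \<Longrightarrow> degree G v \<le> D"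
  and weight_le: "v \<in> verts G \<Longrightarrow> 0 \<le> weight G v \<and> weight G v \<le> int A"
  using bc unfolding bounded_core_def by auto

lemma connected: "U \<subseteq> verts G \<Longrightarrow> U \<noteq> {} \<Longrightarrow> (\<And>u v. u \<in> U \<Longrightarrow> {u, v} \<in> edges G \<Longrightarrow> v \<in> U) \<Longrightarrow> U = verts G"
  using bc unfolding bounded_core_def by meson

lemma finE: "finite (edges G)"
  by (rule finite_subset[of _ "Pow (verts G)"]) (use fin edge in auto)

definition "nb v = {w. {v, w} \<in> edges G}"

lemma edge_neq: "{v, w} \<in> edges G \<Longrightarrow> v \<noteq> w"
  using edge by fastforce

lemma edge_in: "{v, w} \<in> edges G \<Longrightarrow> v \<in> verts G \<and> w \<in> verts G"
  using edge by blast

lemma nb_sym: "w \<in> nb v \<longleftrightarrow> v \<in> nb w"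
  unfolding nb_def by (simp add: insert_commute)

lemma card_nb: "card (nb v) = degree G v"
proof -
  have "{e \<in> edges G. v \<in> e} = (\<lambda>w. {v, w}) ` nb v"
  proof (intro equalityI subsetI)
    fix e assume e: "e \<in> {e \<in> edges G. v \<in> e}"
    then obtain a b where ab: "e = {a, b}" using edge by (metis (no_types, lifting) card_2_iff mem_Collect_eq)
    then have "e = {v, a} \<or> e = {v, b}" using e by auto
    then show "e \<in> (\<lambda>w. {v, w}) ` nb v" using e unfolding nb_def by auto
  qed (auto simp: nb_def)
  moreover have "inj_on (\<lambda>w. {v, w}) (nb v)" by (auto simp: inj_on_def doubleton_eq_iff)
  ultimately show ?thesis unfolding degree_def by (simp add: card_image)
qed

text \<open>The bound counts the vertices at distance at most 2 from the core, with 4 to spare. For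
  p farther away, its neighbours and their neighbours are outside the core and have degree 2. A loop
  or a parallel edge after contraction would mean that p lies in a component of at most four
  vertices, against connectedness.\<close>

lemma exists_contractible:
  assumes big: "4 + K + K * D + K * D * D < card (verts G)"
  shows "\<exists>x p q y. nb p = {x, q} \<and> nb q = {p, y} \<and> x \<noteq> q \<and> y \<noteq> p \<and> x \<noteq> y \<and> {x, y} \<notin> edges G \<and>
    p \<notin> core G \<and> q \<notin> core G"
proof -
  define N1 where "N1 = (\<Union>v\<in>core G. nb v)"
  define N2 where "N2 = (\<Union>v\<in>N1. nb v)"
  have sub: "core G \<subseteq> verts G" "N1 \<subseteq> verts G" "N2 \<subseteq> verts G"
    unfolding core_def N1_def N2_def nb_def using edge_in by auto
  have finC: "finite (core G)" "finite N1" using sub fin finite_subset by blast+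
  have nbD: "card (nb v) \<le> D" if "v \<in> verts G" for v unfolding card_nb using degree_le that .
  have "card N1 \<le> (\<Sum>v\<in>core G. card (nb v))" unfolding N1_def using finC by (intro card_UN_le) auto
  also have "\<dots> \<le> (\<Sum>v\<in>core G. D)" using nbD sub by (intro sum_mono) auto
  also have "\<dots> \<le> K * D" using core_le by simp
  finally have c1: "card N1 \<le> K * D" .
  have "card N2 \<le> (\<Sum>v\<in>N1. card (nb v))" unfolding N2_def using finC by (intro card_UN_le) auto
  also have "\<dots> \<le> (\<Sum>v\<in>N1. D)" using nbD sub by (intro sum_mono) auto
  also have "\<dots> \<le> K * D * D" using c1 by simp
  finally have c2: "card N2 \<le> K * D * D" .
  have "card (core G \<union> N1 \<union> N2) \<le> card (core G) + card N1 + card N2"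
    using card_Un_le[of "core G \<union> N1" N2] card_Un_le[of "core G" N1] by linarith
  then have "card (core G \<union> N1 \<union> N2) < card (verts G)" using c1 c2 core_le big by linarith
  then have "\<not> verts G \<subseteq> core G \<union> N1 \<union> N2"
    using sub fin by (metis card_mono finite_UnI finite_subset not_le)
  then obtain p where p: "p \<in> verts G" "p \<notin> core G" "p \<notin> N1" "p \<notin> N2" by blast
  have two: "card (nb v) = 2" if "v \<in> verts G" "v \<notin> core G" for v
    using that unfolding card_nb core_def by auto
  have nbV: "w \<in> verts G" if "w \<in> nb v" for v w using that edge_in unfolding nb_def by blast
  have far: "w \<notin> core G" if "w \<in> nb p" for w
    using that p(3) nb_sym unfolding N1_def by blast
  have far2: "z \<notin> core G" if "w \<in> nb p" "z \<in> nb w" for w z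
    using that p(4) nb_sym unfolding N1_def N2_def by blast
  obtain x q where xq: "nb p = {x, q}" "x \<noteq> q" using two[OF p(1,2)] by (meson card_2_iff)
  have q: "q \<in> verts G" "q \<notin> core G" "p \<in> nb q" using nbV[of q p] far[of q] xq nb_sym[of p q] by auto
  have x: "x \<in> verts G" "x \<notin> core G" "p \<in> nb x" using nbV[of x p] far[of x] xq nb_sym[of p x] by auto
  have other: "\<exists>z. nb v = {w, z} \<and> z \<noteq> w" if c: "card (nb v) = 2" and w: "w \<in> nb v" for v w
  proof -
    obtain a b where ab: "nb v = {a, b}" "a \<noteq> b" using c by (meson card_2_iff)
    then consider "w = a" | "w = b" using w by blast
    then show ?thesis
    proof cases
      case 1
      then show ?thesis using ab by blast
    next
      case 2
      then have "nb v = {w, a} \<and> a \<noteq> w" using ab by blast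
      then show ?thesis by blast
    qed
  qed
  obtain y where y: "nb q = {p, y}" "y \<noteq> p" using other[OF two[OF q(1,2)] q(3)] by blast
  obtain w where w: "nb x = {p, w}" "w \<noteq> p" using other[OF two[OF x(1,2)] x(3)] by blast
  have closed: "card (verts G) \<le> card U" if "U \<subseteq> verts G" "U \<noteq> {}" "\<And>u. u \<in> U \<Longrightarrow> nb u \<subseteq> U" for U
    using connected[OF that(1,2)] that(3) unfolding nb_def by blast
  have neq: "p \<noteq> q" using q(3) edge_neq unfolding nb_def by blast
  have "x \<noteq> y"
  proof
    assume xy: "x = y"
    have "q \<in> nb x" using y xy nb_sym[of q x] by auto
    then have "w = q" using w neq by auto
    then have "card (verts G) \<le> card {x, p, q}"
      using xq y w xy q(1) x(1) p(1) by (intro closed) auto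
    also have "\<dots> \<le> 4" by (simp add: card_insert_if)
    finally show False using big by simp
  qed
  moreover have "{x, y} \<notin> edges G"
  proof
    assume "{x, y} \<in> edges G"
    then have xy: "y \<in> nb x" "x \<in> nb y" unfolding nb_def by (auto simp: insert_commute)
    have yV: "y \<in> verts G" using nbV[of y q] y by auto
    have "w = y" using xy(1) w y(2) by auto
    have "q \<in> nb y" using y nb_sym[of q y] by auto
    have "y \<notin> core G" using far2[of q y] xq y by auto
    from other[OF two[OF yV this] \<open>q \<in> nb y\<close>] have "nb y = {q, x}" using xy(2) xq(2) by auto
    then have "card (verts G) \<le> card {x, p, q, y}"
      using xq y w \<open>w = y\<close> q(1) x(1) p(1) yV by (intro closed) auto
    also have "\<dots> \<le> 4" by (simp add: card_insert_if)
    finally show False using big by simp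
  qed
  ultimately show ?thesis using xq y p(2) q(2) by blast
qed

text \<open>At x and at y one edge is exchanged for another, because x y is not an edge yet. So the
  degrees of all remaining vertices stay the same and the core does not grow.\<close>

lemma contract:
  assumes p: "nb p = {x, q}" and q: "nb q = {p, y}" and neq: "x \<noteq> q" "y \<noteq> p" "x \<noteq> y" "{x, y} \<notin> edges G"
    and new: "p \<notin> core G" "q \<notin> core G"
  defines "G1 \<equiv> \<lparr>verts = verts G - {p, q}, edges = insert {x, y} (edges G - {{x, p}, {p, q}, {q, y}}), weight = weight G\<rparr>"
  shows "bounded_core K D A G1"
    and "p \<in> verts G" "q \<in> verts G" "p \<noteq> q" "x \<in> verts G1" "y \<in> verts G1"
    and "edges G = insert {x, p} (insert {p, q} (insert {q, y} (edges G1 - {{x, y}})))"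
    and "weight G p = 1" "weight G q = 1"
proof -
  have ed: "{x, p} \<in> edges G" "{p, q} \<in> edges G" "{q, y} \<in> edges G"
  proof -
    have "x \<in> nb p" "q \<in> nb p" "y \<in> nb q" using p q by auto
    then show "{x, p} \<in> edges G" "{p, q} \<in> edges G" "{q, y} \<in> edges G"
      unfolding nb_def by (auto simp: insert_commute)
  qed
  have V: "x \<in> verts G" "p \<in> verts G" "q \<in> verts G" "y \<in> verts G" using edge_in ed by blast+
  have ne2: "x \<noteq> p" "p \<noteq> q" "q \<noteq> y" using edge_neq ed by blast+
  show "p \<in> verts G" "q \<in> verts G" "p \<noteq> q" using V ne2 by auto
  show xy1: "x \<in> verts G1" "y \<in> verts G1" unfolding G1_def using V ne2 neq by auto
  show "edges G = insert {x, p} (insert {p, q} (insert {q, y} (edges G1 - {{x, y}})))"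
    unfolding G1_def using ed neq(4) by auto
  show "weight G p = 1" "weight G q = 1" using V new unfolding core_def by auto
  have at_p: "e = {x, p} \<or> e = {p, q}" if e: "e \<in> edges G" "p \<in> e" for e
  proof -
    obtain a b where "e = {a, b}" using edge[OF e(1)] by (meson card_2_iff)
    then obtain w where w: "e = {p, w}" using e(2) by auto
    then have "w \<in> nb p" using e(1) unfolding nb_def by simp
    then show ?thesis using p w by auto
  qed
  have at_q: "e = {p, q} \<or> e = {q, y}" if e: "e \<in> edges G" "q \<in> e" for e
  proof -
    obtain a b where "e = {a, b}" using edge[OF e(1)] by (meson card_2_iff)
    then obtain w where w: "e = {q, w}" using e(2) by auto
    then have "w \<in> nb q" using e(1) unfolding nb_def by simp
    then show ?thesis using q w by auto
  qed
  have edge1: "e \<subseteq> verts G1 \<and> card e = 2" if e: "e \<in> edges G1" for e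
  proof (cases "e = {x, y}")
    case True
    then show ?thesis using xy1 neq(3) by auto
  next
    case False
    then have e': "e \<in> edges G" "e \<noteq> {x, p}" "e \<noteq> {p, q}" "e \<noteq> {q, y}" using e unfolding G1_def by auto
    then have "p \<notin> e" "q \<notin> e" using at_p at_q by blast+
    then show ?thesis using edge[OF e'(1)] unfolding G1_def by auto
  qed
  have deg: "degree G1 v = degree G v" if v: "v \<in> verts G1" for v
  proof -
    have vpq: "v \<noteq> p" "v \<noteq> q" using v unfolding G1_def by auto
    consider "v = x" | "v = y" | "v \<noteq> x" "v \<noteq> y" by blast
    then show ?thesis
    proof cases
      case 1
      have eq: "{e \<in> edges G1. v \<in> e} = insert {x, y} ({e \<in> edges G. v \<in> e} - {{x, p}})"
        unfolding G1_def using 1 neq ne2 by auto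
      have "{x, y} \<notin> {e \<in> edges G. v \<in> e}" using neq(4) by blast
      moreover have "{x, p} \<in> {e \<in> edges G. v \<in> e}" using ed 1 by simp
      moreover have "finite {e \<in> edges G. v \<in> e}" using finE by simp
      ultimately show ?thesis unfolding degree_def eq by (intro card_exchange)
    next
      case 2
      have eq: "{e \<in> edges G1. v \<in> e} = insert {x, y} ({e \<in> edges G. v \<in> e} - {{q, y}})"
        unfolding G1_def using 2 neq ne2 by auto
      have "{x, y} \<notin> {e \<in> edges G. v \<in> e}" using neq(4) by blast
      moreover have "{q, y} \<in> {e \<in> edges G. v \<in> e}" using ed 2 by simp
      moreover have "finite {e \<in> edges G. v \<in> e}" using finE by simp
      ultimately show ?thesis unfolding degree_def eq by (intro card_exchange)
    next
      case 3
      then have "{e \<in> edges G1. v \<in> e} = {e \<in> edges G. v \<in> e}"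
        unfolding G1_def using vpq by auto
      then show ?thesis unfolding degree_def by simp
    qed
  qed
  have "core G1 \<subseteq> core G"
    using deg unfolding core_def by (auto simp: G1_def)
  moreover have "finite (core G)" unfolding core_def using fin by simp
  ultimately have core1: "card (core G1) \<le> K" using card_mono core_le le_trans by blast
  have conn: "U = verts G1" if U: "U \<subseteq> verts G1" "U \<noteq> {}" and cl: "\<And>u v. u \<in> U \<Longrightarrow> {u, v} \<in> edges G1 \<Longrightarrow> v \<in> U" for U
  proof -
    have xyU: "x \<in> U \<longleftrightarrow> y \<in> U"
      using cl[of x y] cl[of y x] unfolding G1_def by (auto simp: insert_commute)
    have pqU: "p \<notin> U" "q \<notin> U" using U(1) unfolding G1_def by auto
    \<comment> \<open>The new edge puts both or neither of x and y into U, and p and q have to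
      follow them.\<close>
    define U' where "U' = (if x \<in> U then U \<union> {p, q} else U)"
    have "U' = verts G"
    proof (rule connected)
      show "U' \<subseteq> verts G" using U(1) V unfolding U'_def G1_def by auto
      show "U' \<noteq> {}" using U(2) unfolding U'_def by auto
      fix u v assume u: "u \<in> U'" and uv: "{u, v} \<in> edges G"
      show "v \<in> U'"
      proof (cases "u = p \<or> u = q \<or> v = p \<or> v = q")
        case False
        then have "{u, v} \<in> edges G1" unfolding G1_def using uv by (auto simp: doubleton_eq_iff)
        then show ?thesis using u False cl[of u v] unfolding U'_def by (auto split: if_splits)
      next
        case True
        then have "{u, v} = {x, p} \<or> {u, v} = {p, q} \<or> {u, v} = {q, y}"
          using at_p[OF uv] at_q[OF uv] by blast
        then show ?thesis
          using u pqU xyU unfolding U'_def by (auto simp: doubleton_eq_iff split: if_splits)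
      qed
    qed
    then show ?thesis using U(1) pqU unfolding U'_def G1_def by (auto split: if_splits)
  qed
  show "bounded_core K D A G1"
    unfolding bounded_core_def
  proof (intro conjI ballI allI impI)
    show "finite (verts G1)" unfolding G1_def using fin by simp
    show "verts G1 \<noteq> {}" using xy1 by blast
    show "U = verts G1" if "U \<subseteq> verts G1" "U \<noteq> {}" "\<forall>u v. u \<in> U \<longrightarrow> {u, v} \<in> edges G1 \<longrightarrow> v \<in> U" for U
      using conn[OF that(1,2)] that(3) by blast
    show "degree G1 v \<le> D" if "v \<in> verts G1" for v
      unfolding deg[OF that] using degree_le that unfolding G1_def by simp
    show "0 \<le> weight G1 v" "weight G1 v \<le> int A" if "v \<in> verts G1" for v
      using weight_le that unfolding G1_def by auto
  qed (use edge1 core1 in auto)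
qed

end

text \<open>Undoes a contraction: the edge x y occurs on exactly one path and at one place, and
  inserting two vertices there preserves parity.\<close>

lemma uos_insert:
  assumes sd: "subdivided P G1 R" and xy: "{x, y} \<in> edges G1" "x \<noteq> y"
    and pq: "p \<notin> verts G1" "q \<notin> verts G1" "p \<noteq> q"
    and V: "verts G = insert p (insert q (verts G1))"
    and E: "edges G = insert {x, p} (insert {p, q} (insert {q, y} (edges G1 - {{x, y}})))"
    and W: "\<And>v. v \<in> verts G1 \<Longrightarrow> weight G v = weight G1 v" "weight G p = 1" "weight G q = 1"
  shows "\<exists>P'. uos_via P' G R"
proof -
  interpret A: subdivided P G1 R by (rule sd)
  obtain e k where ek: "e \<in> edges R" "Suc k < length (P e)" "{x, y} = {P e ! k, P e ! Suc k}"
    using xy(1) unfolding A.edges_eq path_edges_def by blast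
  define a b where "a = P e ! k" and "b = P e ! Suc k"
  define l1 l2 where "l1 = take k (P e)" and "l2 = drop (Suc (Suc k)) (P e)"
  have Pe: "P e = l1 @ a # b # l2"
    unfolding l1_def l2_def a_def b_def using ek(2)
    by (metis Cons_nth_drop_Suc Suc_lessD append_take_drop_id)
  \<comment> \<open>The path may run through the edge from y to x; then q has to come before
    p.\<close>
  define p' q' where "p' = (if a = x then p else q)" and "q' = (if a = x then q else p)"
  define L where "L = l1 @ a # p' # q' # b # l2"
  define P' where "P' = P(e := L)"
  have ab: "{a, b} = {x, y}" using ek(3) unfolding a_def b_def by simp
  have ab': "(a = x \<and> b = y) \<or> (a = y \<and> b = x)" using ab by (auto simp: doubleton_eq_iff)
  have pq': "{p', q'} = {p, q}" "p' \<noteq> q'" unfolding p'_def q'_def using pq(3) by auto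
  have setP: "set (P d) \<subseteq> verts G1" if "d \<in> edges R" for d
  proof -
    have "set (P d) \<subseteq> internal_verts (P d) \<union> d" using A.path(4)[OF that] unfolding internal_verts_def by blast
    then show ?thesis using A.verts_eq A.edges_in[OF that] that by blast
  qed
  have pq_out: "p' \<notin> set (P e)" "q' \<notin> set (P e)" using setP[OF ek(1)] pq unfolding p'_def q'_def by auto
  have hdL: "hd L = hd (P e)" "last L = last (P e)" unfolding L_def Pe by (cases l1; simp)+
  have setL: "set L = insert p' (insert q' (set (P e)))" unfolding L_def Pe by auto
  have "hd (P e) \<in> set (P e)" "last (P e) \<in> set (P e)" using A.path(1)[OF ek(1)] by auto
  then have "p' \<noteq> hd (P e)" "q' \<noteq> hd (P e)" "p' \<noteq> last (P e)" "q' \<noteq> last (P e)"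
    using pq_out by metis+
  then have intL: "internal_verts L = internal_verts (P e) \<union> {p, q}"
    unfolding internal_verts_def setL hdL pq'(1)[symmetric] by blast
  have distP: "distinct (l1 @ a # b # l2)" using A.path(2)[OF ek(1)] Pe by simp
  have distL: "distinct L"
    using distP pq_out pq'(2) unfolding L_def Pe by auto
  have evenL: "even (length L)" using A.path(3)[OF ek(1)] unfolding L_def Pe by simp
  have peP: "path_edges (P e) = insert {x, y} (path_edges (l1 @ [a]) \<union> path_edges (b # l2))"
    unfolding Pe path_edges_append[of l1 a "b # l2"] path_edges_Cons ab by auto
  have peL: "path_edges L = {{x, p}, {p, q}, {q, y}} \<union> (path_edges (l1 @ [a]) \<union> path_edges (b # l2))"
  proof -
    have "path_edges L = path_edges (l1 @ [a]) \<union> ({{a, p'}, {p', q'}, {q', b}} \<union> path_edges (b # l2))"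
      unfolding L_def path_edges_append[of l1 a "p' # q' # b # l2"] by (simp add: path_edges_Cons)
    moreover have "{{a, p'}, {p', q'}, {q', b}} = {{x, p}, {p, q}, {q, y}}"
      using ab' xy(2) unfolding p'_def q'_def by (auto simp: insert_commute)
    ultimately show ?thesis by auto
  qed
  have not_rest: "{x, y} \<notin> path_edges (l1 @ [a]) \<union> path_edges (b # l2)"
  proof
    assume "{x, y} \<in> path_edges (l1 @ [a]) \<union> path_edges (b # l2)"
    then have "{a, b} \<subseteq> set (l1 @ [a]) \<or> {a, b} \<subseteq> set (b # l2)" unfolding ab using path_edges_sub by blast
    then show False using distP by auto
  qed
  have not_other: "{x, y} \<notin> path_edges (P d)" if d: "d \<in> edges R" "d \<noteq> e" for d
  proof
    assume "{x, y} \<in> path_edges (P d)"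
    then obtain k' where "Suc k' < length (P d)" "{x, y} = {P d ! k', P d ! Suc k'}" unfolding path_edges_def by blast
    then show False using A.edge_unique[OF ek(1) d(1) ek(2)] ek(3) d(2) by metis
  qed
  have int_other: "internal_verts (P d) \<subseteq> verts G1" if "d \<in> edges R" for d
    using A.verts_eq that by blast
  have "uos_via P' G R"
    unfolding uos_via_def
  proof (intro conjI)
    show "\<forall>d\<in>edges R. P' d \<noteq> [] \<and> distinct (P' d) \<and> even (length (P' d)) \<and>
      {hd (P' d), last (P' d)} = d \<and> internal_verts (P' d) \<inter> verts R = {}"
    proof
      fix d assume d: "d \<in> edges R"
      show "P' d \<noteq> [] \<and> distinct (P' d) \<and> even (length (P' d)) \<and>
        {hd (P' d), last (P' d)} = d \<and> internal_verts (P' d) \<inter> verts R = {}"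
      proof (cases "d = e")
        case True
        have "internal_verts L \<inter> verts R = {}"
          unfolding intL using A.internal_out[OF ek(1)] pq(1,2) A.verts_eq by blast
        moreover have "L \<noteq> []" unfolding L_def by simp
        moreover have "{hd L, last L} = e" unfolding hdL using A.path(4)[OF ek(1)] .
        moreover have "P' d = L" unfolding P'_def True by simp
        ultimately show ?thesis using distL evenL True by simp
      next
        case False
        then have "P' d = P d" unfolding P'_def by simp
        then show ?thesis using A.path[OF d] by simp
      qed
    qed
    have disj: "internal_verts (P' e) \<inter> internal_verts (P' d) = {}" if d: "d \<in> edges R" "d \<noteq> e" for d
    proof -
      have "P' e = L" "P' d = P d" unfolding P'_def using d by auto
      moreover have "internal_verts (P e) \<inter> internal_verts (P d) = {}"
        using A.internal_disj[OF ek(1) d(1)] d(2) by blast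
      moreover have "{p, q} \<inter> internal_verts (P d) = {}" using int_other[OF d(1)] pq(1,2) by blast
      ultimately show ?thesis by (simp add: intL Int_Un_distrib2)
    qed
    show "\<forall>d\<in>edges R. \<forall>d'\<in>edges R. d \<noteq> d' \<longrightarrow> internal_verts (P' d) \<inter> internal_verts (P' d') = {}"
    proof (intro ballI impI)
      fix d d' assume d: "d \<in> edges R" "d' \<in> edges R" "d \<noteq> d'"
      show "internal_verts (P' d) \<inter> internal_verts (P' d') = {}"
      proof (cases "d = e \<or> d' = e")
        case True
        then show ?thesis using disj d by (metis Int_commute)
      next
        case False
        then have "P' d = P d" "P' d' = P d'" unfolding P'_def by auto
        then show ?thesis using A.internal_disj d by simp
      qed
    qed
    have "(\<Union>d\<in>edges R. internal_verts (P' d)) = (\<Union>d\<in>edges R. internal_verts (P d)) \<union> {p, q}"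
      unfolding P'_def using ek(1) intL by (auto split: if_splits)
    then show "verts G = verts R \<union> (\<Union>d\<in>edges R. internal_verts (P' d))"
      unfolding V A.verts_eq by auto
    have "(\<Union>d\<in>edges R. path_edges (P' d)) = path_edges L \<union> (\<Union>d\<in>edges R - {e}. path_edges (P d))"
      unfolding P'_def using ek(1) by (auto split: if_splits)
    moreover have "edges G1 - {{x, y}} = (path_edges (l1 @ [a]) \<union> path_edges (b # l2)) \<union> (\<Union>d\<in>edges R - {e}. path_edges (P d))"
    proof -
      have eq: "edges G1 = path_edges (P e) \<union> (\<Union>d\<in>edges R - {e}. path_edges (P d))"
        unfolding A.edges_eq using ek(1) by blast
      have nb: "{x, y} \<notin> (\<Union>d\<in>edges R - {e}. path_edges (P d))" using not_other by blast
      have "insert z M \<union> M' - {z} = M \<union> M'" if "z \<notin> M" "z \<notin> M'" for z and M M' :: "'a set set"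
        using that by blast
      from this[OF not_rest nb] show ?thesis unfolding eq peP .
    qed
    ultimately show "edges G = (\<Union>d\<in>edges R. path_edges (P' d))"
      unfolding E peL by auto
    show "\<forall>v\<in>verts R. weight G v = weight R v" using W(1) A.weight_old A.verts_eq by auto
    show "\<forall>v\<in>verts G - verts R. weight G v = 1"
      using W A.weight_new unfolding V by auto
  qed
  then show ?thesis by blast
qed

lemma uos_refl:
  assumes "\<And>e. e \<in> edges G \<Longrightarrow> e \<subseteq> verts G \<and> card e = 2"
  shows "\<exists>P. uos_via P G G"
proof -
  have "\<forall>e\<in>edges G. \<exists>l. \<exists>a b. l = [a, b] \<and> e = {a, b} \<and> a \<noteq> b"
    using assms by (meson card_2_iff)
  from bchoice[OF this] obtain P where P: "\<forall>e\<in>edges G. \<exists>a b. P e = [a, b] \<and> e = {a, b} \<and> a \<noteq> b"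
    by blast
  have i: "internal_verts (P e) = {}" "path_edges (P e) = {e}"
    "P e \<noteq> [] \<and> distinct (P e) \<and> even (length (P e)) \<and> {hd (P e), last (P e)} = e" if e: "e \<in> edges G" for e
  proof -
    obtain a b where "P e = [a, b]" "e = {a, b}" "a \<noteq> b" using bspec[OF P e] by blast
    then show "internal_verts (P e) = {}" "path_edges (P e) = {e}"
      "P e \<noteq> [] \<and> distinct (P e) \<and> even (length (P e)) \<and> {hd (P e), last (P e)} = e"
      unfolding internal_verts_def by (auto simp: path_edges_Cons)
  qed
  have "uos_via P G G" unfolding uos_via_def using i by simp
  then show ?thesis by blast
qed

lemma bounded_core_reduce:
  assumes "bounded_core K D A G"
  shows "\<exists>R P. subdivided P G R \<and> bounded_core K D A R \<and> card (verts R) \<le> 4 + K + K * D + K * D * D"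
  using assms
proof (induction "card (verts G)" arbitrary: G rule: less_induct)
  case less
  interpret core_graph K D A G using less.prems by unfold_locales
  show ?case
  proof (cases "card (verts G) \<le> 4 + K + K * D + K * D * D")
    case True
    obtain P where "uos_via P G G" using uos_refl[of G] edge by blast
    then have "subdivided P G G" using edge by unfold_locales blast+
    then show ?thesis using less.prems True by blast
  next
    case False
    then obtain x p q y where c: "nb p = {x, q}" "nb q = {p, y}" "x \<noteq> q" "y \<noteq> p" "x \<noteq> y" "{x, y} \<notin> edges G"
      "p \<notin> core G" "q \<notin> core G"
      using exists_contractible by force
    define G1 where "G1 = \<lparr>verts = verts G - {p, q}, edges = insert {x, y} (edges G - {{x, p}, {p, q}, {q, y}}), weight = weight G\<rparr>"
    note C = contract[OF c, folded G1_def]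
    have "card (verts G1) < card (verts G)"
      unfolding G1_def using C(2) fin by (intro psubset_card_mono) auto
    from less.hyps[OF this C(1)] obtain R P where R: "subdivided P G1 R" "bounded_core K D A R"
      "card (verts R) \<le> 4 + K + K * D + K * D * D" by blast
    have "\<exists>P'. uos_via P' G R"
    proof (rule uos_insert[OF R(1)])
      show "{x, y} \<in> edges G1" unfolding G1_def by simp
      show "edges G = insert {x, p} (insert {p, q} (insert {q, y} (edges G1 - {{x, y}})))" by (rule C(7))
      show "verts G = insert p (insert q (verts G1))" unfolding G1_def using C(2,3) by auto
      show "weight G v = weight G1 v" for v unfolding G1_def by simp
      show "x \<noteq> y" by (rule c(5))
      show "p \<notin> verts G1" "q \<notin> verts G1" unfolding G1_def by auto
      show "p \<noteq> q" "weight G p = 1" "weight G q = 1" by (rule C)+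
    qed
    then obtain P' where "uos_via P' G R" by blast
    moreover have "e \<subseteq> verts R" if "e \<in> edges R" for e using R(2) that unfolding bounded_core_def by blast
    ultimately have "subdivided P' G R" by unfold_locales blast+
    then show ?thesis using R by blast
  qed
qed

text \<open>Dickson's lemma. \<open>F0\<close> serves the coordinates in I alone. An element whose
  new coordinate is at least N exceeds every member of \<open>F0\<close> there as well; each of the
  finitely many smaller values gets a finite set of its own by induction.\<close>

lemma finite_minimal_elements:
  fixes len :: "'s \<Rightarrow> 'e \<Rightarrow> nat"
  assumes "finite I"
  shows "\<exists>F\<subseteq>S. finite F \<and> (\<forall>s\<in>S. \<exists>t\<in>F. \<forall>e\<in>I. len t e \<le> len s e)"
  using assms
proof (induction I arbitrary: S rule: finite_induct)
  case empty
  show ?case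
  proof (cases "S = {}")
    case False
    then obtain s where "s \<in> S" by blast
    then show ?thesis by (intro exI[of _ "{s}"]) auto
  qed auto
next
  case (insert i I)
  obtain F0 where F0: "F0 \<subseteq> S" "finite F0" "\<And>s. s \<in> S \<Longrightarrow> \<exists>t\<in>F0. \<forall>e\<in>I. len t e \<le> len s e"
    using insert.IH[of S] by blast
  have "\<forall>n. \<exists>F\<subseteq>{s \<in> S. len s i = n}. finite F \<and> (\<forall>s\<in>{s \<in> S. len s i = n}. \<exists>t\<in>F. \<forall>e\<in>I. len t e \<le> len s e)"
    using insert.IH by blast
  from choice[OF this] obtain Fn where *: "\<forall>n. Fn n \<subseteq> {s \<in> S. len s i = n} \<and> finite (Fn n) \<and>
      (\<forall>s\<in>{s \<in> S. len s i = n}. \<exists>t\<in>Fn n. \<forall>e\<in>I. len t e \<le> len s e)" by blast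
  have Fn: "\<And>n. Fn n \<subseteq> {s \<in> S. len s i = n}" "\<And>n. finite (Fn n)"
    "\<And>n s. s \<in> S \<Longrightarrow> len s i = n \<Longrightarrow> \<exists>t\<in>Fn n. \<forall>e\<in>I. len t e \<le> len s e"
    using * by blast+
  obtain N where N: "\<And>t. t \<in> F0 \<Longrightarrow> len t i < N"
  proof -
    have "finite ((\<lambda>t. len t i) ` F0)" using F0(2) by simp
    then obtain N where "\<forall>k\<in>(\<lambda>t. len t i) ` F0. k < N" using finite_nat_set_iff_bounded by blast
    then show thesis using that by blast
  qed
  show ?case
  proof (intro exI[of _ "F0 \<union> (\<Union>n<N. Fn n)"] conjI ballI)
    show "F0 \<union> (\<Union>n<N. Fn n) \<subseteq> S" using F0(1) Fn(1) by blast
    show "finite (F0 \<union> (\<Union>n<N. Fn n))" using F0(2) Fn(2) by simp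
    fix s assume s: "s \<in> S"
    show "\<exists>t\<in>F0 \<union> (\<Union>n<N. Fn n). \<forall>e\<in>insert i I. len t e \<le> len s e"
    proof (cases "len s i < N")
      case True
      obtain t where t: "t \<in> Fn (len s i)" "\<forall>e\<in>I. len t e \<le> len s e" using Fn(3)[OF s] by blast
      then have "len t i = len s i" using Fn(1) by blast
      then show ?thesis using t True by (intro bexI[of _ t]) auto
    next
      case False
      obtain t where t: "t \<in> F0" "\<forall>e\<in>I. len t e \<le> len s e" using F0(3)[OF s] by blast
      then have "len t i \<le> len s i" using N[OF t(1)] False by linarith
      then show ?thesis using t by (intro bexI[of _ t]) auto
    qed
  qed
qed

text \<open>The code t consists of the number of vertices, the edges and the weights of a contracted
  graph R, named by initial natural numbers. The numbers of vertices of the paths are indexed by the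
  edges of the code, so that they are comparable between graphs with the same code.\<close>

definition encodes :: "'v wgraph \<Rightarrow> nat \<times> nat set set \<times> int list \<Rightarrow> (nat set \<Rightarrow> nat) \<Rightarrow> bool" where
  "encodes G t L \<longleftrightarrow> (\<exists>P R h. subdivided P G R \<and> bij_betw h (verts R) {..<fst t} \<and>
     fst (snd t) = (`) h ` edges R \<and> (\<forall>v\<in>verts R. weight R v = snd (snd t) ! h v) \<and>
     (\<forall>e\<in>edges R. L (h ` e) = length (P e)))"

lemma encodes_exists:
  assumes "bounded_core K D A G"
  shows "\<exists>L n ED ws. n \<le> 4 + K + K * D + K * D * D \<and> ED \<subseteq> Pow {..<n} \<and> length ws = n \<and>
    set ws \<subseteq> {0..int A} \<and> encodes G (n, ED, ws) L"
proof -
  obtain R P where R: "subdivided P G R" "bounded_core K D A R" "card (verts R) \<le> 4 + K + K * D + K * D * D"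
    using bounded_core_reduce[OF assms] by blast
  interpret C: core_graph K D A R using R(2) by unfold_locales
  define n where "n = card (verts R)"
  obtain h where h: "bij_betw h (verts R) {..<n}"
    using ex_bij_betw_finite_nat[OF C.fin] unfolding n_def atLeast0LessThan by blast
  have inj: "inj_on h (verts R)" using h unfolding bij_betw_def by blast
  define ws where "ws = map (\<lambda>k. weight R (inv_into (verts R) h k)) [0..<n]"
  define L where "L d = length (P (inv_into (verts R) h ` d))" for d
  have inv: "inv_into (verts R) h (h v) = v" if "v \<in> verts R" for v using inj that by simp
  have "encodes G (n, (`) h ` edges R, ws) L"
    unfolding encodes_def fst_conv snd_conv
  proof (intro exI conjI ballI)
    show "subdivided P G R" by (rule R(1))
    show "bij_betw h (verts R) {..<n}" by (rule h)
    show "weight R v = ws ! h v" if "v \<in> verts R" for v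
    proof -
      have "h v < n" using h that bij_betwE by blast
      then show ?thesis unfolding ws_def using inv[OF that] by simp
    qed
    show "L (h ` e) = length (P e)" if "e \<in> edges R" for e
    proof -
      have "inv_into (verts R) h ` h ` e = e" using C.edge[OF that] inv by force
      then show ?thesis unfolding L_def by simp
    qed
  qed simp
  moreover have "(`) h ` edges R \<subseteq> Pow {..<n}"
    using C.edge h bij_betwE by blast
  moreover have "set ws \<subseteq> {0..int A}"
  proof -
    have "inv_into (verts R) h k \<in> verts R" if "k < n" for k
      using h that inv_into_into[of k h "verts R"] unfolding bij_betw_def by blast
    then show ?thesis unfolding ws_def using C.weight_le by auto
  qed
  moreover have "length ws = n" unfolding ws_def by simp
  ultimately show ?thesis using R(3) unfolding n_def by blast
qed

lemma encodes_compare: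
  fixes G :: "'v wgraph" and H :: "nat wgraph"
  assumes G: "encodes G t L" and H: "encodes H t L'" and fin: "finite (verts G)" "finite (verts H)"
    and le: "\<And>d. d \<in> fst (snd t) \<Longrightarrow> L' d \<le> L d"
  shows "\<exists>G' :: nat wgraph. unit_odd_subdivision G' H \<and> wgraph_iso G G'"
proof -
  from G[unfolded encodes_def] obtain P R h where R0: "subdivided P G R \<and> bij_betw h (verts R) {..<fst t} \<and>
     fst (snd t) = (`) h ` edges R \<and> (\<forall>v\<in>verts R. weight R v = snd (snd t) ! h v) \<and>
     (\<forall>e\<in>edges R. L (h ` e) = length (P e))" by (elim exE)
  then have R: "subdivided P G R" "bij_betw h (verts R) {..<fst t}" "fst (snd t) = (`) h ` edges R"
    "\<And>v. v \<in> verts R \<Longrightarrow> weight R v = snd (snd t) ! h v" "\<And>e. e \<in> edges R \<Longrightarrow> L (h ` e) = length (P e)"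
    by simp_all
  from H[unfolded encodes_def] obtain Q S k where S0: "subdivided Q H S \<and> bij_betw k (verts S) {..<fst t} \<and>
     fst (snd t) = (`) k ` edges S \<and> (\<forall>v\<in>verts S. weight S v = snd (snd t) ! k v) \<and>
     (\<forall>e\<in>edges S. L' (k ` e) = length (Q e))" by (elim exE)
  then have S: "subdivided Q H S" "bij_betw k (verts S) {..<fst t}" "fst (snd t) = (`) k ` edges S"
    "\<And>v. v \<in> verts S \<Longrightarrow> weight S v = snd (snd t) ! k v" "\<And>e. e \<in> edges S \<Longrightarrow> L' (k ` e) = length (Q e)"
    by simp_all
  interpret R: subdivided P G R by (rule R(1))
  interpret S: subdivided Q H S by (rule S(1))
  define k' where "k' = inv_into (verts S) k"
  define g where "g = k' \<circ> h"
  have k': "bij_betw k' {..<fst t} (verts S)" unfolding k'_def using S(2) by (rule bij_betw_inv_into)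
  have g: "bij_betw g (verts R) (verts S)" unfolding g_def using R(2) k' by (rule bij_betw_trans)
  have kk: "k' (k v) = v" if "v \<in> verts S" for v
    unfolding k'_def using S(2) that by (simp add: bij_betw_inv_into_left)
  have kg: "k (g v) = h v" if "v \<in> verts R" for v
  proof -
    have "h v \<in> {..<fst t}" using R(2) that bij_betwE by blast
    then show ?thesis unfolding g_def k'_def using bij_betw_inv_into_right[OF S(2)] by simp
  qed
  have kge: "k ` g ` e = h ` e" if "e \<in> edges R" for e
    using R.edges_in[OF that] kg by force
  have k'k: "k' ` k ` d = d" if "d \<in> edges S" for d
    using S.edges_in[OF that] kk by force
  have "(`) g ` edges R = (`) k' ` ((`) h ` edges R)"
    unfolding g_def by (simp add: image_comp image_image)
  also have "\<dots> = (`) k' ` ((`) k ` edges S)" using R(3) S(3) by simp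
  also have "\<dots> = (\<lambda>d. k' ` k ` d) ` edges S" by (rule image_image)
  also have "\<dots> = (\<lambda>d. d) ` edges S" by (rule image_cong[OF refl]) (rule k'k)
  finally have gE: "edges S = (`) g ` edges R" by simp
  show ?thesis
  proof (rule subdivision_compare[OF R(1) S(1) fin g gE])
    fix v assume v: "v \<in> verts R"
    have "g v \<in> verts S" using g v bij_betwE by blast
    then show "weight S (g v) = weight R v" using S(4) R(4)[OF v] kg[OF v] by simp
  next
    fix e assume e: "e \<in> edges R"
    then have "g ` e \<in> edges S" using gE by blast
    from S(5)[OF this] have "length (Q (g ` e)) = L' (h ` e)" unfolding kge[OF e] by (rule sym)
    also have "\<dots> \<le> L (h ` e)" using le R(3) e by blast
    finally show "length (Q (g ` e)) \<le> length (P e)" using R(5)[OF e] by simp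
  qed
qed

text \<open>Contracted graphs of bounded size have finitely many codes. For each code, Dickson's
  lemma selects finitely many graphs of the family itself, so the basis inherits every property of
  the family.\<close>

theorem finite_basis:
  fixes \<G> :: "nat wgraph set"
  assumes "\<And>G. G \<in> \<G> \<Longrightarrow> bounded_core K D A G"
  shows "\<exists>C\<subseteq>\<G>. finite C \<and> (\<forall>G\<in>\<G>. \<exists>H\<in>C. \<exists>G'. unit_odd_subdivision G' H \<and> wgraph_iso G G')"
proof -
  define n0 where "n0 = 4 + K + K * D + K * D * D"
  define T :: "(nat \<times> nat set set \<times> int list) set" where
    "T = {..n0} \<times> Pow (Pow {..<n0}) \<times> {ws. set ws \<subseteq> {0..int A} \<and> length ws \<le> n0}"
  have finT: "finite T" unfolding T_def using finite_lists_length_le[of "{0..int A}" n0] by simp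
  have code: "\<exists>t\<in>T. \<exists>L. encodes G t L" if G: "G \<in> \<G>" for G
  proof -
    obtain L n ED ws where c: "n \<le> n0" "ED \<subseteq> Pow {..<n}" "length ws = n" "set ws \<subseteq> {0..int A}" "encodes G (n, ED, ws) L"
      using encodes_exists[OF assms[OF G]] unfolding n0_def by blast
    have "Pow {..<n} \<subseteq> Pow {..<n0}" using c(1) by (intro Pow_mono) auto
    then have "(n, ED, ws) \<in> T" using c unfolding T_def by auto
    then show ?thesis using c(5) by blast
  qed
  define S where "S t = {(G, L). G \<in> \<G> \<and> encodes G t L}" for t
  have "\<forall>t\<in>T. \<exists>F\<subseteq>S t. finite F \<and> (\<forall>s\<in>S t. \<exists>r\<in>F. \<forall>d\<in>fst (snd t). snd r d \<le> snd s d)"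
  proof
    fix t assume "t \<in> T"
    then have "fst (snd t) \<subseteq> Pow {..<n0}" unfolding T_def by auto
    then have "finite (fst (snd t))" using finite_subset by blast
    from finite_minimal_elements[OF this, of "S t" snd]
    show "\<exists>F\<subseteq>S t. finite F \<and> (\<forall>s\<in>S t. \<exists>r\<in>F. \<forall>d\<in>fst (snd t). snd r d \<le> snd s d)" .
  qed
  then obtain F where F: "\<And>t. t \<in> T \<Longrightarrow> F t \<subseteq> S t" "\<And>t. t \<in> T \<Longrightarrow> finite (F t)"
    "\<And>t s. t \<in> T \<Longrightarrow> s \<in> S t \<Longrightarrow> \<exists>r\<in>F t. \<forall>d\<in>fst (snd t). snd r d \<le> snd s d" by metis
  define C where "C = fst ` (\<Union>t\<in>T. F t)"
  have fin: "finite (verts G)" if "G \<in> \<G>" for G using assms[OF that] unfolding bounded_core_def by blast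
  have "C \<subseteq> \<G>" unfolding C_def using F(1) unfolding S_def by fastforce
  moreover have "finite C" unfolding C_def using finT F(2) by blast
  moreover have "\<exists>H\<in>C. \<exists>G'. unit_odd_subdivision G' H \<and> wgraph_iso G G'" if G: "G \<in> \<G>" for G
  proof -
    obtain t L where t: "t \<in> T" "encodes G t L" using code[OF G] by blast
    then have "(G, L) \<in> S t" using G unfolding S_def by blast
    from F(3)[OF t(1) this] obtain r where r: "r \<in> F t" "\<forall>d\<in>fst (snd t). snd r d \<le> L d" by auto
    obtain H L' where HL: "r = (H, L')" by (cases r)
    have H: "H \<in> \<G>" "encodes H t L'" using F(1)[OF t(1)] r(1) HL unfolding S_def by auto
    have "\<exists>G'. unit_odd_subdivision G' H \<and> wgraph_iso G G'"
      using encodes_compare[OF t(2) H(2) fin[OF G] fin[OF H(1)]] r(2) HL by auto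
    moreover have "H \<in> C" unfolding C_def using r(1) HL t(1) by force
    ultimately show ?thesis by blast
  qed
  ultimately show ?thesis by blast
qed

section \<open>Facet-defining graphs\<close>

text \<open>Moves a graph to another vertex type; one collection on the natural numbers can then
  serve every vertex type.\<close>

definition relabel :: "('v \<Rightarrow> 'w) \<Rightarrow> 'v wgraph \<Rightarrow> 'w wgraph" where
  "relabel f G = \<lparr>verts = f ` verts G, edges = (`) f ` edges G,
    weight = \<lambda>y. weight G (inv_into (verts G) f y)\<rparr>"

context
  fixes f :: "'v \<Rightarrow> 'w" and G :: "'v wgraph"
  assumes wg: "weighted_graph G" and inj: "inj_on f (verts G)"
begin

lemma relabel_verts [simp]: "verts (relabel f G) = f ` verts G"
  and relabel_edges [simp]: "edges (relabel f G) = (`) f ` edges G"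
  unfolding relabel_def by auto

lemma relabel_weight: "v \<in> verts G \<Longrightarrow> weight (relabel f G) (f v) = weight G v"
  unfolding relabel_def using inj by simp

lemma edges_sub: "e \<in> edges G \<Longrightarrow> e \<subseteq> verts G"
  using wg unfolding weighted_graph_def by blast

lemma inj_edges: "inj_on ((`) f) (edges G)"
  by (rule inj_onI) (use inj_on_image_eq_iff[OF inj] edges_sub in blast)

lemma relabel_weighted: "weighted_graph (relabel f G)"
proof -
  have "card (f ` e) = 2" if "e \<in> edges G" for e
    using card_image[OF inj_on_subset[OF inj edges_sub[OF that]]] wg that unfolding weighted_graph_def by simp
  moreover have "card (f ` verts G) = card (verts G)" by (rule card_image[OF inj])
  ultimately show ?thesis
    using wg edges_sub relabel_weight unfolding weighted_graph_def by auto
qed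

lemma relabel_value:
  assumes S: "S \<subseteq> verts G"
  shows "sum (weight (relabel f G)) (f ` S) - int (num_induced_edges (relabel f G) (f ` S))
    = sum (weight G) S - int (num_induced_edges G S)"
proof -
  have "sum (weight (relabel f G)) (f ` S) = (\<Sum>v\<in>S. weight (relabel f G) (f v))"
    using sum.reindex[OF inj_on_subset[OF inj S]] by simp
  also have "\<dots> = sum (weight G) S" by (rule sum.cong) (use S relabel_weight in auto)
  finally have 1: "sum (weight (relabel f G)) (f ` S) = sum (weight G) S" .
  have "{e \<in> edges (relabel f G). e \<subseteq> f ` S} = (`) f ` {e \<in> edges G. e \<subseteq> S}"
    using inj_on_image_subset_iff[OF inj _ S] edges_sub by auto
  moreover have "inj_on ((`) f) {e \<in> edges G. e \<subseteq> S}" by (rule inj_on_subset[OF inj_edges]) auto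
  ultimately have "num_induced_edges (relabel f G) (f ` S) = num_induced_edges G S"
    unfolding num_induced_edges_def by (simp add: card_image)
  then show ?thesis using 1 by simp
qed

lemma relabel_beta: "beta (relabel f G) = beta G"
proof -
  have "(\<lambda>S. sum (weight (relabel f G)) S - int (num_induced_edges (relabel f G) S)) ` Pow (f ` verts G)
    = (\<lambda>S. sum (weight (relabel f G)) (f ` S) - int (num_induced_edges (relabel f G) (f ` S))) ` Pow (verts G)"
    unfolding image_Pow_surj[OF refl, symmetric] image_image ..
  also have "\<dots> = (\<lambda>S. sum (weight G) S - int (num_induced_edges G S)) ` Pow (verts G)"
    by (rule image_cong) (use relabel_value in auto)
  finally show ?thesis unfolding beta_def by simp
qed

lemma relabel_subdefect: "subdefect (relabel f G) = subdefect G"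
proof -
  have "sum (weight (relabel f G)) (f ` verts G) = (\<Sum>v\<in>verts G. weight (relabel f G) (f v))"
    using sum.reindex[OF inj] by simp
  also have "\<dots> = sum (weight G) (verts G)" by (rule sum.cong) (use relabel_weight in auto)
  finally show ?thesis unfolding subdefect_def relabel_beta by simp
qed

lemma relabel_graphical_lhs:
  fixes i i' :: "'v \<Rightarrow> 'n" and j j' :: "'w \<Rightarrow> 'n"
  assumes i: "\<And>v. v \<in> verts G \<Longrightarrow> j (f v) = i v" "\<And>v. v \<in> verts G \<Longrightarrow> j' (f v) = i' v"
  shows "graphical_lhs j j' (relabel f G) = graphical_lhs i i' G"
proof
  fix x :: "'n \<times> 'n \<Rightarrow>\<^sub>0 real"
  have "(\<Sum>v\<in>verts (relabel f G). of_int (weight (relabel f G) v) * Poly_Mapping.lookup x (j v, j' v))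
    = (\<Sum>v\<in>verts G. of_int (weight (relabel f G) (f v)) * Poly_Mapping.lookup x (j (f v), j' (f v)))"
    using sum.reindex[OF inj] by simp
  also have "\<dots> = (\<Sum>v\<in>verts G. of_int (weight G v) * Poly_Mapping.lookup x (i v, i' v))"
    by (rule sum.cong) (use i relabel_weight in auto)
  finally have 1: "(\<Sum>v\<in>verts (relabel f G). of_int (weight (relabel f G) v) * Poly_Mapping.lookup x (j v, j' v)) = \<dots>" .
  let ?D = "{(v, w). v \<in> verts G \<and> w \<in> verts G \<and> {v, w} \<in> edges G}"
  have mem: "{f v, f w} \<in> (`) f ` edges G \<longleftrightarrow> {v, w} \<in> edges G" if "v \<in> verts G" "w \<in> verts G" for v w
  proof
    assume "{f v, f w} \<in> (`) f ` edges G"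
    then obtain e where e: "e \<in> edges G" "f ` {v, w} = f ` e" by auto
    then have "{v, w} = e" using inj_on_image_eq_iff[OF inj, of "{v, w}" e] edges_sub that by auto
    then show "{v, w} \<in> edges G" using e by simp
  next
    assume "{v, w} \<in> edges G"
    then have "f ` {v, w} \<in> (`) f ` edges G" by (rule imageI)
    then show "{f v, f w} \<in> (`) f ` edges G" by simp
  qed
  have D: "{(v, w). v \<in> verts (relabel f G) \<and> w \<in> verts (relabel f G) \<and> {v, w} \<in> edges (relabel f G)}
    = map_prod f f ` ?D"
  proof (intro equalityI subsetI)
    fix p assume "p \<in> {(v, w). v \<in> verts (relabel f G) \<and> w \<in> verts (relabel f G) \<and> {v, w} \<in> edges (relabel f G)}"
    then obtain v w where vw: "p = (f v, f w)" "v \<in> verts G" "w \<in> verts G" "{f v, f w} \<in> (`) f ` edges G"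
      by (cases p) auto
    then have "(v, w) \<in> ?D" using mem by simp
    then have "map_prod f f (v, w) \<in> map_prod f f ` ?D" by (rule imageI)
    then show "p \<in> map_prod f f ` ?D" unfolding vw(1) by simp
  next
    fix p assume "p \<in> map_prod f f ` ?D"
    then obtain v w where vw: "p = (f v, f w)" "v \<in> verts G" "w \<in> verts G" "{v, w} \<in> edges G" by auto
    then show "p \<in> {(v, w). v \<in> verts (relabel f G) \<and> w \<in> verts (relabel f G) \<and> {v, w} \<in> edges (relabel f G)}"
      using mem by simp
  qed
  have "inj_on (map_prod f f) ?D"
    using inj unfolding inj_on_def by auto
  from sum.reindex[OF this, of "\<lambda>(v, w). Poly_Mapping.lookup x (j v, j' w)"]
  have "(\<Sum>(v, w)\<in>map_prod f f ` ?D. Poly_Mapping.lookup x (j v, j' w))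
    = (\<Sum>(v, w)\<in>?D. Poly_Mapping.lookup x (j (f v), j' (f w)))"
    by (simp add: case_prod_unfold)
  also have "\<dots> = (\<Sum>(v, w)\<in>?D. Poly_Mapping.lookup x (i v, i' w))"
    by (rule sum.cong) (use i in auto)
  finally show "graphical_lhs j j' (relabel f G) x = graphical_lhs i i' G x"
    unfolding graphical_lhs_def D 1 by simp
qed

text \<open>The ground set stays the same. Composing its two embeddings with the inverse of f yields
  literally the same functional, so there is nothing to transport in the polytope.\<close>

lemma relabel_facet_defining:
  assumes "facet_defining_graph G"
  shows "facet_defining_graph (relabel f G)"
proof -
  obtain N :: "nat set" and i i' where ground: "ground_set_for N i i' (verts G)"
    and df: "defines_facet (graphical_lhs i i' G) (of_int (beta G)) (linear_ordering_polytope N)"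
    using assms unfolding facet_defining_graph_def by blast
  define g where "g = inv_into (verts G) f"
  have gf: "g (f v) = v" if "v \<in> verts G" for v unfolding g_def using inj that by simp
  have img: "(i \<circ> g) ` f ` verts G = i ` verts G" "(i' \<circ> g) ` f ` verts G = i' ` verts G"
    using gf by (auto simp: image_image)
  have "inj_on (i \<circ> g) (f ` verts G)" "inj_on (i' \<circ> g) (f ` verts G)"
    using ground gf unfolding ground_set_for_def inj_on_def by auto
  then have "ground_set_for N (i \<circ> g) (i' \<circ> g) (verts (relabel f G))"
    using ground img unfolding ground_set_for_def by simp
  moreover have "graphical_lhs (i \<circ> g) (i' \<circ> g) (relabel f G) = graphical_lhs i i' G"
    by (rule relabel_graphical_lhs) (use gf in auto)
  ultimately show ?thesis
    unfolding facet_defining_graph_def relabel_beta using relabel_weighted df by metis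
qed

lemma relabel_iso: "wgraph_iso G (relabel f G)"
  unfolding relabel_def by (rule wgraph_iso_image[OF inj])

end

lemma wgraph_iso_trans:
  assumes "wgraph_iso G H" "wgraph_iso H J"
  shows "wgraph_iso G J"
proof -
  from assms(1)[unfolded wgraph_iso_def] obtain f where f: "bij_betw f (verts G) (verts H) \<and>
    edges H = (\<lambda>e. f ` e) ` edges G \<and> (\<forall>v\<in>verts G. weight H (f v) = weight G v)" by (elim exE)
  from assms(2)[unfolded wgraph_iso_def] obtain g where g: "bij_betw g (verts H) (verts J) \<and>
    edges J = (\<lambda>e. g ` e) ` edges H \<and> (\<forall>v\<in>verts H. weight J (g v) = weight H v)" by (elim exE)
  show ?thesis
    unfolding wgraph_iso_def
  proof (intro exI[of _ "g \<circ> f"] conjI ballI)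
    show "bij_betw (g \<circ> f) (verts G) (verts J)"
      using bij_betw_trans[OF f[THEN conjunct1] g[THEN conjunct1]] .
    have "edges J = (\<lambda>e. g ` e) ` (\<lambda>e. f ` e) ` edges G" using f g by simp
    then show "edges J = (\<lambda>e. (g \<circ> f) ` e) ` edges G" by (simp add: image_image)
    fix v assume v: "v \<in> verts G"
    then have "f v \<in> verts H" using bij_betwE[OF f[THEN conjunct1]] by blast
    then show "weight J ((g \<circ> f) v) = weight G v" using f g v by simp
  qed
qed

lemma facet_defining_bounded_core:
  assumes facet: "facet_defining_graph G" and lam: "subdefect G = int lam"
  shows "bounded_core (core_limit lam) (weight_limit lam * missed_limit lam) (weight_limit lam) G"
proof -
  have wg: "weighted_graph G" using facet unfolding facet_defining_graph_def by blast
  interpret ranked_graph G lam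
  proof
    fix zv ze k
    assume "\<And>S. tight_set G S \<Longrightarrow> (\<Sum>v\<in>S. zv v) - (\<Sum>e\<in>{e \<in> edges G. e \<subseteq> S}. ze e) = (k :: real)"
    then show "\<exists>\<mu>. (\<forall>v\<in>verts G. zv v = \<mu> * of_int (weight G v)) \<and> (\<forall>e\<in>edges G. ze e = \<mu>)"
      by (rule facet_defining_rank[OF facet])
  qed (fact wg lam)+
  show ?thesis
    unfolding bounded_core_def
  proof (intro conjI ballI allI impI)
    show "finite V" by (rule finV)
    show "V \<noteq> {}" using third_vertex by blast
    show "e \<subseteq> V" "card e = 2" if "e \<in> E" for e using that edge_sub edge_card by blast+
    show "U = V" if "U \<subseteq> V" "U \<noteq> {}" "\<forall>u v. u \<in> U \<longrightarrow> {u, v} \<in> E \<longrightarrow> v \<in> U" for U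
      by (rule graph_connected[OF that(1,2)]) (use that(3) in blast)
    show "card (core G) \<le> core_limit lam"
      unfolding core_def degree_def by (rule card_core)
    show "degree G v \<le> weight_limit lam * missed_limit lam" if "v \<in> V" for v
      unfolding degree_def by (rule degree_bound[OF that])
    show "0 \<le> weight G v" "weight G v \<le> int (weight_limit lam)" if "v \<in> V" for v
      using weight_pos[OF that] weight_bound[OF that] int_wt[OF that] by linarith+
  qed
qed

theorem corollary2:
  fixes lam :: int
  assumes "lam \<ge> 1"
  shows "\<exists>C :: nat wgraph set.
           finite C \<and> (\<forall>H\<in>C. facet_defining_graph H) \<and>
           (\<forall>G :: 'v wgraph. facet_defining_graph G \<and> subdefect G = lam \<longrightarrow>
              (\<exists>H\<in>C. \<exists>G' :: nat wgraph. unit_odd_subdivision G' H \<and> wgraph_iso G G'))"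
proof -
  \<comment> \<open>By \<open>relabel\<close> this family contains an isomorphic copy of every graph
    in question, whatever its vertex type.\<close>
  define \<G> where "\<G> = {G :: nat wgraph. facet_defining_graph G \<and> subdefect G = lam}"
  have bc: "bounded_core (core_limit (nat lam)) (weight_limit (nat lam) * missed_limit (nat lam))
      (weight_limit (nat lam)) G" if "G \<in> \<G>" for G
  proof (rule facet_defining_bounded_core)
    show "subdefect G = int (nat lam)" using that assms unfolding \<G>_def by simp
  qed (use that in \<open>simp add: \<G>_def\<close>)
  from finite_basis[of \<G>, OF bc] obtain C where C: "C \<subseteq> \<G>" "finite C"
    "\<forall>G\<in>\<G>. \<exists>H\<in>C. \<exists>G'. unit_odd_subdivision G' H \<and> wgraph_iso G G'"
    by blast
  have "\<exists>H\<in>C. \<exists>G' :: nat wgraph. unit_odd_subdivision G' H \<and> wgraph_iso G G'"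
    if G: "facet_defining_graph G" "subdefect G = lam" for G :: "'v wgraph"
  proof -
    have wg: "weighted_graph G" using G(1) unfolding facet_defining_graph_def by blast
    then have "finite (verts G)" unfolding weighted_graph_def by blast
    then obtain f :: "'v \<Rightarrow> nat" where f: "inj_on f (verts G)"
      using finite_imp_inj_to_nat_seg by blast
    have "relabel f G \<in> \<G>"
      unfolding \<G>_def using relabel_facet_defining[OF wg f G(1)] relabel_subdefect[OF wg f] G(2) by simp
    from bspec[OF C(3) this] obtain H G' where "H \<in> C" "unit_odd_subdivision G' H" "wgraph_iso (relabel f G) G'"
      by blast
    then show ?thesis using wgraph_iso_trans[OF relabel_iso[OF wg f]] by blast
  qed
  moreover have "\<forall>H\<in>C. facet_defining_graph H" using C(1) unfolding \<G>_def by blast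
  ultimately show ?thesis using C(2) by blast
qed

end
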